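(* Let $G$ be a compact Lie group, $\phi: G \to \mathbb{Z}_2$ a surjective homomorphism (so that $(G,\phi)$ is a magnetic group), $G_0=\ker\phi$, and $\iota: G_0\to G$ the inclusion. Let $X$ be a compact $G$-space. Then the restriction homomorphism $\iota^*:\mathcal{K}_G^*(X)\to K_{G_0}^*(X)$, from magnetic $G$-equivariant K-theory to complex $G_0$-equivariant K-theory, takes values in the $\mathbb{Z}_2$-invariant subgroup, $$\iota^*:\mathcal{K}_G^*(X)\to K_{G_0}^*(X)^{\mathbb{Z}_2},$$ where $\mathbb{Z}_2$ acts by the conjugation involution $F\mapsto a_0^*\overline{F}$ (for any $a_0\in G\setminus G_0$), and it becomes an isomorphism rationally: $$\iota^*\otimes\mathbb{Q}:\mathcal{K}_G^*(X)\otimes\mathbb{Q}\xrightarrow{\ \cong\ }K_{G_0}^*(X)^{\mathbb{Z}_2}\otimes\mathbb{Q}.$$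
   Context: **Magnetic groups.** A magnetic group is a group $G$ together with a surjective homomorphism $\phi:G\to\mathbb{Z}_2$; write $G_0=\ker\phi$. Here $G$ is a compact Lie group, and $\phi$ is continuous. **Magnetic bundles.** Let $X$ be a compact $G$-space. A magnetic $G$-equivariant vector bundle over $X$ is a complex vector bundle $p:E\to X$ with a $G$-action on $E$ making $p$ equivariant, such that elements of $G_0$ act complex linearly on the fibers and elements of $G\setminus G_0$ act complex anti-linearly on the fibers. A homomorphism of such bundles is a $G$-equivariant homomorphism of the underlying complex vector bundles. **K-groups.** $\mathcal{K}_G(X)$ is the Grothendieck group of isomorphism classes of magnetic $G$-equivariant vector bundles over $X$ under direct sum: formal differences $E_0-E_1$, with $E_0-E_1\sim E_0'-E_1'$ iff $E_0\oplus E_1'\oplus F\cong E_0'\oplus E_1\oplus F$ for some magnetic $G$-equivariant bundle $F$. $K_{G_0}(X)$ is the usual (Segal) complex $G_0$-equivariant K-theory. For a base point $x_0$ fixed by the group, the reduced group is $\widetilde{\mathcal{K}}_G(X)=\ker(\mathcal{K}_G(X)\to\mathcal{K}_G(\{x_0\}))$. For a pair $(X,Y)$ of compact $G$-spaces, $\mathcal{K}_G(X,Y)=\widetilde{\mathcal{K}}_G(X/Y)$, with $X/\emptyset=X_+$ ($X$ with a disjoint base point). For $q\ge 0$, $$\mathcal{K}_G^{-q}(X,Y)=\mathcal{K}_G(X\times B^q,\ X\times S^{q-1}\cup Y\times B^q),$$ where $G$ acts trivially on the unit ball $B^q$ and its boundary sphere $S^{q-1}$, and $\mathcal{K}_G^{-q}(X)=\mathcal{K}_G^{-q}(X,\emptyset)$.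 The groups $K_{G_0}^{-q}$ are defined in the same way. Magnetic K-theory is 8-periodic, $\mathcal{K}_G^{-q-8}(X)\cong\mathcal{K}_G^{-q}(X)$, and positive degrees are defined by this periodicity (similarly, compatibly with the maps below, for $K_{G_0}^*$). The superscript $*$ denotes an arbitrary integer degree. **Restriction.** $\iota^*:\mathcal{K}_G^*(X)\to K_{G_0}^*(X)$ is induced by regarding a magnetic $G$-equivariant bundle as a complex $G_0$-equivariant bundle. **The $\mathbb{Z}_2$-action.** Choose $a_0\in G\setminus G_0$. For a complex $G_0$-equivariant bundle $p:F\to X$, let $\overline{F}$ be the complex conjugate bundle (the element corresponding to $s\in F$ is written $\overline{s}$) and put $$a_0^*\overline{F}=\{(\overline{s},x)\in\overline{F}\times X\mid p(s)=a_0x\},$$ a bundle over $X$ by projection to the second coordinate, with complex structure $\lambda\cdot(\overline{s},x)=(\overline{\bar\lambda s},x)$ for $\lambda\in\mathbb{C}$ and $G_0$-action $g\cdot(\overline{s},x)=(\overline{a_0ga_0^{-1}s},gx)$. The assignment $F\mapsto a_0^*\overline{F}$ induces an involution of $K_{G_0}(X)$ that is independent of the choice of $a_0$; applying the same construction over the (pairs of) spaces defining $K_{G_0}^{-q}(X)$ gives an involution on $K_{G_0}^*(X)$ in every degree. $K_{G_0}^*(X)^{\mathbb{Z}_2}$ is the subgroup of elements fixed by this involution. *)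

theory Defs
  imports "HOL-Analysis.Analysis" "HOL-Algebra.Free_Abelian_Groups"
begin

section \<open>Compact Lie groups and magnetic groups\<close>

text \<open>
  Smoothness is taken on relatively open subsets of \<^const>\<open>Euclidean_space\<close>, so that the dimension
  is an ordinary natural number; dimension 0, i.e.\ finite groups, is included.
  A function is \<open>C\<^sup>k\<^sup>+\<^sup>1\<close> iff it is continuous and its first partial derivatives exist and are \<open>C\<^sup>k\<close>.
\<close>

primrec Ck_on :: "nat \<Rightarrow> nat \<Rightarrow> (nat \<Rightarrow> real) set \<Rightarrow> ((nat \<Rightarrow> real) \<Rightarrow> real) \<Rightarrow> bool" where
  "Ck_on 0 m W f \<longleftrightarrow> continuous_map (subtopology (Euclidean_space m) W) euclideanreal f"
| "Ck_on (Suc k) m W f \<longleftrightarrow>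
     continuous_map (subtopology (Euclidean_space m) W) euclideanreal f \<and>
     (\<exists>D. \<forall>i<m. (\<forall>x\<in>W. ((\<lambda>t. f (x(i := t))) has_real_derivative D i x) (at (x i))) \<and>
                Ck_on k m W (D i))"

definition smooth_map_on ::
  "nat \<Rightarrow> nat \<Rightarrow> (nat \<Rightarrow> real) set \<Rightarrow> ((nat \<Rightarrow> real) \<Rightarrow> nat \<Rightarrow> real) \<Rightarrow> bool" where
  "smooth_map_on m d W f \<longleftrightarrow>
     openin (Euclidean_space m) W \<and> f ` W \<subseteq> topspace (Euclidean_space d) \<and>
     (\<forall>i<d. \<forall>k. Ck_on k m W (\<lambda>x. f x i))"

text \<open>The two halves of a point of \<open>\<real>\<^sup>2\<^sup>d = \<real>\<^sup>d \<times> \<real>\<^sup>d\<close>.\<close>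

definition half1 :: "nat \<Rightarrow> (nat \<Rightarrow> real) \<Rightarrow> nat \<Rightarrow> real" where
  "half1 d u = (\<lambda>i. if i < d then u i else 0)"

definition half2 :: "nat \<Rightarrow> (nat \<Rightarrow> real) \<Rightarrow> nat \<Rightarrow> real" where
  "half2 d u = (\<lambda>i. if i < d then u (d + i) else 0)"

definition smooth_atlas :: "nat \<Rightarrow> 'g topology \<Rightarrow> ('g set \<times> ('g \<Rightarrow> nat \<Rightarrow> real)) set \<Rightarrow> bool" where
  "smooth_atlas d T \<A> \<longleftrightarrow>
     (\<forall>(U, h)\<in>\<A>. openin T U \<and> openin (Euclidean_space d) (h ` U) \<and>
        homeomorphic_map (subtopology T U) (subtopology (Euclidean_space d) (h ` U)) h) \<and>
     (\<Union>(U, h)\<in>\<A>. U) = topspace T \<and>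
     (\<forall>(U, h)\<in>\<A>. \<forall>(V, k)\<in>\<A>. smooth_map_on d d (h ` (U \<inter> V)) (k \<circ> inv_into U h))"

text \<open>
  The field \<open>phase\<close> is the homomorphism \<open>\<phi> : G \<rightarrow> \<int>\<^sub>2\<close>, where \<open>\<int>\<^sub>2\<close> is
  \<^term>\<open>integer_mod_group 2\<close> with carrier \<open>{0, 1}\<close>.
\<close>

record 'g mgroup = "'g monoid" +
  gtop :: "'g topology"
  phase :: "'g \<Rightarrow> int"

definition topological_group :: "'g mgroup \<Rightarrow> bool" where
  "topological_group G \<longleftrightarrow>
     group G \<and> topspace (gtop G) = carrier G \<and>
     continuous_map (prod_topology (gtop G) (gtop G)) (gtop G) (\<lambda>(g, h). g \<otimes>\<^bsub>G\<^esub> h) \<and>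
     continuous_map (gtop G) (gtop G) (\<lambda>g. inv\<^bsub>G\<^esub> g)"

definition lie_group :: "nat \<Rightarrow> 'g mgroup \<Rightarrow> ('g set \<times> ('g \<Rightarrow> nat \<Rightarrow> real)) set \<Rightarrow> bool" where
  "lie_group d G \<A> \<longleftrightarrow>
     topological_group G \<and> Hausdorff_space (gtop G) \<and> second_countable (gtop G) \<and>
     smooth_atlas d (gtop G) \<A> \<and>
     (\<forall>(U, h)\<in>\<A>. \<forall>(V, k)\<in>\<A>. \<forall>(W, l)\<in>\<A>.
        smooth_map_on (d + d) d
          {u \<in> topspace (Euclidean_space (d + d)).
             half1 d u \<in> h ` U \<and> half2 d u \<in> k ` V \<and>
             inv_into U h (half1 d u) \<otimes>\<^bsub>G\<^esub> inv_into V k (half2 d u) \<in> W}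
          (\<lambda>u. l (inv_into U h (half1 d u) \<otimes>\<^bsub>G\<^esub> inv_into V k (half2 d u)))) \<and>
     (\<forall>(U, h)\<in>\<A>. \<forall>(V, k)\<in>\<A>.
        smooth_map_on d d {u \<in> h ` U. inv\<^bsub>G\<^esub> (inv_into U h u) \<in> V}
          (\<lambda>u. k (inv\<^bsub>G\<^esub> (inv_into U h u))))"

definition compact_lie_group :: "'g mgroup \<Rightarrow> bool" where
  "compact_lie_group G \<longleftrightarrow> compact_space (gtop G) \<and> (\<exists>d \<A>. lie_group d G \<A>)"

definition magnetic_group :: "'g mgroup \<Rightarrow> bool" where
  "magnetic_group G \<longleftrightarrow>
     compact_lie_group G \<and>
     phase G \<in> epi G (integer_mod_group 2) \<and>
     continuous_map (gtop G) (discrete_topology (carrier (integer_mod_group 2))) (phase G)"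

text \<open>The group \<open>G\<^sub>0 = ker \<phi>\<close>, carrying the trivial phase.\<close>

definition even_part :: "'g mgroup \<Rightarrow> 'g mgroup" where
  "even_part G = G\<lparr>carrier := kernel G (integer_mod_group 2) (phase G),
                   gtop := subtopology (gtop G) (kernel G (integer_mod_group 2) (phase G)),
                   phase := (\<lambda>_. 0)\<rparr>"

section \<open>\<open>G\<close>-spaces\<close>

record ('g, 'x) gspace =
  gs_top :: "'x topology"
  gs_act :: "'g \<Rightarrow> 'x \<Rightarrow> 'x"

definition G_space :: "'g mgroup \<Rightarrow> ('g, 'x) gspace \<Rightarrow> bool" where
  "G_space G X \<longleftrightarrow>
     continuous_map (prod_topology (gtop G) (gs_top X)) (gs_top X) (\<lambda>(g, x). gs_act X g x) \<and>
     (\<forall>x\<in>topspace (gs_top X). gs_act X \<one>\<^bsub>G\<^esub> x = x) \<and>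
     (\<forall>g\<in>carrier G. \<forall>h\<in>carrier G. \<forall>x\<in>topspace (gs_top X).
        gs_act X (g \<otimes>\<^bsub>G\<^esub> h) x = gs_act X g (gs_act X h x))"

definition sub_gspace :: "('g, 'x) gspace \<Rightarrow> 'x set \<Rightarrow> ('g, 'x) gspace" where
  "sub_gspace X S = X\<lparr>gs_top := subtopology (gs_top X) S\<rparr>"

text \<open>
  The quotient \<open>X/Y\<close> has \<^const>\<open>None\<close> as base point and \<open>Some x\<close> for \<open>x \<in> X - Y\<close> as its other
  points. The projection \<open>quot_proj Y\<close> is onto unless \<open>Y\<close> is empty, in which case \<^const>\<open>None\<close> is
  an added isolated point, so that \<open>X/\<emptyset> = X\<^sub>+\<close>.
\<close>

definition quot_proj :: "'x set \<Rightarrow> 'x \<Rightarrow> 'x option" where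
  "quot_proj Y x = (if x \<in> Y then None else Some x)"

definition quot_topology :: "'x topology \<Rightarrow> 'x set \<Rightarrow> 'x option topology" where
  "quot_topology T Y = topology (\<lambda>U. U \<subseteq> insert None (Some ` (topspace T - Y)) \<and>
     openin T {x \<in> topspace T. quot_proj Y x \<in> U})"

lemma openin_quot_topology:
  "openin (quot_topology T Y) U \<longleftrightarrow>
     U \<subseteq> insert None (Some ` (topspace T - Y)) \<and> openin T {x \<in> topspace T. quot_proj Y x \<in> U}"
proof -
  let ?P = "\<lambda>U. U \<subseteq> insert None (Some ` (topspace T - Y)) \<and>
     openin T {x \<in> topspace T. quot_proj Y x \<in> U}"
  have "istopology ?P"
    unfolding istopology_def
  proof (intro conjI allI impI)
    fix S S' assume S: "?P S" and S': "?P S'"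
    show "S \<inter> S' \<subseteq> insert None (Some ` (topspace T - Y))" using S by blast
    have "{x \<in> topspace T. quot_proj Y x \<in> S \<inter> S'} =
      {x \<in> topspace T. quot_proj Y x \<in> S} \<inter> {x \<in> topspace T. quot_proj Y x \<in> S'}" by blast
    then show "openin T {x \<in> topspace T. quot_proj Y x \<in> S \<inter> S'}" using S S' by auto
  next
    fix \<K> assume K: "\<forall>K\<in>\<K>. ?P K"
    then show "\<Union>\<K> \<subseteq> insert None (Some ` (topspace T - Y))" by blast
    have "{x \<in> topspace T. quot_proj Y x \<in> \<Union>\<K>} =
      (\<Union>K\<in>\<K>. {x \<in> topspace T. quot_proj Y x \<in> K})" by blast
    then show "openin T {x \<in> topspace T. quot_proj Y x \<in> \<Union>\<K>}"
      using K by (auto intro!: openin_Union)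
  qed
  then show ?thesis by (simp add: quot_topology_def topology_inverse')
qed

lemma topspace_quot_topology:
  "topspace (quot_topology T Y) = insert None (Some ` (topspace T - Y))"
proof -
  have "{x \<in> topspace T. quot_proj Y x \<in> insert None (Some ` (topspace T - Y))} = topspace T"
    by (auto simp: quot_proj_def)
  then have "openin (quot_topology T Y) (insert None (Some ` (topspace T - Y)))"
    by (simp add: openin_quot_topology)
  then show ?thesis
    by (metis openin_quot_topology openin_subset openin_topspace subset_antisym)
qed

lemma quotient_map_quot_proj:
  assumes "Y \<subseteq> topspace T" "Y \<noteq> {}"
  shows "quotient_map T (quot_topology T Y) (quot_proj Y)"
proof -
  have "quot_proj Y ` topspace T = topspace (quot_topology T Y)"
    using assms by (auto simp: topspace_quot_topology quot_proj_def image_iff split: if_splits)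
  then show ?thesis
    by (auto simp: quotient_map_def openin_quot_topology topspace_quot_topology)
qed

definition quot_gspace :: "('g, 'x) gspace \<Rightarrow> 'x set \<Rightarrow> ('g, 'x option) gspace" where
  "quot_gspace X Y = \<lparr>gs_top = quot_topology (gs_top X) Y,
                      gs_act = (\<lambda>g z. Option.bind z (\<lambda>x. quot_proj Y (gs_act X g x)))\<rparr>"

text \<open>The ball \<open>B\<^sup>q\<close> and its boundary \<open>S\<^sup>q\<^sup>-\<^sup>1\<close>; for \<open>q = 0\<close> these are a point and the empty set.\<close>

definition ball_space :: "nat \<Rightarrow> (nat \<Rightarrow> real) topology" where
  "ball_space q = subtopology (Euclidean_space q) {t. (\<Sum>i<q. (t i)\<^sup>2) \<le> 1}"

definition ball_boundary :: "nat \<Rightarrow> (nat \<Rightarrow> real) set" where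
  "ball_boundary q = {t \<in> topspace (Euclidean_space q). (\<Sum>i<q. (t i)\<^sup>2) = 1}"

definition times_ball :: "('g, 'x) gspace \<Rightarrow> nat \<Rightarrow> ('g, 'x \<times> (nat \<Rightarrow> real)) gspace" where
  "times_ball X q = \<lparr>gs_top = prod_topology (gs_top X) (ball_space q),
                     gs_act = (\<lambda>g (x, t). (gs_act X g x, t))\<rparr>"

section \<open>Equivariant vector bundles\<close>

text \<open>\<open>cspace n\<close> is \<open>\<complex>\<^sup>n\<close>, with vectors as sequences vanishing from index \<open>n\<close> on.\<close>

definition cspace :: "nat \<Rightarrow> (nat \<Rightarrow> complex) topology" where
  "cspace n = subtopology (product_topology (\<lambda>_. euclidean) UNIV) {v. \<forall>i\<ge>n. v i = 0}"

record ('e, 'b, 'g) vbundle =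
  tspace :: "'e topology"
  proj :: "'e \<Rightarrow> 'b"
  vadd :: "'e \<Rightarrow> 'e \<Rightarrow> 'e"
  vscale :: "complex \<Rightarrow> 'e \<Rightarrow> 'e"
  vact :: "'g \<Rightarrow> 'e \<Rightarrow> 'e"

definition fibre :: "('e, 'b, 'g) vbundle \<Rightarrow> 'b \<Rightarrow> 'e set" where
  "fibre E b = {e \<in> topspace (tspace E). proj E e = b}"

definition local_triv ::
  "'b topology \<Rightarrow> ('e, 'b, 'g) vbundle \<Rightarrow> 'b set \<Rightarrow> nat \<Rightarrow> ('e \<Rightarrow> 'b \<times> (nat \<Rightarrow> complex)) \<Rightarrow> bool" where
  "local_triv B E U n h \<longleftrightarrow>
     homeomorphic_map (subtopology (tspace E) {e. proj E e \<in> U})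
       (prod_topology (subtopology B U) (cspace n)) h \<and>
     (\<forall>b\<in>U. \<forall>e\<in>fibre E b. fst (h e) = b \<and>
        (\<forall>e'\<in>fibre E b. snd (h (vadd E e e')) = (\<lambda>i. snd (h e) i + snd (h e') i)) \<and>
        (\<forall>c. snd (h (vscale E c e)) = (\<lambda>i. c * snd (h e) i)))"

text \<open>
  A local trivialization restricts to a bijection from each fibre onto \<open>\<complex>\<^sup>n\<close> preserving addition
  and scalar multiplication, under which the fibres are closed; so the fibres are
  complex vector spaces without further axioms. The rank may vary with the base point.
\<close>

definition complex_vector_bundle :: "'b topology \<Rightarrow> ('e, 'b, 'g) vbundle \<Rightarrow> bool" where
  "complex_vector_bundle B E \<longleftrightarrow>
     continuous_map (tspace E) B (proj E) \<and>
     (\<forall>b\<in>topspace B. \<forall>e\<in>fibre E b.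
        (\<forall>e'\<in>fibre E b. vadd E e e' \<in> fibre E b) \<and> (\<forall>c. vscale E c e \<in> fibre E b)) \<and>
     (\<forall>b\<in>topspace B. \<exists>U n h. openin B U \<and> b \<in> U \<and> local_triv B E U n h)"

text \<open>
  If \<open>phase G\<close> is onto, these are the magnetic \<open>G\<close>-equivariant bundles; for \<open>even_part G\<close>, whose
  phase is trivial, they are the complex \<open>G\<^sub>0\<close>-equivariant bundles.
\<close>

definition equivariant_bundle ::
  "'g mgroup \<Rightarrow> ('g, 'b) gspace \<Rightarrow> ('e, 'b, 'g) vbundle \<Rightarrow> bool" where
  "equivariant_bundle G B E \<longleftrightarrow>
     complex_vector_bundle (gs_top B) E \<and>
     continuous_map (prod_topology (gtop G) (tspace E)) (tspace E) (\<lambda>(g, e). vact E g e) \<and>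
     (\<forall>e\<in>topspace (tspace E). vact E \<one>\<^bsub>G\<^esub> e = e) \<and>
     (\<forall>g\<in>carrier G. \<forall>h\<in>carrier G. \<forall>e\<in>topspace (tspace E).
        vact E (g \<otimes>\<^bsub>G\<^esub> h) e = vact E g (vact E h e)) \<and>
     (\<forall>g\<in>carrier G. \<forall>e\<in>topspace (tspace E). proj E (vact E g e) = gs_act B g (proj E e)) \<and>
     (\<forall>g\<in>carrier G. \<forall>b\<in>topspace (gs_top B). \<forall>e\<in>fibre E b. \<forall>e'\<in>fibre E b.
        vact E g (vadd E e e') = vadd E (vact E g e) (vact E g e')) \<and>
     (\<forall>g\<in>carrier G. \<forall>e\<in>topspace (tspace E). \<forall>c.
        vact E g (vscale E c e) = vscale E (if phase G g = 0 then c else cnj c) (vact E g e))"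

definition bundle_hom ::
  "'g mgroup \<Rightarrow> ('g, 'b) gspace \<Rightarrow> ('e, 'b, 'g) vbundle \<Rightarrow> ('f, 'b, 'g) vbundle \<Rightarrow> ('e \<Rightarrow> 'f) \<Rightarrow> bool"
  where
  "bundle_hom G B E F f \<longleftrightarrow>
     continuous_map (tspace E) (tspace F) f \<and>
     (\<forall>e\<in>topspace (tspace E). proj F (f e) = proj E e) \<and>
     (\<forall>b\<in>topspace (gs_top B). \<forall>e\<in>fibre E b. \<forall>e'\<in>fibre E b.
        f (vadd E e e') = vadd F (f e) (f e')) \<and>
     (\<forall>c. \<forall>e\<in>topspace (tspace E). f (vscale E c e) = vscale F c (f e)) \<and>
     (\<forall>g\<in>carrier G. \<forall>e\<in>topspace (tspace E). f (vact E g e) = vact F g (f e))"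

definition bundle_iso ::
  "'g mgroup \<Rightarrow> ('g, 'b) gspace \<Rightarrow> ('e, 'b, 'g) vbundle \<Rightarrow> ('f, 'b, 'g) vbundle \<Rightarrow> bool" where
  "bundle_iso G B E F \<longleftrightarrow>
     (\<exists>f f'. bundle_hom G B E F f \<and> bundle_hom G B F E f' \<and>
        (\<forall>e\<in>topspace (tspace E). f' (f e) = e) \<and> (\<forall>e\<in>topspace (tspace F). f (f' e) = e))"

definition bundle_sum ::
  "('e, 'b, 'g) vbundle \<Rightarrow> ('f, 'b, 'g) vbundle \<Rightarrow> ('e \<times> 'f, 'b, 'g) vbundle" where
  "bundle_sum E F =
     \<lparr>tspace = subtopology (prod_topology (tspace E) (tspace F)) {(e, f). proj E e = proj F f},
      proj = (\<lambda>(e, f). proj E e),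
      vadd = (\<lambda>(e, f) (e', f'). (vadd E e e', vadd F f f')),
      vscale = (\<lambda>c (e, f). (vscale E c e, vscale F c f)),
      vact = (\<lambda>g (e, f). (vact E g e, vact F g f))\<rparr>"

definition zero_bundle :: "('g, 'b) gspace \<Rightarrow> ('b \<times> (nat \<Rightarrow> complex), 'b, 'g) vbundle" where
  "zero_bundle B =
     \<lparr>tspace = prod_topology (gs_top B) (cspace 0), proj = fst,
      vadd = (\<lambda>e _. e), vscale = (\<lambda>_ e. e), vact = (\<lambda>g (b, v). (gs_act B g b, v))\<rparr>"

definition restrict_bundle :: "'b set \<Rightarrow> ('e, 'b, 'g) vbundle \<Rightarrow> ('e, 'b, 'g) vbundle" where
  "restrict_bundle S E = E\<lparr>tspace := subtopology (tspace E) {e. proj E e \<in> S}\<rparr>"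

text \<open>
  The pullback along \<open>a\<close> of the complex conjugate of \<open>F\<close>. As the conjugate bundle has the same points as \<open>F\<close>,
  the point \<open>s\<close> also stands for its copy in the conjugate; only the scalar multiplication differs.
\<close>

definition conj_bundle ::
  "'g mgroup \<Rightarrow> ('g, 'b) gspace \<Rightarrow> 'g \<Rightarrow> ('e, 'b, 'g) vbundle \<Rightarrow> ('e \<times> 'b, 'b, 'g) vbundle" where
  "conj_bundle G B a F =
     \<lparr>tspace = subtopology (prod_topology (tspace F) (gs_top B)) {(s, x). proj F s = gs_act B a x},
      proj = snd,
      vadd = (\<lambda>(s, x) (s', _). (vadd F s s', x)),
      vscale = (\<lambda>c (s, x). (vscale F (cnj c) s, x)),
      vact = (\<lambda>g (s, x). (vact F (a \<otimes>\<^bsub>G\<^esub> g \<otimes>\<^bsub>G\<^esub> inv\<^bsub>G\<^esub> a) s, gs_act B g x))\<rparr>"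

section \<open>K-groups\<close>

text \<open>
  Isomorphism classes need bundles whose total spaces live in one fixed type. The type
  \<open>'b \<times> (nat \<Rightarrow> complex)\<close> suffices: by \<open>ubundle_exhaustive\<close> below, every equivariant bundle,
  whatever the type of its total space, is isomorphic to one of this type.
\<close>

type_synonym ('g, 'b) ubundle = "('b \<times> (nat \<Rightarrow> complex), 'b, 'g) vbundle"
type_synonym ('g, 'b) kelem = "(('g, 'b) ubundle \<times> ('g, 'b) ubundle) set"

definition transport_bundle ::
  "('e \<Rightarrow> 'f) \<Rightarrow> ('e, 'b, 'g) vbundle \<Rightarrow> ('f, 'b, 'g) vbundle" where
  "transport_bundle j E = (let k = inv_into (topspace (tspace E)) j in
     \<lparr>tspace = pullback_topology (j ` topspace (tspace E)) k (tspace E),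
      proj = proj E \<circ> k,
      vadd = (\<lambda>e e'. j (vadd E (k e) (k e'))),
      vscale = (\<lambda>c e. j (vscale E c (k e))),
      vact = (\<lambda>g e. j (vact E g (k e)))\<rparr>)"

lemma transport_bundle:
  fixes E :: "('e, 'b, 'g) vbundle" and j :: "'e \<Rightarrow> 'f"
  assumes E: "equivariant_bundle G B E" and grp: "topspace (gtop G) = carrier G"
    and j: "inj_on j (topspace (tspace E))"
  shows "equivariant_bundle G B (transport_bundle j E) \<and> bundle_iso G B E (transport_bundle j E)"
proof -
  define T where "T = topspace (tspace E)"
  define k where "k = inv_into T j"
  define S where "S = transport_bundle j E"
  have kj [simp]: "k (j e) = e" if "e \<in> T" for e
    using j that by (simp add: k_def T_def)
  have kT: "k y \<in> T" if "y \<in> j ` T" for y using that by auto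
  have jk [simp]: "j (k y) = y" if "y \<in> j ` T" for y using that by auto
  have tot: "tspace S = pullback_topology (j ` T) k (tspace E)"
    and prj: "proj S y = proj E (k y)" and add: "vadd S y y' = j (vadd E (k y) (k y'))"
    and scl: "vscale S c y = j (vscale E c (k y))" and act: "vact S g y = j (vact E g (k y))"
    for y y' c g
    by (simp_all add: S_def transport_bundle_def Let_def k_def T_def)
  have ts: "topspace (tspace S) = j ` T"
    using kT by (auto simp: tot topspace_pullback_topology T_def)
  have contk: "continuous_map (tspace S) (tspace E) k"
    using continuous_map_pullback[OF continuous_map_id[of "tspace E"], where A = "j ` T" and f = k]
    by (simp add: tot)
  have contj: "continuous_map (tspace E) (tspace S) j"
    unfolding tot
  proof (rule continuous_map_pullback')
    show "continuous_map (tspace E) (tspace E) (k \<circ> j)"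
      by (rule continuous_map_eq[OF continuous_map_id]) (simp add: T_def[symmetric])
    show "topspace (tspace E) \<subseteq> j -` (j ` T)" by (auto simp: T_def)
  qed
  have hk: "homeomorphic_maps (tspace S) (tspace E) k j"
    using contk contj by (auto simp: homeomorphic_maps_def ts T_def[symmetric])
  have fibS: "y \<in> fibre S b \<longleftrightarrow> y \<in> j ` T \<and> k y \<in> fibre E b" for y b
    using kT by (auto simp: fibre_def ts prj T_def)
  have fibE: "e \<in> fibre E b \<Longrightarrow> e \<in> T" for e b by (simp add: fibre_def T_def)
  have cvb: "complex_vector_bundle (gs_top B) E"
    and cact: "continuous_map (prod_topology (gtop G) (tspace E)) (tspace E) (\<lambda>(g, e). vact E g e)"
    and act1: "\<And>e. e \<in> T \<Longrightarrow> vact E \<one>\<^bsub>G\<^esub> e = e"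
    and actm: "\<And>g h e. g \<in> carrier G \<Longrightarrow> h \<in> carrier G \<Longrightarrow> e \<in> T \<Longrightarrow>
        vact E (g \<otimes>\<^bsub>G\<^esub> h) e = vact E g (vact E h e)"
    and actp: "\<And>g e. g \<in> carrier G \<Longrightarrow> e \<in> T \<Longrightarrow> proj E (vact E g e) = gs_act B g (proj E e)"
    and acta: "\<And>g b e e'. g \<in> carrier G \<Longrightarrow> b \<in> topspace (gs_top B) \<Longrightarrow> e \<in> fibre E b \<Longrightarrow>
        e' \<in> fibre E b \<Longrightarrow> vact E g (vadd E e e') = vadd E (vact E g e) (vact E g e')"
    and acts: "\<And>g e c. g \<in> carrier G \<Longrightarrow> e \<in> T \<Longrightarrow>
        vact E g (vscale E c e) = vscale E (if phase G g = 0 then c else cnj c) (vact E g e)"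
    using E by (simp_all add: equivariant_bundle_def T_def)
  have cproj: "continuous_map (tspace E) (gs_top B) (proj E)"
    and clos: "\<And>b e e'. b \<in> topspace (gs_top B) \<Longrightarrow> e \<in> fibre E b \<Longrightarrow> e' \<in> fibre E b \<Longrightarrow>
       vadd E e e' \<in> fibre E b"
    and closs: "\<And>b e c. b \<in> topspace (gs_top B) \<Longrightarrow> e \<in> fibre E b \<Longrightarrow> vscale E c e \<in> fibre E b"
    and ltriv: "\<And>b. b \<in> topspace (gs_top B) \<Longrightarrow>
       \<exists>U n h. openin (gs_top B) U \<and> b \<in> U \<and> local_triv (gs_top B) E U n h"
    using cvb by (simp_all add: complex_vector_bundle_def)
  have projT: "proj E e \<in> topspace (gs_top B)" if "e \<in> T" for e
    using continuous_map_funspace[OF cproj] that by (auto simp: T_def)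
  have inf: "e \<in> fibre E (proj E e)" if "e \<in> T" for e using that by (simp add: fibre_def T_def)
  have sT: "vscale E c e \<in> T" if "e \<in> T" for c e
    using closs[OF projT[OF that] inf[OF that]] fibE by blast
  have aT: "vact E g e \<in> T" if "g \<in> carrier G" "e \<in> T" for g e
    using continuous_map_funspace[OF cact] that grp by (fastforce simp: T_def Pi_iff)
  have triv: "local_triv (gs_top B) S U n (h \<circ> k)"
    if UB: "openin (gs_top B) U" and h: "local_triv (gs_top B) E U n h" for U n h
    unfolding local_triv_def
  proof (intro conjI ballI allI)
    have "homeomorphic_map (subtopology (tspace S) {y. proj S y \<in> U})
            (subtopology (tspace E) {e. proj E e \<in> U}) k"
    proof (rule homeomorphic_map_subtopologies)
      show "homeomorphic_map (tspace S) (tspace E) k" using hk homeomorphic_maps_map by blast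
      show "k ` (topspace (tspace S) \<inter> {y. proj S y \<in> U}) = topspace (tspace E) \<inter> {e. proj E e \<in> U}"
        unfolding ts prj using kj by (force simp: T_def[symmetric])
    qed
    moreover have "homeomorphic_map (subtopology (tspace E) {e. proj E e \<in> U})
       (prod_topology (subtopology (gs_top B) U) (cspace n)) h"
      using h by (simp add: local_triv_def)
    ultimately show "homeomorphic_map (subtopology (tspace S) {y. proj S y \<in> U})
       (prod_topology (subtopology (gs_top B) U) (cspace n)) (h \<circ> k)"
      by (rule homeomorphic_map_compose)
  next
    fix b y assume b: "b \<in> U" and y: "y \<in> fibre S b"
    have bt: "b \<in> topspace (gs_top B)" using UB b openin_subset by blast
    have ky: "k y \<in> fibre E b" using y fibS by blast
    show "fst ((h \<circ> k) y) = b" using h b ky by (simp add: local_triv_def)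
    show "snd ((h \<circ> k) (vadd S y y')) = (\<lambda>i. snd ((h \<circ> k) y) i + snd ((h \<circ> k) y') i)"
      if "y' \<in> fibre S b" for y'
    proof -
      have ky': "k y' \<in> fibre E b" using that fibS by blast
      show ?thesis
        using h b ky ky' fibE[OF clos[OF bt ky ky']] by (simp add: local_triv_def add)
    qed
    show "snd ((h \<circ> k) (vscale S c y)) = (\<lambda>i. c * snd ((h \<circ> k) y) i)" for c
      using h b ky fibE[OF closs[OF bt ky]] by (simp add: local_triv_def scl)
  qed
  have cvbS: "complex_vector_bundle (gs_top B) S"
    unfolding complex_vector_bundle_def
  proof (intro conjI ballI allI)
    have "continuous_map (tspace S) (gs_top B) (proj E \<circ> k)"
      using contk cproj by (rule continuous_map_compose)
    moreover have "proj S = proj E \<circ> k" by (auto simp: prj)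
    ultimately show "continuous_map (tspace S) (gs_top B) (proj S)" by simp
  next
    fix b y assume b: "b \<in> topspace (gs_top B)" and y: "y \<in> fibre S b"
    have ky: "k y \<in> fibre E b" using y fibS by blast
    show "vadd S y y' \<in> fibre S b" if "y' \<in> fibre S b" for y'
    proof -
      have ky': "k y' \<in> fibre E b" using that fibS by blast
      show ?thesis using clos[OF b ky ky'] fibE[OF clos[OF b ky ky']] by (simp add: fibS add)
    qed
    show "vscale S c y \<in> fibre S b" for c
      using closs[OF b ky] fibE[OF closs[OF b ky]] by (simp add: fibS scl)
  next
    fix b assume "b \<in> topspace (gs_top B)"
    then show "\<exists>U n h. openin (gs_top B) U \<and> b \<in> U \<and> local_triv (gs_top B) S U n h"
      using ltriv triv by meson
  qed
  have cactS: "continuous_map (prod_topology (gtop G) (tspace S)) (tspace S) (\<lambda>(g, y). vact S g y)"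
  proof -
    have "continuous_map (prod_topology (gtop G) (tspace S)) (prod_topology (gtop G) (tspace E))
            (\<lambda>z. (fst z, (k \<circ> snd) z))"
      by (intro continuous_map_pairedI continuous_map_fst
          continuous_map_compose[OF continuous_map_snd contk])
    from continuous_map_compose[OF continuous_map_compose[OF this cact] contj]
    show ?thesis by (simp add: o_def case_prod_unfold act)
  qed
  have "equivariant_bundle G B S"
    unfolding equivariant_bundle_def
  proof (intro conjI ballI allI)
    fix g b y y' assume g: "g \<in> carrier G" and b: "b \<in> topspace (gs_top B)"
      and y: "y \<in> fibre S b" and y': "y' \<in> fibre S b"
    have k: "k y \<in> fibre E b" "k y' \<in> fibre E b" using y y' fibS by auto
    then show "vact S g (vadd S y y') = vadd S (vact S g y) (vact S g y')"
      using g acta[OF g b k] aT fibE clos[OF b k] by (simp add: add act)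
  qed (rule cvbS, rule cactS, use kT act1 actm actp acts aT sT in \<open>auto simp: ts prj act scl\<close>)
  moreover have "bundle_hom G B E S j"
    unfolding bundle_hom_def T_def[symmetric] using contj fibE by (auto simp: prj add scl act)
  moreover have "bundle_hom G B S E k"
    unfolding bundle_hom_def ts using contk fibE[OF clos] sT aT
    by (auto simp: prj add scl act fibS)
  ultimately show ?thesis
    unfolding bundle_iso_def S_def[symmetric] using kj jk ts T_def by metis
qed

lemma ubundle_exhaustive:
  fixes E :: "('e, 'b, 'g) vbundle"
  assumes E: "equivariant_bundle G B E" and grp: "topspace (gtop G) = carrier G"
  shows "\<exists>S :: ('g, 'b) ubundle. equivariant_bundle G B S \<and> bundle_iso G B E S"
proof -
  have ex: "\<forall>b\<in>topspace (gs_top B). \<exists>h. \<exists>U n. b \<in> U \<and> local_triv (gs_top B) E U n h"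
    using E unfolding equivariant_bundle_def complex_vector_bundle_def by meson
  obtain h where h: "\<And>b. b \<in> topspace (gs_top B) \<Longrightarrow>
      \<exists>U n. b \<in> U \<and> local_triv (gs_top B) E U n (h b)"
    using bchoice[OF ex] by blast
  have cproj: "continuous_map (tspace E) (gs_top B) (proj E)"
    using E by (simp add: equivariant_bundle_def complex_vector_bundle_def)
  define j where "j = (\<lambda>e. (proj E e, snd (h (proj E e) e)))"
  have "inj_on j (topspace (tspace E))"
  proof (rule inj_onI)
    fix e e' assume e: "e \<in> topspace (tspace E)" "e' \<in> topspace (tspace E)" and eq: "j e = j e'"
    define b where "b = proj E e"
    have b': "proj E e' = b" using eq by (simp add: j_def b_def)
    have "b \<in> topspace (gs_top B)"
      using continuous_map_funspace[OF cproj] e by (auto simp: b_def)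
    then obtain U n where U: "b \<in> U" and t: "local_triv (gs_top B) E U n (h b)" using h by blast
    have inj: "inj_on (h b) (topspace (subtopology (tspace E) {e. proj E e \<in> U}))"
      using t homeomorphic_imp_injective_map by (fastforce simp: local_triv_def)
    have "fst (h b e) = b" "fst (h b e') = b"
      using t U e b' by (auto simp: local_triv_def fibre_def b_def)
    moreover have "snd (h b e) = snd (h b e')" using eq b' by (simp add: j_def b_def)
    ultimately have "h b e = h b e'" by (simp add: prod_eq_iff)
    then show "e = e'" using inj e U b' by (auto simp: inj_on_def b_def)
  qed
  then show ?thesis using transport_bundle[OF E grp] by blast
qed

text \<open>The class of the formal difference \<open>E\<^sub>0 - E\<^sub>1\<close>.\<close>

definition kclass ::
  "'g mgroup \<Rightarrow> ('g, 'b) gspace \<Rightarrow> ('e, 'b, 'g) vbundle \<Rightarrow> ('e, 'b, 'g) vbundle \<Rightarrow> ('g, 'b) kelem"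
  where
  "kclass G B E0 E1 =
     {(S0, S1). equivariant_bundle G B S0 \<and> equivariant_bundle G B S1 \<and>
        (\<exists>F :: ('g, 'b) ubundle. equivariant_bundle G B F \<and>
           bundle_iso G B (bundle_sum E0 (bundle_sum S1 F)) (bundle_sum S0 (bundle_sum E1 F)))}"

definition K_group :: "'g mgroup \<Rightarrow> ('g, 'b) gspace \<Rightarrow> ('g, 'b) kelem monoid" where
  "K_group G B =
     \<lparr>carrier = {kclass G B E0 E1 | (E0 :: ('g, 'b) ubundle) E1.
                   equivariant_bundle G B E0 \<and> equivariant_bundle G B E1},
      mult = (\<lambda>\<xi> \<eta>. \<Union>(E0, E1)\<in>\<xi>. \<Union>(F0, F1)\<in>\<eta>. kclass G B (bundle_sum E0 F0) (bundle_sum E1 F1)),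
      one = kclass G B (zero_bundle B) (zero_bundle B)\<rparr>"

text \<open>The map of K-groups induced by an additive construction on bundles.\<close>

definition K_map ::
  "'g mgroup \<Rightarrow> ('g, 'c) gspace \<Rightarrow> (('g, 'b) ubundle \<Rightarrow> ('e, 'c, 'g) vbundle) \<Rightarrow>
   ('g, 'b) kelem \<Rightarrow> ('g, 'c) kelem" where
  "K_map G C \<Phi> \<xi> = (\<Union>(E0, E1)\<in>\<xi>. kclass G C (\<Phi> E0) (\<Phi> E1))"

definition K_reduced :: "'g mgroup \<Rightarrow> ('g, 'b) gspace \<Rightarrow> 'b \<Rightarrow> ('g, 'b) kelem monoid" where
  "K_reduced G B b0 =
     (K_group G B)\<lparr>carrier :=
        kernel (K_group G B) (K_group G (sub_gspace B {b0}))
          (K_map G (sub_gspace B {b0}) (restrict_bundle {b0}))\<rparr>"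

definition K_pair :: "'g mgroup \<Rightarrow> ('g, 'x) gspace \<Rightarrow> 'x set \<Rightarrow> ('g, 'x option) kelem monoid" where
  "K_pair G X Y = K_reduced G (quot_gspace X Y) None"

definition neg_degree_sub :: "nat \<Rightarrow> ('g, 'x) gspace \<Rightarrow> 'x set \<Rightarrow> ('x \<times> (nat \<Rightarrow> real)) set" where
  "neg_degree_sub q X Y =
     topspace (gs_top X) \<times> ball_boundary q \<union> Y \<times> topspace (ball_space q)"

definition K_neg_pair ::
  "'g mgroup \<Rightarrow> nat \<Rightarrow> ('g, 'x) gspace \<Rightarrow> 'x set \<Rightarrow> ('g, ('x \<times> (nat \<Rightarrow> real)) option) kelem monoid"
  where
  "K_neg_pair G q X Y = K_pair G (times_ball X q) (neg_degree_sub q X Y)"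

text \<open>
  Degree \<open>n > 0\<close> is defined by 8-periodicity as the degree \<open>-q\<close> with \<open>q \<equiv> -n (mod 8)\<close> and
  \<open>0 \<le> q < 8\<close>, both for \<open>G\<close> and for \<open>G\<^sub>0\<close>, so that all maps carry over.
\<close>

definition suspension_degree :: "int \<Rightarrow> nat" where
  "suspension_degree n = (if n \<le> 0 then nat (- n) else nat ((- n) mod 8))"

definition K_deg ::
  "'g mgroup \<Rightarrow> int \<Rightarrow> ('g, 'x) gspace \<Rightarrow> ('g, ('x \<times> (nat \<Rightarrow> real)) option) kelem monoid" where
  "K_deg G n X = K_neg_pair G (suspension_degree n) X {}"

text \<open>The space whose reduced K-group is \<^term>\<open>K_deg G n X\<close>.\<close>

definition K_deg_space ::
  "int \<Rightarrow> ('g, 'x) gspace \<Rightarrow> ('g, ('x \<times> (nat \<Rightarrow> real)) option) gspace" where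
  "K_deg_space n X =
     quot_gspace (times_ball X (suspension_degree n)) (neg_degree_sub (suspension_degree n) X {})"

lemma K_deg_eq: "K_deg G n X = K_reduced G (K_deg_space n X) None"
  by (simp add: K_deg_def K_neg_pair_def K_pair_def K_deg_space_def)

text \<open>
  For the restriction \<open>\<iota>\<^sup>*\<close> the underlying bundle data do not change; only the elements of \<open>G\<^sub>0\<close>
  are regarded as acting.
\<close>

definition K_restriction ::
  "'g mgroup \<Rightarrow> int \<Rightarrow> ('g, 'x) gspace \<Rightarrow>
   ('g, ('x \<times> (nat \<Rightarrow> real)) option) kelem \<Rightarrow> ('g, ('x \<times> (nat \<Rightarrow> real)) option) kelem" where
  "K_restriction G n X = K_map (even_part G) (K_deg_space n X) (\<lambda>E. E)"

definition K_conj ::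
  "'g mgroup \<Rightarrow> 'g \<Rightarrow> int \<Rightarrow> ('g, 'x) gspace \<Rightarrow>
   ('g, ('x \<times> (nat \<Rightarrow> real)) option) kelem \<Rightarrow> ('g, ('x \<times> (nat \<Rightarrow> real)) option) kelem" where
  "K_conj G a n X =
     K_map (even_part G) (K_deg_space n X) (conj_bundle G (K_deg_space n X) a)"

definition K_invariants ::
  "'g mgroup \<Rightarrow> 'g \<Rightarrow> int \<Rightarrow> ('g, 'x) gspace \<Rightarrow> ('g, ('x \<times> (nat \<Rightarrow> real)) option) kelem monoid"
  where
  "K_invariants G a n X =
     (K_deg (even_part G) n X)\<lparr>carrier :=
        {\<xi> \<in> carrier (K_deg (even_part G) n X). K_conj G a n X \<xi> = \<xi>}\<rparr>"

section \<open>Tensor products of abelian groups\<close>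

definition tensor_relations :: "('a, 'm) monoid_scheme \<Rightarrow> ('b, 'n) monoid_scheme \<Rightarrow> ('a \<times> 'b \<Rightarrow>\<^sub>0 int) set"
  where
  "tensor_relations A B =
     generate (free_Abelian_group (carrier A \<times> carrier B))
       ({frag_of (a \<otimes>\<^bsub>A\<^esub> a', b) - frag_of (a, b) - frag_of (a', b) | a a' b.
           a \<in> carrier A \<and> a' \<in> carrier A \<and> b \<in> carrier B} \<union>
        {frag_of (a, b \<otimes>\<^bsub>B\<^esub> b') - frag_of (a, b) - frag_of (a, b') | a b b'.
           a \<in> carrier A \<and> b \<in> carrier B \<and> b' \<in> carrier B})"

definition tensor_group ::
  "('a, 'm) monoid_scheme \<Rightarrow> ('b, 'n) monoid_scheme \<Rightarrow> ('a \<times> 'b \<Rightarrow>\<^sub>0 int) set monoid" where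
  "tensor_group A B = free_Abelian_group (carrier A \<times> carrier B) Mod tensor_relations A B"

text \<open>\<open>f \<otimes> id : A \<otimes> B \<rightarrow> A' \<otimes> B\<close>, on cosets.\<close>

definition tensor_map ::
  "('a', 'm) monoid_scheme \<Rightarrow> ('b, 'n) monoid_scheme \<Rightarrow> ('a \<Rightarrow> 'a') \<Rightarrow>
   ('a \<times> 'b \<Rightarrow>\<^sub>0 int) set \<Rightarrow> ('a' \<times> 'b \<Rightarrow>\<^sub>0 int) set" where
  "tensor_map A' B f C =
     (\<Union>c\<in>C. tensor_relations A' B #>\<^bsub>free_Abelian_group (carrier A' \<times> carrier B)\<^esub>
               frag_extend (\<lambda>(a, b). frag_of (f a, b)) c)"

definition rational_group :: "rat monoid" where
  "rational_group = \<lparr>carrier = UNIV, mult = (+), one = 0\<rparr>"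

end

theory Submission
  imports Defs
begin

text \<open>
  Restriction has an inverse up to the factor 2. Given a complex \<open>G\<^sub>0\<close>-bundle \<open>F\<close>, the sum
  \<open>F \<oplus> a\<^sup>*F\<close> with the conjugate pullback carries a magnetic \<open>G\<close>-action in which the elements outside
  \<open>G\<^sub>0\<close> exchange the two summands; this is the bundle induced from \<open>G\<^sub>0\<close> to \<open>G\<close>
  (\<open>equivariant_bundle_induced\<close>). Restricted to \<open>G\<^sub>0\<close> it is \<open>F\<close> plus its conjugate, so restriction
  after induction is \<open>1 + \<tau>\<close> with \<open>\<tau>\<close> the conjugation involution, which is multiplication by 2 on the
  invariants (\<open>K_res_ind\<close>). Conversely, for a magnetic bundle \<open>E\<close> the bundle induced from its
  restriction is \<open>E\<close> tensored with the real permutation representation of \<open>G/G\<^sub>0\<close>, that is, with the sum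
  of the trivial and the sign representation. As odd elements act antilinearly, multiplication by \<open>\<i>\<close>
  identifies \<open>E\<close> with its sign twist, so the result is \<open>E \<oplus> E\<close>
  (\<open>bundle_iso_induced_magnetic\<close>) and induction after restriction is multiplication by 2
  (\<open>K_ind_res\<close>). The image of restriction is invariant because the action of \<open>a\<inverse>\<close> on a magnetic
  bundle is an isomorphism from its conjugate pullback to the bundle itself
  (\<open>bundle_iso_conj_magnetic\<close>).

  Two homomorphisms whose composites are both multiplication by 2 become isomorphisms after tensoring
  with \<open>\<rat>\<close>: the inverse of \<open>f \<otimes> 1\<close> is \<open>g \<otimes> 1/2\<close> (\<open>tensor_map_rational_iso\<close>).

  Most of the text makes these constructions well defined. Bundles are handled through charts, which
  provide the vector space laws in the fibres and the continuity of addition. K-theory classes are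
  handled through the commutative semigroup of isomorphism classes, in which a construction on bundles
  that respects direct sums up to isomorphism induces a homomorphism of K-groups
  (locale \<open>additive_map\<close>). In every degree the K-group is a reduced K-group of a quotient space, so
  it remains that \<open>G\<close> acts continuously on that quotient, which rests on the compactness of \<open>G\<close>
  (\<open>G_space_quotient\<close>), and that restriction to \<open>G\<^sub>0\<close> and induction commute with
  restriction to the base point.
\<close>

section \<open>Vector bundles in local coordinates\<close>

lemma continuous_map_comp:
  "\<lbrakk>continuous_map Y W f; continuous_map Z Y s\<rbrakk> \<Longrightarrow> continuous_map Z W (\<lambda>z. f (s z))"
  using continuous_map_compose[of Z Y s W f] by (simp add: o_def)

lemma continuous_map_comp2:
  "\<lbrakk>continuous_map (prod_topology X Y) W (\<lambda>(x, y). f x y); continuous_map Z X r; continuous_map Z Y s\<rbrakk>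
    \<Longrightarrow> continuous_map Z W (\<lambda>z. f (r z) (s z))"
  using continuous_map_comp[of "prod_topology X Y" W "\<lambda>(x, y). f x y" Z "\<lambda>z. (r z, s z)"]
  by (simp add: continuous_map_pairedI)

lemma continuous_map_id': "continuous_map Z Z (\<lambda>z. z)"
  using continuous_map_id[of Z] by (simp add: id_def)

lemma continuous_map_fst_comp:
  "continuous_map Z (prod_topology X Y) f \<Longrightarrow> continuous_map Z X (\<lambda>z. fst (f z))"
  by (rule continuous_map_comp[OF continuous_map_fst])

lemma continuous_map_snd_comp:
  "continuous_map Z (prod_topology X Y) f \<Longrightarrow> continuous_map Z Y (\<lambda>z. snd (f z))"
  by (rule continuous_map_comp[OF continuous_map_snd])

lemma continuous_map_in_topspace:
  "\<lbrakk>continuous_map Z Y f; z \<in> topspace Z\<rbrakk> \<Longrightarrow> f z \<in> topspace Y"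
  by (simp add: continuous_map_def Pi_iff)

lemma topspace_cspace [simp]: "topspace (cspace n) = {v. \<forall>i\<ge>n. v i = 0}"
  by (simp add: cspace_def)

lemma continuous_map_into_cspace:
  "continuous_map Z (cspace n) f \<longleftrightarrow>
     (\<forall>i. continuous_map Z euclidean (\<lambda>z. f z i)) \<and> (\<forall>z\<in>topspace Z. \<forall>i\<ge>n. f z i = 0)"
  by (auto simp: cspace_def continuous_map_in_subtopology continuous_map_componentwise_UNIV Pi_iff)

lemma continuous_map_coordinate:
  "continuous_map Z (cspace n) f \<Longrightarrow> continuous_map Z euclidean (\<lambda>z. f z i)"
  by (simp add: continuous_map_into_cspace)

lemma continuous_map_euclidean_comp:
  "\<lbrakk>continuous_map Z euclidean f; continuous_on UNIV h\<rbrakk> \<Longrightarrow> continuous_map Z euclidean (\<lambda>z. h (f z))"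
  by (rule continuous_map_comp) (auto simp: continuous_map_iff_continuous2)

lemma continuous_map_cadd:
  fixes f g :: "'a \<Rightarrow> complex"
  assumes "continuous_map Z euclidean f" "continuous_map Z euclidean g"
  shows "continuous_map Z euclidean (\<lambda>z. f z + g z)"
proof -
  have "continuous_map Z euclidean (\<lambda>z. (f z, g z))"
    using continuous_map_pairedI[OF assms] by simp
  from continuous_map_euclidean_comp[OF this, of "\<lambda>p. fst p + snd p"] show ?thesis
    by (simp add: continuous_on_add continuous_on_fst continuous_on_snd)
qed

lemma continuous_map_cscale:
  fixes f :: "'a \<Rightarrow> complex"
  assumes "continuous_map Z euclidean f"
  shows "continuous_map Z euclidean (\<lambda>z. c * f z)"
  using continuous_map_euclidean_comp[OF assms, of "\<lambda>w. c * w"]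
  by (simp add: continuous_on_mult_left)

text \<open>
  A local trivialization given by the fibre coordinate \<open>v\<close> and the inverse \<open>k\<close> of the pair of
  projection and \<open>v\<close>. In this form the charts of a construction can be written down from the charts
  of its ingredients.
\<close>

definition coord_chart ::
  "'b topology \<Rightarrow> ('e, 'b, 'g) vbundle \<Rightarrow> 'b set \<Rightarrow> nat \<Rightarrow> ('e \<Rightarrow> nat \<Rightarrow> complex) \<Rightarrow>
   ('b \<times> (nat \<Rightarrow> complex) \<Rightarrow> 'e) \<Rightarrow> bool" where
  "coord_chart B E U n v k \<longleftrightarrow>
     continuous_map (subtopology (tspace E) {e. proj E e \<in> U}) (cspace n) v \<and>
     continuous_map (prod_topology (subtopology B U) (cspace n)) (tspace E) k \<and>
     (\<forall>b\<in>topspace B \<inter> U. \<forall>w\<in>topspace (cspace n). proj E (k (b, w)) = b \<and> v (k (b, w)) = w) \<and>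
     (\<forall>e\<in>topspace (tspace E). proj E e \<in> U \<longrightarrow> k (proj E e, v e) = e) \<and>
     (\<forall>e\<in>topspace (tspace E). proj E e \<in> U \<longrightarrow>
        (\<forall>e'\<in>fibre E (proj E e). v (vadd E e e') = (\<lambda>i. v e i + v e' i)) \<and>
        (\<forall>c. v (vscale E c e) = (\<lambda>i. c * v e i)))"

lemma coord_chartD:
  assumes "coord_chart B E U n v k"
  shows "continuous_map (subtopology (tspace E) {e. proj E e \<in> U}) (cspace n) v"
    and "continuous_map (prod_topology (subtopology B U) (cspace n)) (tspace E) k"
    and "\<And>b w. \<lbrakk>b \<in> topspace B; b \<in> U; w \<in> topspace (cspace n)\<rbrakk> \<Longrightarrow>
      k (b, w) \<in> topspace (tspace E) \<and> proj E (k (b, w)) = b \<and> v (k (b, w)) = w"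
    and "\<And>e. \<lbrakk>e \<in> topspace (tspace E); proj E e \<in> U\<rbrakk> \<Longrightarrow> k (proj E e, v e) = e"
    and "\<And>e e'. \<lbrakk>e \<in> topspace (tspace E); e' \<in> topspace (tspace E); proj E e' = proj E e; proj E e \<in> U\<rbrakk> \<Longrightarrow>
      v (vadd E e e') = (\<lambda>i. v e i + v e' i)"
    and "\<And>e c. \<lbrakk>e \<in> topspace (tspace E); proj E e \<in> U\<rbrakk> \<Longrightarrow> v (vscale E c e) = (\<lambda>i. c * v e i)"
    and "\<And>e i. \<lbrakk>e \<in> topspace (tspace E); proj E e \<in> U; i \<ge> n\<rbrakk> \<Longrightarrow> v e i = 0"
proof -
  have k: "continuous_map (prod_topology (subtopology B U) (cspace n)) (tspace E) k"
    and v: "continuous_map (subtopology (tspace E) {e. proj E e \<in> U}) (cspace n) v"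
    using assms by (simp_all add: coord_chart_def)
  show "k (b, w) \<in> topspace (tspace E) \<and> proj E (k (b, w)) = b \<and> v (k (b, w)) = w"
    if "b \<in> topspace B" "b \<in> U" "w \<in> topspace (cspace n)" for b w
    using that assms continuous_map_in_topspace[OF k, of "(b, w)"] by (simp add: coord_chart_def)
  show "v e i = 0" if "e \<in> topspace (tspace E)" "proj E e \<in> U" "i \<ge> n" for e i
    using that continuous_map_in_topspace[OF v, of e] by simp
qed (use assms in \<open>auto simp: coord_chart_def fibre_def\<close>)

lemma coord_chart_imp_local_triv:
  assumes cp: "continuous_map (tspace E) B (proj E)" and c: "coord_chart B E U n v k"
  shows "local_triv B E U n (\<lambda>e. (proj E e, v e))"
proof -
  have vc: "continuous_map (subtopology (tspace E) {e. proj E e \<in> U}) (cspace n) v"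
    and kc: "continuous_map (prod_topology (subtopology B U) (cspace n)) (tspace E) k"
    using c by (simp_all add: coord_chart_def)
  have "homeomorphic_maps (subtopology (tspace E) {e. proj E e \<in> U})
       (prod_topology (subtopology B U) (cspace n)) (\<lambda>e. (proj E e, v e)) k"
    unfolding homeomorphic_maps_def
  proof (intro conjI)
    show "continuous_map (subtopology (tspace E) {e. proj E e \<in> U})
       (prod_topology (subtopology B U) (cspace n)) (\<lambda>e. (proj E e, v e))"
      by (intro continuous_map_pairedI vc)
        (auto simp: continuous_map_in_subtopology continuous_map_from_subtopology cp)
    show "continuous_map (prod_topology (subtopology B U) (cspace n))
       (subtopology (tspace E) {e. proj E e \<in> U}) k"
      using c by (auto simp: continuous_map_in_subtopology kc coord_chart_def)
  qed (use c in \<open>auto simp: coord_chart_def\<close>)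
  then show ?thesis
    using c unfolding local_triv_def homeomorphic_map_maps
    by (auto simp: coord_chart_def fibre_def)
qed

lemma local_triv_imp_coord_chart:
  assumes U: "U \<subseteq> topspace B" and h: "local_triv B E U n h"
  obtains k where "coord_chart B E U n (\<lambda>e. snd (h e)) k"
proof -
  obtain k where hk: "homeomorphic_maps (subtopology (tspace E) {e. proj E e \<in> U})
       (prod_topology (subtopology B U) (cspace n)) h k"
    using h by (auto simp: local_triv_def homeomorphic_map_maps)
  have fst: "fst (h e) = proj E e" if "e \<in> topspace (tspace E)" "proj E e \<in> U" for e
    using h that by (simp add: local_triv_def fibre_def)
  have kc: "continuous_map (prod_topology (subtopology B U) (cspace n))
       (subtopology (tspace E) {e. proj E e \<in> U}) k"
    and hc: "continuous_map (subtopology (tspace E) {e. proj E e \<in> U})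
       (prod_topology (subtopology B U) (cspace n)) h"
    using hk by (simp_all add: homeomorphic_maps_def)
  have h': "h (k (b, w)) = (b, w)" "k (b, w) \<in> topspace (tspace E)" "proj E (k (b, w)) \<in> U"
    if "b \<in> topspace B" "b \<in> U" "w \<in> topspace (cspace n)" for b w
    using hk continuous_map_in_topspace[OF kc, of "(b, w)"] that
    by (auto simp: homeomorphic_maps_def)
  have "coord_chart B E U n (\<lambda>e. snd (h e)) k"
    unfolding coord_chart_def
  proof (intro conjI ballI impI allI)
    show "continuous_map (subtopology (tspace E) {e. proj E e \<in> U}) (cspace n) (\<lambda>e. snd (h e))"
      by (rule continuous_map_snd_comp[OF hc])
    show "continuous_map (prod_topology (subtopology B U) (cspace n)) (tspace E) k"
      using kc by (simp add: continuous_map_in_subtopology)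
    fix b w assume b: "b \<in> topspace B \<inter> U" and w: "w \<in> topspace (cspace n)"
    show "proj E (k (b, w)) = b" using fst[of "k (b, w)"] h' b w by auto
    show "snd (h (k (b, w))) = w" using h' b w by auto
  next
    fix e assume e: "e \<in> topspace (tspace E)" "proj E e \<in> U"
    have "h e = (proj E e, snd (h e))" using fst[OF e] by (simp add: prod_eq_iff)
    then show "k (proj E e, snd (h e)) = e" using hk e by (metis (mono_tags, lifting) IntI
      homeomorphic_maps_def mem_Collect_eq topspace_subtopology)
  qed (use h in \<open>auto simp: local_triv_def fibre_def\<close>)
  then show ?thesis using that by blast
qed

lemma bundle_chart:
  assumes "complex_vector_bundle B E" "b \<in> topspace B"
  obtains U n v k where "openin B U" "b \<in> U" "coord_chart B E U n v k"
proof -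
  obtain U n h where U: "openin B U" "b \<in> U" "local_triv B E U n h"
    using assms by (auto simp: complex_vector_bundle_def)
  obtain k where "coord_chart B E U n (\<lambda>e. snd (h e)) k"
    using local_triv_imp_coord_chart[OF openin_subset[OF U(1)] U(3)] .
  then show ?thesis by (rule that[OF U(1,2)])
qed

lemma complex_vector_bundleI:
  assumes "continuous_map (tspace E) B (proj E)"
    and "\<And>e e'. \<lbrakk>e \<in> topspace (tspace E); e' \<in> topspace (tspace E); proj E e' = proj E e\<rbrakk> \<Longrightarrow>
      vadd E e e' \<in> topspace (tspace E) \<and> proj E (vadd E e e') = proj E e"
    and "\<And>e c. e \<in> topspace (tspace E) \<Longrightarrow>
      vscale E c e \<in> topspace (tspace E) \<and> proj E (vscale E c e) = proj E e"
    and "\<And>b. b \<in> topspace B \<Longrightarrow> \<exists>U n v k. openin B U \<and> b \<in> U \<and> coord_chart B E U n v k"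
  shows "complex_vector_bundle B E"
  unfolding complex_vector_bundle_def
proof (intro conjI ballI allI)
  fix b assume "b \<in> topspace B"
  then obtain U n v k where U: "openin B U" "b \<in> U" and c: "coord_chart B E U n v k"
    using assms(4) by metis
  then show "\<exists>U n h. openin B U \<and> b \<in> U \<and> local_triv B E U n h"
    using coord_chart_imp_local_triv[OF assms(1) c] by metis
qed (use assms(1-3) in \<open>auto simp: fibre_def\<close>)

context
  fixes B :: "'b topology" and E :: "('e, 'b, 'g) vbundle"
  assumes E: "complex_vector_bundle B E"
begin

lemma continuous_map_bundle_proj: "continuous_map (tspace E) B (proj E)"
  using E by (simp add: complex_vector_bundle_def)

lemma bundle_proj_in: "e \<in> topspace (tspace E) \<Longrightarrow> proj E e \<in> topspace B"
  using continuous_map_in_topspace[OF continuous_map_bundle_proj] .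

lemma bundle_vadd_in:
  assumes "e \<in> topspace (tspace E)" "e' \<in> topspace (tspace E)" "proj E e' = proj E e"
  shows "vadd E e e' \<in> topspace (tspace E)" "proj E (vadd E e e') = proj E e"
  using E assms bundle_proj_in[of e] unfolding complex_vector_bundle_def fibre_def by auto

lemma bundle_vscale_in:
  assumes "e \<in> topspace (tspace E)"
  shows "vscale E c e \<in> topspace (tspace E)" "proj E (vscale E c e) = proj E e"
  using E assms bundle_proj_in[of e] unfolding complex_vector_bundle_def fibre_def by auto

lemma fibre_coordinates:
  assumes "b \<in> topspace B"
  obtains v :: "'e \<Rightarrow> nat \<Rightarrow> complex" where "inj_on v (fibre E b)"
    "\<And>e e'. \<lbrakk>e \<in> fibre E b; e' \<in> fibre E b\<rbrakk> \<Longrightarrow> v (vadd E e e') = (\<lambda>i. v e i + v e' i)"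
    "\<And>c e. e \<in> fibre E b \<Longrightarrow> v (vscale E c e) = (\<lambda>i. c * v e i)"
proof -
  obtain U n v k where "b \<in> U" and c: "coord_chart B E U n v k" using bundle_chart[OF E assms] .
  then have "inj_on v (fibre E b)"
    unfolding inj_on_def coord_chart_def fibre_def by (metis (mono_tags, lifting) mem_Collect_eq)
  then show ?thesis
    using \<open>b \<in> U\<close> c by (intro that[of v]) (auto simp: coord_chart_def fibre_def)
qed

text \<open>
  Continuity of addition is not among the bundle axioms. In a chart it is addition of coordinates,
  and the charts cover.
\<close>

lemma continuous_map_vadd:
  assumes f: "continuous_map Z (tspace E) f" and g: "continuous_map Z (tspace E) g"
    and fg: "\<And>z. z \<in> topspace Z \<Longrightarrow> proj E (g z) = proj E (f z)"
  shows "continuous_map Z (tspace E) (\<lambda>z. vadd E (f z) (g z))"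
proof -
  have pf: "continuous_map Z B (\<lambda>z. proj E (f z))"
    by (rule continuous_map_comp[OF continuous_map_bundle_proj f])
  have "\<exists>W. openin Z W \<and> z \<in> W \<and>
     continuous_map (subtopology Z W) (tspace E) (\<lambda>z. vadd E (f z) (g z))"
    if z: "z \<in> topspace Z" for z
  proof -
    have "proj E (f z) \<in> topspace B" by (rule continuous_map_in_topspace[OF pf z])
    then obtain U n v k where U: "openin B U" "proj E (f z) \<in> U" and c: "coord_chart B E U n v k"
      by (rule bundle_chart[OF E])
    define W where "W = {z \<in> topspace Z. proj E (f z) \<in> U}"
    have W: "openin Z W" unfolding W_def by (rule openin_continuous_map_preimage[OF pf U(1)])
    have vc: "continuous_map (subtopology (tspace E) {e. proj E e \<in> U}) (cspace n) v"
      and kc: "continuous_map (prod_topology (subtopology B U) (cspace n)) (tspace E) k"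
      using c by (simp_all add: coord_chart_def)
    have vf: "continuous_map (subtopology Z W) (cspace n) (\<lambda>z. v (f z))"
      by (rule continuous_map_comp[OF vc])
        (auto simp: W_def continuous_map_in_subtopology continuous_map_from_subtopology f)
    have vg: "continuous_map (subtopology Z W) (cspace n) (\<lambda>z. v (g z))"
      by (rule continuous_map_comp[OF vc])
        (auto simp: W_def continuous_map_in_subtopology continuous_map_from_subtopology g fg)
    have "continuous_map (subtopology Z W) (cspace n) (\<lambda>z i. v (f z) i + v (g z) i)"
      using vf vg by (auto simp: continuous_map_into_cspace intro!: continuous_map_cadd)
    moreover have "continuous_map (subtopology Z W) (subtopology B U) (\<lambda>z. proj E (f z))"
      using pf by (auto simp: W_def continuous_map_in_subtopology continuous_map_from_subtopology)
    ultimately have "continuous_map (subtopology Z W) (tspace E)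
        (\<lambda>z. k (proj E (f z), (\<lambda>i. v (f z) i + v (g z) i)))"
      by (intro continuous_map_comp[OF kc] continuous_map_pairedI)
    then have "continuous_map (subtopology Z W) (tspace E) (\<lambda>z. vadd E (f z) (g z))"
    proof (rule continuous_map_eq)
      fix z assume "z \<in> topspace (subtopology Z W)"
      then have z: "z \<in> topspace Z" "proj E (f z) \<in> U" by (auto simp: W_def)
      have i: "f z \<in> topspace (tspace E)" "g z \<in> topspace (tspace E)"
        using f g z continuous_map_in_topspace by metis+
      have "v (vadd E (f z) (g z)) = (\<lambda>i. v (f z) i + v (g z) i)"
        using c i z fg by (simp add: coord_chart_def fibre_def)
      moreover have "k (proj E (vadd E (f z) (g z)), v (vadd E (f z) (g z))) = vadd E (f z) (g z)"
        using bundle_vadd_in[OF i fg[OF z(1)]] z by (intro coord_chartD(4)[OF c]) simp_all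
      ultimately show "k (proj E (f z), (\<lambda>i. v (f z) i + v (g z) i)) = vadd E (f z) (g z)"
        using bundle_vadd_in[OF i fg[OF z(1)]] by simp
    qed
    then show ?thesis using W z U by (auto simp: W_def)
  qed
  then obtain W where "\<And>z. z \<in> topspace Z \<Longrightarrow> openin Z (W z) \<and> z \<in> W z \<and>
     continuous_map (subtopology Z (W z)) (tspace E) (\<lambda>z. vadd E (f z) (g z))" by metis
  then have W: "openin Z (W z)" "z \<in> W z"
     "continuous_map (subtopology Z (W z)) (tspace E) (\<lambda>z. vadd E (f z) (g z))" if "z \<in> topspace Z" for z
    using that by blast+
  show ?thesis
    by (rule pasting_lemma[where I = "topspace Z" and T = W and f = "\<lambda>_ z. vadd E (f z) (g z)"])
      (use W in blast)+
qed

lemma continuous_map_vscale: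
  assumes f: "continuous_map Z (tspace E) f"
  shows "continuous_map Z (tspace E) (\<lambda>z. vscale E a (f z))"
proof -
  have pf: "continuous_map Z B (\<lambda>z. proj E (f z))"
    by (rule continuous_map_comp[OF continuous_map_bundle_proj f])
  have "\<exists>W. openin Z W \<and> z \<in> W \<and>
     continuous_map (subtopology Z W) (tspace E) (\<lambda>z. vscale E a (f z))"
    if z: "z \<in> topspace Z" for z
  proof -
    have "proj E (f z) \<in> topspace B" by (rule continuous_map_in_topspace[OF pf z])
    then obtain U n v k where U: "openin B U" "proj E (f z) \<in> U" and c: "coord_chart B E U n v k"
      by (rule bundle_chart[OF E])
    define W where "W = {z \<in> topspace Z. proj E (f z) \<in> U}"
    have W: "openin Z W" unfolding W_def by (rule openin_continuous_map_preimage[OF pf U(1)])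
    have vc: "continuous_map (subtopology (tspace E) {e. proj E e \<in> U}) (cspace n) v"
      and kc: "continuous_map (prod_topology (subtopology B U) (cspace n)) (tspace E) k"
      using c by (simp_all add: coord_chart_def)
    have vf: "continuous_map (subtopology Z W) (cspace n) (\<lambda>z. v (f z))"
      by (rule continuous_map_comp[OF vc])
        (auto simp: W_def continuous_map_in_subtopology continuous_map_from_subtopology f)
    have "continuous_map (subtopology Z W) (cspace n) (\<lambda>z i. a * v (f z) i)"
      using vf by (auto simp: continuous_map_into_cspace intro!: continuous_map_cscale)
    moreover have "continuous_map (subtopology Z W) (subtopology B U) (\<lambda>z. proj E (f z))"
      using pf by (auto simp: W_def continuous_map_in_subtopology continuous_map_from_subtopology)
    ultimately have "continuous_map (subtopology Z W) (tspace E)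
        (\<lambda>z. k (proj E (f z), (\<lambda>i. a * v (f z) i)))"
      by (intro continuous_map_comp[OF kc] continuous_map_pairedI)
    then have "continuous_map (subtopology Z W) (tspace E) (\<lambda>z. vscale E a (f z))"
    proof (rule continuous_map_eq)
      fix z assume "z \<in> topspace (subtopology Z W)"
      then have z: "z \<in> topspace Z" "proj E (f z) \<in> U" by (auto simp: W_def)
      have i: "f z \<in> topspace (tspace E)" using f z continuous_map_in_topspace by metis
      have "v (vscale E a (f z)) = (\<lambda>i. a * v (f z) i)"
        using c i z by (simp add: coord_chart_def fibre_def)
      moreover have "k (proj E (vscale E a (f z)), v (vscale E a (f z))) = vscale E a (f z)"
        using bundle_vscale_in[OF i] z by (intro coord_chartD(4)[OF c]) simp_all
      ultimately show "k (proj E (f z), (\<lambda>i. a * v (f z) i)) = vscale E a (f z)"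
        using bundle_vscale_in[OF i] by simp
    qed
    then show ?thesis using W z U by (auto simp: W_def)
  qed
  then obtain W where "\<And>z. z \<in> topspace Z \<Longrightarrow> openin Z (W z) \<and> z \<in> W z \<and>
     continuous_map (subtopology Z (W z)) (tspace E) (\<lambda>z. vscale E a (f z))" by metis
  then have W: "openin Z (W z)" "z \<in> W z"
     "continuous_map (subtopology Z (W z)) (tspace E) (\<lambda>z. vscale E a (f z))" if "z \<in> topspace Z" for z
    using that by blast+
  show ?thesis
    by (rule pasting_lemma[where I = "topspace Z" and T = W and f = "\<lambda>_ z. vscale E a (f z)"])
      (use W in blast)+
qed

end

section \<open>Direct sums, conjugates and restrictions of bundles\<close>

lemma topspace_bundle_sum [simp]:
  "topspace (tspace (bundle_sum E F)) =
     {(e, f). e \<in> topspace (tspace E) \<and> f \<in> topspace (tspace F) \<and> proj E e = proj F f}"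
  by (auto simp: bundle_sum_def)

lemma bundle_sum_simps [simp]:
  "proj (bundle_sum E F) = (\<lambda>z. proj E (fst z))"
  "vadd (bundle_sum E F) z z' = (vadd E (fst z) (fst z'), vadd F (snd z) (snd z'))"
  "vscale (bundle_sum E F) c z = (vscale E c (fst z), vscale F c (snd z))"
  "vact (bundle_sum E F) g z = (vact E g (fst z), vact F g (snd z))"
  by (auto simp: bundle_sum_def case_prod_unfold)

lemma continuous_map_sum_fst:
  "continuous_map Z (tspace (bundle_sum E F)) f \<Longrightarrow> continuous_map Z (tspace E) (\<lambda>z. fst (f z))"
  unfolding bundle_sum_def vbundle.simps continuous_map_in_subtopology
  by (blast intro: continuous_map_fst_comp)

lemma continuous_map_sum_snd:
  "continuous_map Z (tspace (bundle_sum E F)) f \<Longrightarrow> continuous_map Z (tspace F) (\<lambda>z. snd (f z))"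
  unfolding bundle_sum_def vbundle.simps continuous_map_in_subtopology
  by (blast intro: continuous_map_snd_comp)

lemma continuous_map_into_sum:
  "\<lbrakk>continuous_map Z (tspace E) f; continuous_map Z (tspace F) g;
    \<And>z. z \<in> topspace Z \<Longrightarrow> proj E (f z) = proj F (g z)\<rbrakk>
    \<Longrightarrow> continuous_map Z (tspace (bundle_sum E F)) (\<lambda>z. (f z, g z))"
  unfolding bundle_sum_def vbundle.simps continuous_map_in_subtopology
  by (auto intro: continuous_map_pairedI)

lemma coord_chart_restrict:
  assumes c: "coord_chart B E U n v k"
  shows "coord_chart B E (U \<inter> U') n v k"
  unfolding coord_chart_def
proof (intro conjI ballI impI allI)
  show "continuous_map (subtopology (tspace E) {e. proj E e \<in> U \<inter> U'}) (cspace n) v"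
    using coord_chartD(1)[OF c] by (rule continuous_map_from_subtopology_mono) auto
  have "subtopology (prod_topology (subtopology B U) (cspace n)) (U' \<times> UNIV) =
      prod_topology (subtopology B (U \<inter> U')) (cspace n)"
    by (simp add: subtopology_Times subtopology_subtopology)
  then show "continuous_map (prod_topology (subtopology B (U \<inter> U')) (cspace n)) (tspace E) k"
    using continuous_map_from_subtopology[OF coord_chartD(2)[OF c]] by metis
qed (use c in \<open>auto simp: coord_chart_def\<close>)

lemma coord_chart_sum:
  assumes E: "coord_chart B E U n v k" and F: "coord_chart B F U m v' k'"
  shows "coord_chart B (bundle_sum E F) U (n + m)
     (\<lambda>z i. if i < n then v (fst z) i else v' (snd z) (i - n))
     (\<lambda>(b, w). (k (b, \<lambda>i. if i < n then w i else 0), k' (b, \<lambda>i. w (i + n))))"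
  (is "coord_chart B ?S U (n + m) ?v ?k")
  unfolding coord_chart_def
proof (intro conjI ballI impI allI)
  let ?Z = "subtopology (tspace ?S) {z. proj ?S z \<in> U}"
  have "continuous_map ?Z (subtopology (tspace E) {e. proj E e \<in> U}) (\<lambda>z. fst z)"
    unfolding continuous_map_in_subtopology
    by (auto intro!: continuous_map_sum_fst continuous_map_from_subtopology continuous_map_id')
  from continuous_map_comp[OF coord_chartD(1)[OF E] this]
  have 1: "continuous_map ?Z (cspace n) (\<lambda>z. v (fst z))" .
  have "continuous_map ?Z (subtopology (tspace F) {e. proj F e \<in> U}) (\<lambda>z. snd z)"
    unfolding continuous_map_in_subtopology
    by (auto intro!: continuous_map_sum_snd continuous_map_from_subtopology continuous_map_id')
  from continuous_map_comp[OF coord_chartD(1)[OF F] this]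
  have 2: "continuous_map ?Z (cspace m) (\<lambda>z. v' (snd z))" .
  have "continuous_map ?Z euclidean (\<lambda>z. ?v z i)" for i
    using continuous_map_coordinate[OF 1] continuous_map_coordinate[OF 2] by (cases "i < n") auto
  moreover have "?v z i = 0" if "z \<in> topspace ?Z" "i \<ge> n + m" for z i
    using that coord_chartD(7)[OF F, of "snd z" "i - n"] by auto
  ultimately show "continuous_map ?Z (cspace (n + m)) ?v"
    by (simp add: continuous_map_into_cspace)
next
  let ?Z = "prod_topology (subtopology B U) (cspace (n + m))"
  have w: "continuous_map ?Z euclidean (\<lambda>z. snd z i)" for i
    by (rule continuous_map_coordinate[OF continuous_map_snd])
  have "continuous_map ?Z (cspace n) (\<lambda>z i. if i < n then snd z i else 0)"
    using w by (auto simp: continuous_map_into_cspace)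
  then have 1: "continuous_map ?Z (tspace E) (\<lambda>z. k (fst z, \<lambda>i. if i < n then snd z i else 0))"
    by (intro continuous_map_comp[OF coord_chartD(2)[OF E]] continuous_map_pairedI continuous_map_fst)
  have "continuous_map ?Z (cspace m) (\<lambda>z i. snd z (i + n))"
    using w by (auto simp: continuous_map_into_cspace)
  then have 2: "continuous_map ?Z (tspace F) (\<lambda>z. k' (fst z, \<lambda>i. snd z (i + n)))"
    by (intro continuous_map_comp[OF coord_chartD(2)[OF F]] continuous_map_pairedI continuous_map_fst)
  have "continuous_map ?Z (tspace ?S)
     (\<lambda>z. (k (fst z, \<lambda>i. if i < n then snd z i else 0), k' (fst z, \<lambda>i. snd z (i + n))))"
    using coord_chartD(3)[OF E] coord_chartD(3)[OF F]
    by (intro continuous_map_into_sum 1 2) auto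
  then show "continuous_map ?Z (tspace ?S) ?k" by (simp add: case_prod_unfold)
next
  fix b w assume b: "b \<in> topspace B \<inter> U" and w: "w \<in> topspace (cspace (n + m))"
  have 1: "k (b, \<lambda>i. if i < n then w i else 0) \<in> topspace (tspace E) \<and>
     proj E (k (b, \<lambda>i. if i < n then w i else 0)) = b \<and>
     v (k (b, \<lambda>i. if i < n then w i else 0)) = (\<lambda>i. if i < n then w i else 0)"
    using b by (intro coord_chartD(3)[OF E]) auto
  have 2: "k' (b, \<lambda>i. w (i + n)) \<in> topspace (tspace F) \<and> proj F (k' (b, \<lambda>i. w (i + n))) = b \<and>
     v' (k' (b, \<lambda>i. w (i + n))) = (\<lambda>i. w (i + n))"
    using b w by (intro coord_chartD(3)[OF F]) auto
  show "proj ?S (?k (b, w)) = b" using 1 by simp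
  show "?v (?k (b, w)) = w" using 1 2 by (auto simp: fun_eq_iff)
next
  fix z assume z: "z \<in> topspace (tspace ?S)" "proj ?S z \<in> U"
  then have z1: "fst z \<in> topspace (tspace E)" "proj E (fst z) \<in> U"
    and z2: "snd z \<in> topspace (tspace F)" "proj F (snd z) \<in> U"
    and eq: "proj F (snd z) = proj E (fst z)" by auto
  have "(\<lambda>i. if i < n then ?v z i else 0) = v (fst z)"
    using coord_chartD(7)[OF E z1] by (auto simp: fun_eq_iff)
  moreover have "(\<lambda>i. ?v z (i + n)) = v' (snd z)" by simp
  ultimately show "?k (proj ?S z, ?v z) = z"
    using coord_chartD(4)[OF E z1] coord_chartD(4)[OF F z2] eq by (simp add: prod_eq_iff)
  show "?v (vadd ?S z z') = (\<lambda>i. ?v z i + ?v z' i)" if "z' \<in> fibre ?S (proj ?S z)" for z'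
  proof -
    have "fst z' \<in> topspace (tspace E)" "proj E (fst z') = proj E (fst z)"
      "snd z' \<in> topspace (tspace F)" "proj F (snd z') = proj F (snd z)"
      using that eq by (auto simp: fibre_def)
    then show ?thesis
      using coord_chartD(5)[OF E z1(1) _ _ z1(2)] coord_chartD(5)[OF F z2(1) _ _ z2(2)] by auto
  qed
  show "?v (vscale ?S c z) = (\<lambda>i. c * ?v z i)" for c
    using coord_chartD(6)[OF E z1] coord_chartD(6)[OF F z2] by auto
qed

lemma complex_vector_bundle_sum:
  assumes E: "complex_vector_bundle B E" and F: "complex_vector_bundle B F"
  shows "complex_vector_bundle B (bundle_sum E F)"
proof (rule complex_vector_bundleI)
  show "continuous_map (tspace (bundle_sum E F)) B (proj (bundle_sum E F))"
    unfolding bundle_sum_simps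
    by (rule continuous_map_comp[OF continuous_map_bundle_proj[OF E]
          continuous_map_sum_fst[OF continuous_map_id']])
next
  fix b assume b: "b \<in> topspace B"
  obtain U n v k where U: "openin B U" "b \<in> U" and c: "coord_chart B E U n v k"
    by (rule bundle_chart[OF E b])
  obtain U' n' v' k' where U': "openin B U'" "b \<in> U'" and c': "coord_chart B F U' n' v' k'"
    by (rule bundle_chart[OF F b])
  have "coord_chart B E (U \<inter> U') n v k" by (rule coord_chart_restrict[OF c])
  note coord_chart_sum[OF this]
  moreover have "coord_chart B F (U \<inter> U') n' v' k'"
    using coord_chart_restrict[OF c', of U] by (simp add: Int_commute)
  ultimately show "\<exists>U n v k. openin B U \<and> b \<in> U \<and> coord_chart B (bundle_sum E F) U n v k"
    using openin_Int[OF U(1) U'(1)] U(2) U'(2) by blast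
qed (auto simp: bundle_vadd_in[OF E] bundle_vadd_in[OF F] bundle_vscale_in[OF E] bundle_vscale_in[OF F])

lemma topspace_conj_bundle [simp]:
  "topspace (tspace (conj_bundle G B a F)) =
     {(s, x). s \<in> topspace (tspace F) \<and> x \<in> topspace (gs_top B) \<and> proj F s = gs_act B a x}"
  by (auto simp: conj_bundle_def)

lemma conj_bundle_simps [simp]:
  "proj (conj_bundle G B a F) = snd"
  "vadd (conj_bundle G B a F) z z' = (vadd F (fst z) (fst z'), snd z)"
  "vscale (conj_bundle G B a F) c z = (vscale F (cnj c) (fst z), snd z)"
  "vact (conj_bundle G B a F) g z =
     (vact F (a \<otimes>\<^bsub>G\<^esub> g \<otimes>\<^bsub>G\<^esub> inv\<^bsub>G\<^esub> a) (fst z), gs_act B g (snd z))"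
  by (auto simp: conj_bundle_def case_prod_unfold)

lemma continuous_map_conj_fst:
  "continuous_map Z (tspace (conj_bundle G B a F)) f \<Longrightarrow> continuous_map Z (tspace F) (\<lambda>z. fst (f z))"
  unfolding conj_bundle_def vbundle.simps continuous_map_in_subtopology
  by (blast intro: continuous_map_fst_comp)

lemma continuous_map_conj_snd:
  "continuous_map Z (tspace (conj_bundle G B a F)) f \<Longrightarrow> continuous_map Z (gs_top B) (\<lambda>z. snd (f z))"
  unfolding conj_bundle_def vbundle.simps continuous_map_in_subtopology
  by (blast intro: continuous_map_snd_comp)

lemma continuous_map_into_conj:
  "\<lbrakk>continuous_map Z (tspace F) f; continuous_map Z (gs_top B) g;
    \<And>z. z \<in> topspace Z \<Longrightarrow> proj F (f z) = gs_act B a (g z)\<rbrakk>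
    \<Longrightarrow> continuous_map Z (tspace (conj_bundle G B a F)) (\<lambda>z. (f z, g z))"
  unfolding conj_bundle_def vbundle.simps continuous_map_in_subtopology
  by (auto intro: continuous_map_pairedI)

lemma continuous_map_ccnj:
  "continuous_map Z euclidean f \<Longrightarrow> continuous_map Z euclidean (\<lambda>z. cnj (f z))"
  by (rule continuous_map_euclidean_comp) (auto intro: continuous_intros)

text \<open>
  The chart at \<open>x\<close> comes from a chart of \<open>F\<close> at \<open>a x\<close>; conjugating its coordinates makes it linear
  for the conjugate scalar multiplication.
\<close>

lemma coord_chart_conj:
  assumes ca: "continuous_map (gs_top B) (gs_top B) (gs_act B a)"
    and F: "coord_chart (gs_top B) F U n v k"
  shows "coord_chart (gs_top B) (conj_bundle G B a F) {x \<in> topspace (gs_top B). gs_act B a x \<in> U} n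
     (\<lambda>z i. cnj (v (fst z) i)) (\<lambda>(x, w). (k (gs_act B a x, \<lambda>i. cnj (w i)), x))"
  (is "coord_chart ?B ?C ?V n ?v ?k")
  unfolding coord_chart_def
proof (intro conjI ballI impI allI)
  have B_in: "gs_act B a x \<in> topspace ?B" if "x \<in> topspace ?B" for x
    using continuous_map_in_topspace[OF ca that] .
  let ?Z = "subtopology (tspace ?C) {z. proj ?C z \<in> ?V}"
  have "continuous_map ?Z (subtopology (tspace F) {e. proj F e \<in> U}) (\<lambda>z. fst z)"
    unfolding continuous_map_in_subtopology
    by (auto intro!: continuous_map_conj_fst continuous_map_from_subtopology continuous_map_id')
  from continuous_map_comp[OF coord_chartD(1)[OF F] this]
  show "continuous_map ?Z (cspace n) ?v"
    by (auto simp: continuous_map_into_cspace intro!: continuous_map_ccnj)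
  let ?Z = "prod_topology (subtopology ?B ?V) (cspace n)"
  have x: "continuous_map ?Z ?B (\<lambda>z. fst z)"
    using continuous_map_fst by (rule continuous_map_into_fulltopology)
  have "continuous_map ?Z (cspace n) (\<lambda>z i. cnj (snd z i))"
    using continuous_map_snd[of "subtopology ?B ?V" "cspace n"]
    by (auto simp: continuous_map_into_cspace intro!: continuous_map_ccnj)
  moreover have "continuous_map ?Z (subtopology ?B U) (\<lambda>z. gs_act B a (fst z))"
    using continuous_map_comp[OF ca x] by (auto simp: continuous_map_in_subtopology)
  ultimately have "continuous_map ?Z (tspace F) (\<lambda>z. k (gs_act B a (fst z), \<lambda>i. cnj (snd z i)))"
    by (intro continuous_map_comp[OF coord_chartD(2)[OF F]] continuous_map_pairedI)
  then have "continuous_map ?Z (tspace ?C)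
      (\<lambda>z. (k (gs_act B a (fst z), \<lambda>i. cnj (snd z i)), fst z))"
    using coord_chartD(3)[OF F] B_in by (intro continuous_map_into_conj x) auto
  then show "continuous_map ?Z (tspace ?C) ?k" by (simp add: case_prod_unfold)
  fix b w assume b: "b \<in> topspace ?B \<inter> ?V" and w: "w \<in> topspace (cspace n)"
  then have "k (gs_act B a b, \<lambda>i. cnj (w i)) \<in> topspace (tspace F) \<and>
     proj F (k (gs_act B a b, \<lambda>i. cnj (w i))) = gs_act B a b \<and>
     v (k (gs_act B a b, \<lambda>i. cnj (w i))) = (\<lambda>i. cnj (w i))"
    using B_in by (intro coord_chartD(3)[OF F]) auto
  then show "proj ?C (?k (b, w)) = b" "?v (?k (b, w)) = w" by simp_all
next
  fix z assume z: "z \<in> topspace (tspace ?C)" "proj ?C z \<in> ?V"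
  then have z1: "fst z \<in> topspace (tspace F)" "proj F (fst z) \<in> U"
    and eq: "proj F (fst z) = gs_act B a (snd z)" by auto
  show "?k (proj ?C z, ?v z) = z"
    using coord_chartD(4)[OF F z1] eq by (simp add: prod_eq_iff)
  show "?v (vadd ?C z z') = (\<lambda>i. ?v z i + ?v z' i)" if "z' \<in> fibre ?C (proj ?C z)" for z'
  proof -
    have "fst z' \<in> topspace (tspace F)" "proj F (fst z') = proj F (fst z)"
      using that eq by (auto simp: fibre_def)
    then show ?thesis using coord_chartD(5)[OF F z1(1) _ _ z1(2)] by auto
  qed
  show "?v (vscale ?C c z) = (\<lambda>i. c * ?v z i)" for c
    using coord_chartD(6)[OF F z1] by auto
qed

lemma complex_vector_bundle_conj:
  assumes F: "complex_vector_bundle (gs_top B) F"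
    and ca: "continuous_map (gs_top B) (gs_top B) (gs_act B a)"
  shows "complex_vector_bundle (gs_top B) (conj_bundle G B a F)"
proof (rule complex_vector_bundleI)
  show "continuous_map (tspace (conj_bundle G B a F)) (gs_top B) (proj (conj_bundle G B a F))"
    unfolding conj_bundle_simps by (rule continuous_map_conj_snd[OF continuous_map_id'])
next
  fix b assume b: "b \<in> topspace (gs_top B)"
  then have "gs_act B a b \<in> topspace (gs_top B)" by (rule continuous_map_in_topspace[OF ca])
  then obtain U n v k where U: "openin (gs_top B) U" "gs_act B a b \<in> U"
    and c: "coord_chart (gs_top B) F U n v k"
    by (rule bundle_chart[OF F])
  let ?V = "{x \<in> topspace (gs_top B). gs_act B a x \<in> U}"
  have "openin (gs_top B) ?V" by (rule openin_continuous_map_preimage[OF ca U(1)])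
  moreover have "b \<in> ?V" using b U by simp
  ultimately show "\<exists>U n v k. openin (gs_top B) U \<and> b \<in> U \<and>
      coord_chart (gs_top B) (conj_bundle G B a F) U n v k"
    using coord_chart_conj[OF ca c, of G] by blast
qed (auto simp: bundle_vadd_in[OF F] bundle_vscale_in[OF F])

lemma restrict_bundle_simps [simp]:
  "proj (restrict_bundle S E) = proj E"
  "vadd (restrict_bundle S E) = vadd E"
  "vscale (restrict_bundle S E) = vscale E"
  "vact (restrict_bundle S E) = vact E"
  "tspace (restrict_bundle S E) = subtopology (tspace E) {e. proj E e \<in> S}"
  by (auto simp: restrict_bundle_def)

lemma complex_vector_bundle_restrict:
  assumes E: "complex_vector_bundle B E"
  shows "complex_vector_bundle (subtopology B S) (restrict_bundle S E)"
proof (rule complex_vector_bundleI)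
  show "continuous_map (tspace (restrict_bundle S E)) (subtopology B S) (proj (restrict_bundle S E))"
    using continuous_map_bundle_proj[OF E]
    by (auto simp: continuous_map_in_subtopology continuous_map_from_subtopology)
next
  fix b assume "b \<in> topspace (subtopology B S)"
  then have b: "b \<in> topspace B" "b \<in> S" by auto
  obtain U n v k where U: "openin B U" "b \<in> U" and c: "coord_chart B E U n v k"
    by (rule bundle_chart[OF E b(1)])
  have c': "coord_chart B E (U \<inter> S) n v k" by (rule coord_chart_restrict[OF c])
  have top: "subtopology (subtopology B S) (U \<inter> S) = subtopology B (U \<inter> S)"
    "subtopology (subtopology (tspace E) {e. proj E e \<in> S}) {e. proj E e \<in> U \<inter> S} =
      subtopology (tspace E) {e. proj E e \<in> U \<inter> S}"
    by (auto simp: subtopology_subtopology intro: arg_cong[where f = "subtopology _"])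
  have "coord_chart (subtopology B S) (restrict_bundle S E) (U \<inter> S) n v k"
    unfolding coord_chart_def restrict_bundle_simps top
  proof (intro conjI ballI impI allI)
    show "continuous_map (subtopology (tspace E) {e. proj E e \<in> U \<inter> S}) (cspace n) v"
      by (rule coord_chartD(1)[OF c'])
    show "continuous_map (prod_topology (subtopology B (U \<inter> S)) (cspace n))
        (subtopology (tspace E) {e. proj E e \<in> S}) k"
      unfolding continuous_map_in_subtopology using coord_chartD(2,3)[OF c'] by auto
  qed (use coord_chartD[OF c'] in \<open>auto simp: fibre_def\<close>)
  moreover have "openin (subtopology B S) (U \<inter> S)" using U by (auto simp: openin_subtopology)
  ultimately show "\<exists>U n v k. openin (subtopology B S) U \<and> b \<in> U \<and>
      coord_chart (subtopology B S) (restrict_bundle S E) U n v k"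
    using U b by blast
qed (auto simp: bundle_vadd_in[OF E] bundle_vscale_in[OF E])

lemma complex_vector_bundle_zero: "complex_vector_bundle (gs_top B) (zero_bundle B)"
proof (rule complex_vector_bundleI)
  have Z: "coord_chart (gs_top B) (zero_bundle B) (topspace (gs_top B)) 0 snd id"
    unfolding coord_chart_def
  proof (intro conjI ballI impI allI)
    show "continuous_map (subtopology (tspace (zero_bundle B))
        {e. proj (zero_bundle B) e \<in> topspace (gs_top B)}) (cspace 0) snd"
      by (simp add: zero_bundle_def continuous_map_from_subtopology continuous_map_snd)
  qed (auto simp: zero_bundle_def fibre_def)
  fix b assume "b \<in> topspace (gs_top B)"
  with Z show "\<exists>U n v k. openin (gs_top B) U \<and> b \<in> U \<and> coord_chart (gs_top B) (zero_bundle B) U n v k"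
    by (metis openin_topspace)
qed (auto simp: zero_bundle_def continuous_map_fst)

section \<open>Equivariant bundles and their isomorphisms\<close>

lemma equivariant_bundleI:
  assumes "complex_vector_bundle (gs_top B) E"
    and "continuous_map (prod_topology (gtop G) (tspace E)) (tspace E) (\<lambda>(g, e). vact E g e)"
    and "\<And>e. e \<in> topspace (tspace E) \<Longrightarrow> vact E \<one>\<^bsub>G\<^esub> e = e"
    and "\<And>g h e. \<lbrakk>g \<in> carrier G; h \<in> carrier G; e \<in> topspace (tspace E)\<rbrakk> \<Longrightarrow>
      vact E (g \<otimes>\<^bsub>G\<^esub> h) e = vact E g (vact E h e)"
    and "\<And>g e. \<lbrakk>g \<in> carrier G; e \<in> topspace (tspace E)\<rbrakk> \<Longrightarrow>
      proj E (vact E g e) = gs_act B g (proj E e)"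
    and "\<And>g e e'. \<lbrakk>g \<in> carrier G; e \<in> topspace (tspace E); e' \<in> topspace (tspace E);
      proj E e' = proj E e\<rbrakk> \<Longrightarrow> vact E g (vadd E e e') = vadd E (vact E g e) (vact E g e')"
    and "\<And>g e c. \<lbrakk>g \<in> carrier G; e \<in> topspace (tspace E)\<rbrakk> \<Longrightarrow>
      vact E g (vscale E c e) = vscale E (if phase G g = 0 then c else cnj c) (vact E g e)"
  shows "equivariant_bundle G B E"
  unfolding equivariant_bundle_def using assms by (simp add: fibre_def)

context
  fixes G :: "'g mgroup" and B :: "('g, 'b) gspace" and E :: "('e, 'b, 'g) vbundle"
  assumes E: "equivariant_bundle G B E"
begin

lemma equivariant_bundle_imp_vector: "complex_vector_bundle (gs_top B) E"
  using E by (simp add: equivariant_bundle_def)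

lemma vact_one: "e \<in> topspace (tspace E) \<Longrightarrow> vact E \<one>\<^bsub>G\<^esub> e = e"
  using E by (simp add: equivariant_bundle_def)

lemma vact_mult:
  "\<lbrakk>g \<in> carrier G; h \<in> carrier G; e \<in> topspace (tspace E)\<rbrakk> \<Longrightarrow>
    vact E (g \<otimes>\<^bsub>G\<^esub> h) e = vact E g (vact E h e)"
  using E by (simp add: equivariant_bundle_def)

lemma proj_vact:
  "\<lbrakk>g \<in> carrier G; e \<in> topspace (tspace E)\<rbrakk> \<Longrightarrow> proj E (vact E g e) = gs_act B g (proj E e)"
  using E by (simp add: equivariant_bundle_def)

lemma vact_vadd:
  "\<lbrakk>g \<in> carrier G; e \<in> topspace (tspace E); e' \<in> topspace (tspace E); proj E e' = proj E e\<rbrakk> \<Longrightarrow>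
    vact E g (vadd E e e') = vadd E (vact E g e) (vact E g e')"
  using E bundle_proj_in[OF equivariant_bundle_imp_vector, of e]
  unfolding equivariant_bundle_def fibre_def by blast

lemma vact_vscale:
  "\<lbrakk>g \<in> carrier G; e \<in> topspace (tspace E)\<rbrakk> \<Longrightarrow>
    vact E g (vscale E c e) = vscale E (if phase G g = 0 then c else cnj c) (vact E g e)"
  using E by (simp add: equivariant_bundle_def)

lemma continuous_map_vact:
  "\<lbrakk>continuous_map Z (gtop G) \<gamma>; continuous_map Z (tspace E) f\<rbrakk> \<Longrightarrow>
    continuous_map Z (tspace E) (\<lambda>z. vact E (\<gamma> z) (f z))"
  by (rule continuous_map_comp2) (use E in \<open>auto simp: equivariant_bundle_def\<close>)

lemma vact_in:
  assumes "topspace (gtop G) = carrier G" "g \<in> carrier G" "e \<in> topspace (tspace E)"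
  shows "vact E g e \<in> topspace (tspace E)"
  using continuous_map_in_topspace[of "prod_topology (gtop G) (tspace E)" "tspace E"
      "\<lambda>(g, e). vact E g e" "(g, e)"] E assms by (simp add: equivariant_bundle_def)

end

lemma bundle_homI:
  assumes "continuous_map (tspace E) (tspace F) f"
    and "\<And>e. e \<in> topspace (tspace E) \<Longrightarrow> proj F (f e) = proj E e"
    and "\<And>e e'. \<lbrakk>e \<in> topspace (tspace E); e' \<in> topspace (tspace E); proj E e' = proj E e\<rbrakk> \<Longrightarrow>
      f (vadd E e e') = vadd F (f e) (f e')"
    and "\<And>e c. e \<in> topspace (tspace E) \<Longrightarrow> f (vscale E c e) = vscale F c (f e)"
    and "\<And>g e. \<lbrakk>g \<in> carrier G; e \<in> topspace (tspace E)\<rbrakk> \<Longrightarrow> f (vact E g e) = vact F g (f e)"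
  shows "bundle_hom G B E F f"
  unfolding bundle_hom_def using assms by (simp add: fibre_def)

lemma bundle_homD:
  assumes "bundle_hom G B E F f"
  shows "continuous_map (tspace E) (tspace F) f"
    and "e \<in> topspace (tspace E) \<Longrightarrow> f e \<in> topspace (tspace F)"
    and "e \<in> topspace (tspace E) \<Longrightarrow> proj F (f e) = proj E e"
    and "\<lbrakk>complex_vector_bundle (gs_top B) E; e \<in> topspace (tspace E); e' \<in> topspace (tspace E);
      proj E e' = proj E e\<rbrakk> \<Longrightarrow> f (vadd E e e') = vadd F (f e) (f e')"
    and "e \<in> topspace (tspace E) \<Longrightarrow> f (vscale E c e) = vscale F c (f e)"
    and "\<lbrakk>g \<in> carrier G; e \<in> topspace (tspace E)\<rbrakk> \<Longrightarrow> f (vact E g e) = vact F g (f e)"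
proof -
  show c: "continuous_map (tspace E) (tspace F) f"
    using assms by (simp add: bundle_hom_def)
  show "e \<in> topspace (tspace E) \<Longrightarrow> f e \<in> topspace (tspace F)"
    by (rule continuous_map_in_topspace[OF c])
  show "f (vadd E e e') = vadd F (f e) (f e')"
    if "complex_vector_bundle (gs_top B) E" "e \<in> topspace (tspace E)" "e' \<in> topspace (tspace E)"
      "proj E e' = proj E e"
    using assms that bundle_proj_in[OF that(1,2)] unfolding bundle_hom_def fibre_def by blast
qed (use assms in \<open>auto simp: bundle_hom_def\<close>)

text \<open>
  The inverse of a bijective homomorphism is automatically linear and equivariant, so only its
  continuity has to be checked.
\<close>

lemma bundle_iso_bij_hom:
  assumes tg: "topspace (gtop G) = carrier G"
    and E: "equivariant_bundle G B E" and F: "equivariant_bundle G B F"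
    and f: "bundle_hom G B E F f" and g: "continuous_map (tspace F) (tspace E) g"
    and gf: "\<And>e. e \<in> topspace (tspace E) \<Longrightarrow> g (f e) = e"
    and fg: "\<And>y. y \<in> topspace (tspace F) \<Longrightarrow> f (g y) = y"
  shows "bundle_iso G B E F"
proof -
  note cE = equivariant_bundle_imp_vector[OF E]
  have gin: "g y \<in> topspace (tspace E)" if "y \<in> topspace (tspace F)" for y
    using continuous_map_in_topspace[OF g that] .
  have gp: "proj E (g y) = proj F y" if "y \<in> topspace (tspace F)" for y
    using bundle_homD(3)[OF f gin[OF that]] fg[OF that] by simp
  have "bundle_hom G B F E g"
  proof (rule bundle_homI)
    fix y y' assume y: "y \<in> topspace (tspace F)" "y' \<in> topspace (tspace F)" "proj F y' = proj F y"
    then have p: "proj E (g y') = proj E (g y)" by (simp add: gp)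
    have "g (vadd F y y') = g (vadd F (f (g y)) (f (g y')))" using fg y by simp
    also have "\<dots> = g (f (vadd E (g y) (g y')))"
      using bundle_homD(4)[OF f cE gin[OF y(1)] gin[OF y(2)] p] by simp
    finally show "g (vadd F y y') = vadd E (g y) (g y')"
      using gf bundle_vadd_in[OF cE gin[OF y(1)] gin[OF y(2)] p] by simp
  next
    fix y c assume y: "y \<in> topspace (tspace F)"
    have "g (vscale F c y) = g (f (vscale E c (g y)))"
      using bundle_homD(5)[OF f gin[OF y]] fg[OF y] by simp
    then show "g (vscale F c y) = vscale E c (g y)"
      using gf bundle_vscale_in[OF cE gin[OF y]] by simp
  next
    fix h y assume h: "h \<in> carrier G" and y: "y \<in> topspace (tspace F)"
    have "g (vact F h y) = g (f (vact E h (g y)))"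
      using bundle_homD(6)[OF f h gin[OF y]] fg[OF y] by simp
    then show "g (vact F h y) = vact E h (g y)"
      using gf vact_in[OF E tg h gin[OF y]] by simp
  qed (use g gp in auto)
  then show ?thesis unfolding bundle_iso_def using f gf fg by blast
qed

lemma bundle_iso_refl: "bundle_iso G B E E"
  unfolding bundle_iso_def bundle_hom_def
  by (rule exI[of _ "\<lambda>e. e"], rule exI[of _ "\<lambda>e. e"]) (simp add: continuous_map_id')

lemma bundle_iso_sym: "bundle_iso G B E F \<Longrightarrow> bundle_iso G B F E"
  unfolding bundle_iso_def by blast

lemma bundle_hom_comp:
  assumes E: "complex_vector_bundle (gs_top B) E"
    and f: "bundle_hom G B E F f" and g: "bundle_hom G B F H g"
    and F: "complex_vector_bundle (gs_top B) F"
  shows "bundle_hom G B E H (\<lambda>e. g (f e))"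
  by (rule bundle_homI)
    (auto simp: bundle_homD(2-6)[OF f] bundle_homD(2-6)[OF g] E F
      intro: continuous_map_comp[OF bundle_homD(1)[OF g] bundle_homD(1)[OF f]])

lemma bundle_iso_trans:
  assumes "complex_vector_bundle (gs_top B) E" "complex_vector_bundle (gs_top B) F"
    "complex_vector_bundle (gs_top B) H"
    and "bundle_iso G B E F" "bundle_iso G B F H"
  shows "bundle_iso G B E H"
proof -
  obtain f f' where f: "bundle_hom G B E F f" "bundle_hom G B F E f'"
    "\<And>e. e \<in> topspace (tspace E) \<Longrightarrow> f' (f e) = e" "\<And>e. e \<in> topspace (tspace F) \<Longrightarrow> f (f' e) = e"
    using assms(4) unfolding bundle_iso_def by blast
  obtain g g' where g: "bundle_hom G B F H g" "bundle_hom G B H F g'"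
    "\<And>e. e \<in> topspace (tspace F) \<Longrightarrow> g' (g e) = e" "\<And>e. e \<in> topspace (tspace H) \<Longrightarrow> g (g' e) = e"
    using assms(5) unfolding bundle_iso_def by blast
  show ?thesis
    unfolding bundle_iso_def
    using bundle_hom_comp[OF assms(1) f(1) g(1) assms(2)] bundle_hom_comp[OF assms(3) g(2) f(2) assms(2)]
      f(3,4) g(3,4) bundle_homD(2)[OF f(1)] bundle_homD(2)[OF g(2)]
    by (intro exI[of _ "\<lambda>e. g (f e)"] exI[of _ "\<lambda>e. f' (g' e)"]) simp
qed

lemma equivariant_bundle_sum:
  assumes tg: "topspace (gtop G) = carrier G"
    and E: "equivariant_bundle G B E" and F: "equivariant_bundle G B F"
  shows "equivariant_bundle G B (bundle_sum E F)"
proof (rule equivariant_bundleI)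
  show "complex_vector_bundle (gs_top B) (bundle_sum E F)"
    by (intro complex_vector_bundle_sum equivariant_bundle_imp_vector[OF E]
        equivariant_bundle_imp_vector[OF F])
next
  let ?Z = "prod_topology (gtop G) (tspace (bundle_sum E F))"
  have "continuous_map ?Z (tspace (bundle_sum E F))
      (\<lambda>z. (vact E (fst z) (fst (snd z)), vact F (fst z) (snd (snd z))))"
  proof (rule continuous_map_into_sum)
    show "continuous_map ?Z (tspace E) (\<lambda>z. vact E (fst z) (fst (snd z)))"
      by (rule continuous_map_vact[OF E continuous_map_fst continuous_map_sum_fst[OF continuous_map_snd]])
    show "continuous_map ?Z (tspace F) (\<lambda>z. vact F (fst z) (snd (snd z)))"
      by (rule continuous_map_vact[OF F continuous_map_fst continuous_map_sum_snd[OF continuous_map_snd]])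
  qed (auto simp: tg proj_vact[OF E] proj_vact[OF F])
  then show "continuous_map ?Z (tspace (bundle_sum E F)) (\<lambda>(g, e). vact (bundle_sum E F) g e)"
    by (simp add: case_prod_unfold)
qed (auto simp: vact_one[OF E] vact_one[OF F] vact_mult[OF E] vact_mult[OF F] proj_vact[OF E]
    vact_vadd[OF E] vact_vadd[OF F] vact_vscale[OF E] vact_vscale[OF F])

lemma G_spaceD:
  assumes "G_space G B"
  shows "\<lbrakk>continuous_map Z (gtop G) \<gamma>; continuous_map Z (gs_top B) f\<rbrakk> \<Longrightarrow>
      continuous_map Z (gs_top B) (\<lambda>z. gs_act B (\<gamma> z) (f z))"
    and "x \<in> topspace (gs_top B) \<Longrightarrow> gs_act B \<one>\<^bsub>G\<^esub> x = x"
    and "\<lbrakk>g \<in> carrier G; h \<in> carrier G; x \<in> topspace (gs_top B)\<rbrakk> \<Longrightarrow>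
      gs_act B (g \<otimes>\<^bsub>G\<^esub> h) x = gs_act B g (gs_act B h x)"
    and "\<lbrakk>topspace (gtop G) = carrier G; g \<in> carrier G; x \<in> topspace (gs_top B)\<rbrakk> \<Longrightarrow>
      gs_act B g x \<in> topspace (gs_top B)"
proof -
  have c: "continuous_map (prod_topology (gtop G) (gs_top B)) (gs_top B) (\<lambda>(g, x). gs_act B g x)"
    using assms by (simp add: G_space_def)
  show "continuous_map Z (gs_top B) (\<lambda>z. gs_act B (\<gamma> z) (f z))"
    if "continuous_map Z (gtop G) \<gamma>" "continuous_map Z (gs_top B) f"
    by (rule continuous_map_comp2[OF c that])
  show "gs_act B g x \<in> topspace (gs_top B)"
    if "topspace (gtop G) = carrier G" "g \<in> carrier G" "x \<in> topspace (gs_top B)"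
    using continuous_map_in_topspace[OF c, of "(g, x)"] that by simp
qed (use assms in \<open>auto simp: G_space_def\<close>)

lemma equivariant_bundle_zero:
  assumes B: "G_space G B"
  shows "equivariant_bundle G B (zero_bundle B)"
proof (rule equivariant_bundleI)
  show "complex_vector_bundle (gs_top B) (zero_bundle B)" by (rule complex_vector_bundle_zero)
next
  let ?Z = "prod_topology (gtop G) (tspace (zero_bundle B))"
  have s: "continuous_map ?Z (prod_topology (gs_top B) (cspace 0)) snd"
    using continuous_map_snd[of "gtop G" "tspace (zero_bundle B)"] by (simp add: zero_bundle_def)
  have "continuous_map ?Z (prod_topology (gs_top B) (cspace 0))
      (\<lambda>z. (gs_act B (fst z) (fst (snd z)), snd (snd z)))"
    by (intro continuous_map_pairedI G_spaceD(1)[OF B] continuous_map_fst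
        continuous_map_fst_comp[OF s] continuous_map_snd_comp[OF s])
  then show "continuous_map ?Z (tspace (zero_bundle B)) (\<lambda>(g, e). vact (zero_bundle B) g e)"
    by (simp add: zero_bundle_def case_prod_unfold)
qed (auto simp: zero_bundle_def G_spaceD[OF B])

lemma sub_gspace_simps [simp]:
  "gs_top (sub_gspace B S) = subtopology (gs_top B) S" "gs_act (sub_gspace B S) = gs_act B"
  by (simp_all add: sub_gspace_def)

lemma G_space_sub:
  assumes tg: "topspace (gtop G) = carrier G" and B: "G_space G B"
    and S: "\<And>g x. \<lbrakk>g \<in> carrier G; x \<in> topspace (gs_top B); x \<in> S\<rbrakk> \<Longrightarrow> gs_act B g x \<in> S"
  shows "G_space G (sub_gspace B S)"
  unfolding G_space_def
proof (intro conjI ballI)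
  have "continuous_map (prod_topology (gtop G) (subtopology (gs_top B) S)) (gs_top B)
      (\<lambda>z. gs_act B (fst z) (snd z))"
    by (intro G_spaceD(1)[OF B] continuous_map_fst continuous_map_into_fulltopology[OF continuous_map_snd])
  then show "continuous_map (prod_topology (gtop G) (gs_top (sub_gspace B S)))
      (gs_top (sub_gspace B S)) (\<lambda>(g, x). gs_act (sub_gspace B S) g x)"
    using S by (auto simp: continuous_map_in_subtopology case_prod_unfold tg)
qed (auto simp: G_spaceD[OF B])

lemma equivariant_bundle_restrict:
  assumes tg: "topspace (gtop G) = carrier G" and E: "equivariant_bundle G B E"
    and S: "\<And>g x. \<lbrakk>g \<in> carrier G; x \<in> topspace (gs_top B); x \<in> S\<rbrakk> \<Longrightarrow> gs_act B g x \<in> S"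
  shows "equivariant_bundle G (sub_gspace B S) (restrict_bundle S E)"
proof (rule equivariant_bundleI)
  note cE = equivariant_bundle_imp_vector[OF E]
  show "complex_vector_bundle (gs_top (sub_gspace B S)) (restrict_bundle S E)"
    using complex_vector_bundle_restrict[OF cE] by simp
  let ?Z = "prod_topology (gtop G) (tspace (restrict_bundle S E))"
  have "continuous_map ?Z (tspace E) (\<lambda>z. vact E (fst z) (snd z))"
    unfolding restrict_bundle_simps
    by (intro continuous_map_vact[OF E] continuous_map_fst
        continuous_map_into_fulltopology[OF continuous_map_snd])
  then show "continuous_map ?Z (tspace (restrict_bundle S E)) (\<lambda>(g, e). vact (restrict_bundle S E) g e)"
    using S bundle_proj_in[OF cE]
    by (auto simp: continuous_map_in_subtopology case_prod_unfold tg proj_vact[OF E])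
qed (auto simp: vact_one[OF E] vact_mult[OF E] proj_vact[OF E] vact_vadd[OF E] vact_vscale[OF E])

lemma bundle_hom_restrict:
  assumes f: "bundle_hom G B E F f" and E: "complex_vector_bundle (gs_top B) E"
  shows "bundle_hom G (sub_gspace B S) (restrict_bundle S E) (restrict_bundle S F) f"
  by (rule bundle_homI)
    (use bundle_homD[OF f] E in
      \<open>auto simp: continuous_map_in_subtopology continuous_map_from_subtopology\<close>)

lemma bundle_iso_restrict:
  assumes "complex_vector_bundle (gs_top B) E" "complex_vector_bundle (gs_top B) F"
    and "bundle_iso G B E F"
  shows "bundle_iso G (sub_gspace B S) (restrict_bundle S E) (restrict_bundle S F)"
proof -
  obtain f f' where f: "bundle_hom G B E F f" "bundle_hom G B F E f'"
    "\<And>e. e \<in> topspace (tspace E) \<Longrightarrow> f' (f e) = e" "\<And>e. e \<in> topspace (tspace F) \<Longrightarrow> f (f' e) = e"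
    using assms(3) unfolding bundle_iso_def by blast
  show ?thesis
    unfolding bundle_iso_def
    using bundle_hom_restrict[OF f(1) assms(1)] bundle_hom_restrict[OF f(2) assms(2)] f(3,4)
    by (intro exI[of _ f] exI[of _ f']) simp
qed

lemma restrict_bundle_sum:
  "restrict_bundle S (bundle_sum E F) = bundle_sum (restrict_bundle S E) (restrict_bundle S F)"
proof -
  have "subtopology (subtopology (prod_topology (tspace E) (tspace F)) {(e, f). proj E e = proj F f})
       {z. proj E (fst z) \<in> S} =
     subtopology (subtopology (prod_topology (tspace E) (tspace F))
       ({e. proj E e \<in> S} \<times> {f. proj F f \<in> S})) {(e, f). proj E e = proj F f}"
    unfolding subtopology_subtopology by (rule arg_cong[where f = "subtopology _"]) auto
  then show ?thesis
    by (simp add: restrict_bundle_def bundle_sum_def subtopology_Times case_prod_unfold)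
qed

lemma bundle_hom_sum:
  assumes E: "complex_vector_bundle (gs_top B) E" and F: "complex_vector_bundle (gs_top B) F"
    and f: "bundle_hom G B E E' f" and g: "bundle_hom G B F F' g"
  shows "bundle_hom G B (bundle_sum E F) (bundle_sum E' F') (\<lambda>z. (f (fst z), g (snd z)))"
proof (rule bundle_homI)
  show "continuous_map (tspace (bundle_sum E F)) (tspace (bundle_sum E' F'))
     (\<lambda>z. (f (fst z), g (snd z)))"
    by (intro continuous_map_into_sum continuous_map_comp[OF bundle_homD(1)[OF f]]
        continuous_map_comp[OF bundle_homD(1)[OF g]] continuous_map_sum_fst[OF continuous_map_id']
        continuous_map_sum_snd[OF continuous_map_id'])
      (auto simp: bundle_homD(3)[OF f] bundle_homD(3)[OF g])
qed (auto simp: bundle_homD(3,5,6)[OF f] bundle_homD(3,5,6)[OF g]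
    bundle_homD(4)[OF f E] bundle_homD(4)[OF g F])

lemma bundle_iso_sum:
  assumes cv: "complex_vector_bundle (gs_top B) E" "complex_vector_bundle (gs_top B) E'"
    "complex_vector_bundle (gs_top B) F" "complex_vector_bundle (gs_top B) F'"
    and "bundle_iso G B E E'" "bundle_iso G B F F'"
  shows "bundle_iso G B (bundle_sum E F) (bundle_sum E' F')"
proof -
  obtain f f' where f: "bundle_hom G B E E' f" "bundle_hom G B E' E f'"
    "\<And>e. e \<in> topspace (tspace E) \<Longrightarrow> f' (f e) = e" "\<And>e. e \<in> topspace (tspace E') \<Longrightarrow> f (f' e) = e"
    using assms(5) unfolding bundle_iso_def by blast
  obtain g g' where g: "bundle_hom G B F F' g" "bundle_hom G B F' F g'"
    "\<And>e. e \<in> topspace (tspace F) \<Longrightarrow> g' (g e) = e" "\<And>e. e \<in> topspace (tspace F') \<Longrightarrow> g (g' e) = e"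
    using assms(6) unfolding bundle_iso_def by blast
  show ?thesis
    unfolding bundle_iso_def
    using bundle_hom_sum[OF cv(1,3) f(1) g(1)] bundle_hom_sum[OF cv(2,4) f(2) g(2)] f(3,4) g(3,4)
    by (intro exI[of _ "\<lambda>z. (f (fst z), g (snd z))"] exI[of _ "\<lambda>z. (f' (fst z), g' (snd z))"]) auto
qed

lemma bundle_hom_sum_swap: "bundle_hom G B (bundle_sum E F) (bundle_sum F E) (\<lambda>z. (snd z, fst z))"
proof (rule bundle_homI)
  show "continuous_map (tspace (bundle_sum E F)) (tspace (bundle_sum F E)) (\<lambda>z. (snd z, fst z))"
    by (intro continuous_map_into_sum continuous_map_sum_fst[OF continuous_map_id']
        continuous_map_sum_snd[OF continuous_map_id']) auto
qed auto

lemma bundle_iso_sum_commute: "bundle_iso G B (bundle_sum E F) (bundle_sum F E)"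
  unfolding bundle_iso_def using bundle_hom_sum_swap[of G B E F] bundle_hom_sum_swap[of G B F E]
  by (intro exI[of _ "\<lambda>z. (snd z, fst z)"]) auto

lemma bundle_iso_sum_assoc:
  "bundle_iso G B (bundle_sum (bundle_sum E F) H) (bundle_sum E (bundle_sum F H))"
proof -
  let ?L = "bundle_sum (bundle_sum E F) H" and ?R = "bundle_sum E (bundle_sum F H)"
  note id = continuous_map_id'
  have 1: "bundle_hom G B ?L ?R (\<lambda>z. (fst (fst z), (snd (fst z), snd z)))"
  proof (rule bundle_homI)
    show "continuous_map (tspace ?L) (tspace ?R) (\<lambda>z. (fst (fst z), (snd (fst z), snd z)))"
      by (intro continuous_map_into_sum
          continuous_map_sum_fst[OF continuous_map_sum_fst[OF id]]
          continuous_map_sum_snd[OF continuous_map_sum_fst[OF id]] continuous_map_sum_snd[OF id]) auto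
  qed auto
  have 2: "bundle_hom G B ?R ?L (\<lambda>z. ((fst z, fst (snd z)), snd (snd z)))"
  proof (rule bundle_homI)
    show "continuous_map (tspace ?R) (tspace ?L) (\<lambda>z. ((fst z, fst (snd z)), snd (snd z)))"
      by (intro continuous_map_into_sum
          continuous_map_sum_fst[OF continuous_map_sum_snd[OF id]]
          continuous_map_sum_snd[OF continuous_map_sum_snd[OF id]] continuous_map_sum_fst[OF id]) auto
  qed auto
  show ?thesis
    unfolding bundle_iso_def using 1 2
    by (intro exI[of _ "\<lambda>z. (fst (fst z), (snd (fst z), snd z))"]
        exI[of _ "\<lambda>z. ((fst z, fst (snd z)), snd (snd z))"]) auto
qed

section \<open>Linear algebra in the fibres\<close>

context
  fixes B :: "'b topology" and E :: "('e, 'b, 'g) vbundle" and b :: 'b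
  assumes E: "complex_vector_bundle B E" and b: "b \<in> topspace B"
begin

lemma fibre_closed:
  "\<lbrakk>e \<in> fibre E b; e' \<in> fibre E b\<rbrakk> \<Longrightarrow> vadd E e e' \<in> fibre E b"
  "e \<in> fibre E b \<Longrightarrow> vscale E c e \<in> fibre E b"
  using E b by (auto simp: complex_vector_bundle_def)

text \<open>
  Coordinates are injective on a fibre, so identities between linear combinations of vectors reduce
  to identities between complex numbers.
\<close>

lemma fibre_eqI:
  assumes "p \<in> fibre E b" "q \<in> fibre E b"
    and "\<And>v :: 'e \<Rightarrow> nat \<Rightarrow> complex.
      \<lbrakk>\<And>e e'. \<lbrakk>e \<in> fibre E b; e' \<in> fibre E b\<rbrakk> \<Longrightarrow> v (vadd E e e') = (\<lambda>i. v e i + v e' i);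
       \<And>c e. e \<in> fibre E b \<Longrightarrow> v (vscale E c e) = (\<lambda>i. c * v e i)\<rbrakk> \<Longrightarrow> v p = v q"
  shows "p = q"
proof (rule fibre_coordinates[OF E b])
  fix v :: "'e \<Rightarrow> nat \<Rightarrow> complex"
  assume inj: "inj_on v (fibre E b)"
    and v: "\<And>e e'. \<lbrakk>e \<in> fibre E b; e' \<in> fibre E b\<rbrakk> \<Longrightarrow> v (vadd E e e') = (\<lambda>i. v e i + v e' i)"
      "\<And>c e. e \<in> fibre E b \<Longrightarrow> v (vscale E c e) = (\<lambda>i. c * v e i)"
  have "v p = v q" by (rule assms(3)[OF v])
  with inj show "p = q" using assms(1,2) by (rule inj_onD)
qed

lemma fibre_vadd_commute:
  "\<lbrakk>s \<in> fibre E b; t \<in> fibre E b\<rbrakk> \<Longrightarrow> vadd E s t = vadd E t s"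
  by (rule fibre_eqI) (simp_all add: fibre_closed add.commute)

lemma fibre_vadd_interchange:
  "\<lbrakk>s \<in> fibre E b; t \<in> fibre E b; s' \<in> fibre E b; t' \<in> fibre E b\<rbrakk> \<Longrightarrow>
    vadd E (vadd E s s') (vadd E t t') = vadd E (vadd E s t) (vadd E s' t')"
  by (rule fibre_eqI) (simp_all add: fibre_closed add_ac)

lemma fibre_vscale_vadd:
  "\<lbrakk>s \<in> fibre E b; t \<in> fibre E b\<rbrakk> \<Longrightarrow> vscale E c (vadd E s t) = vadd E (vscale E c s) (vscale E c t)"
  by (rule fibre_eqI) (simp_all add: fibre_closed ring_distribs)

lemma fibre_vscale_vscale:
  "s \<in> fibre E b \<Longrightarrow> vscale E c (vscale E d s) = vscale E (c * d) s"
  by (rule fibre_eqI) (simp_all add: fibre_closed mult.assoc)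

text \<open>
  Exchanging \<open>s\<close> and \<open>t\<close> has the same effect on \<open>\<i>(s - t)\<close> as conjugating the factor \<open>\<i>\<close>.
\<close>

lemma fibre_rotate:
  "\<lbrakk>s \<in> fibre E b; t \<in> fibre E b\<rbrakk> \<Longrightarrow>
    vscale E \<i> (vadd E t (vscale E (-1) s)) = vscale E (- \<i>) (vadd E s (vscale E (-1) t))"
  by (rule fibre_eqI) (simp_all add: fibre_closed algebra_simps)

text \<open>
  The maps \<open>(s, t) \<mapsto> (s + t, \<i>(s - t))\<close> and \<open>(u, v) \<mapsto> ((u - \<i>v)/2, (u + \<i>v)/2)\<close> are inverse
  to each other.
\<close>

lemma fibre_split:
  assumes "s \<in> fibre E b" "t \<in> fibre E b"
  shows "vscale E (1/2) (vadd E (vadd E s t) (vscale E (- \<i>) (vscale E \<i> (vadd E s (vscale E (-1) t))))) = s"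
    and "vscale E (1/2) (vadd E (vadd E s t) (vscale E \<i> (vscale E \<i> (vadd E s (vscale E (-1) t))))) = t"
    and "vadd E (vscale E (1/2) (vadd E s (vscale E (- \<i>) t))) (vscale E (1/2) (vadd E s (vscale E \<i> t))) = s"
    and "vscale E \<i> (vadd E (vscale E (1/2) (vadd E s (vscale E (- \<i>) t)))
           (vscale E (-1) (vscale E (1/2) (vadd E s (vscale E \<i> t))))) = t"
  by (rule fibre_eqI; use assms in \<open>simp add: fibre_closed fun_eq_iff algebra_simps\<close>)+

end

section \<open>Conjugation and magnetic induction\<close>

text \<open>
  The \<open>G\<close>-bundle induced from the \<open>G\<^sub>0\<close>-bundle \<open>F\<close>. A vector \<open>t\<close> of \<open>F\<close> over \<open>a x\<close> plays the role of
  \<open>a\<inverse>t\<close> over \<open>x\<close>, which explains the conjugate scalar multiplication on the second summand and the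
  formulas for the action: for odd \<open>g\<close> both \<open>g a\<inverse>\<close> and \<open>a g\<close> lie in \<open>G\<^sub>0\<close>, and \<open>g\<close> sends
  \<open>s + a\<inverse>t\<close> to \<open>g a\<inverse>t + a\<inverse>(a g s)\<close>.
\<close>

definition induced_bundle ::
  "'g mgroup \<Rightarrow> ('g, 'b) gspace \<Rightarrow> 'g \<Rightarrow> ('e, 'b, 'g) vbundle \<Rightarrow> ('e \<times> ('e \<times> 'b), 'b, 'g) vbundle" where
  "induced_bundle G B a F = (bundle_sum F (conj_bundle G B a F))\<lparr>vact := (\<lambda>g (s, (t, x)).
     if phase G g = 0 then (vact F g s, (vact F (a \<otimes>\<^bsub>G\<^esub> g \<otimes>\<^bsub>G\<^esub> inv\<^bsub>G\<^esub> a) t, gs_act B g x))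
     else (vact F (g \<otimes>\<^bsub>G\<^esub> inv\<^bsub>G\<^esub> a) t, (vact F (a \<otimes>\<^bsub>G\<^esub> g) s, gs_act B g x)))\<rparr>"

lemma induced_bundle_simps [simp]:
  "tspace (induced_bundle G B a F) = tspace (bundle_sum F (conj_bundle G B a F))"
  "proj (induced_bundle G B a F) = (\<lambda>z. proj F (fst z))"
  "vadd (induced_bundle G B a F) = vadd (bundle_sum F (conj_bundle G B a F))"
  "vscale (induced_bundle G B a F) = vscale (bundle_sum F (conj_bundle G B a F))"
  "vact (induced_bundle G B a F) g z = (if phase G g = 0 then
     (vact F g (fst z), (vact F (a \<otimes>\<^bsub>G\<^esub> g \<otimes>\<^bsub>G\<^esub> inv\<^bsub>G\<^esub> a) (fst (snd z)), gs_act B g (snd (snd z))))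
     else (vact F (g \<otimes>\<^bsub>G\<^esub> inv\<^bsub>G\<^esub> a) (fst (snd z)), (vact F (a \<otimes>\<^bsub>G\<^esub> g) (fst z), gs_act B g (snd (snd z)))))"
  by (auto simp: induced_bundle_def case_prod_unfold)

lemma complex_vector_bundle_cong:
  assumes "tspace E = tspace F" "proj E = proj F" "vadd E = vadd F" "vscale E = vscale F"
  shows "complex_vector_bundle B E \<longleftrightarrow> complex_vector_bundle B F"
  unfolding complex_vector_bundle_def local_triv_def fibre_def assms ..

lemma even_part_simps [simp]:
  "mult (even_part G) = mult G" "one (even_part G) = one G" "phase (even_part G) g = 0"
  "gtop (even_part G) = subtopology (gtop G) (carrier (even_part G))"
  "carrier (even_part G) = {g \<in> carrier G. phase G g = 0}"
  by (auto simp: even_part_def kernel_def)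

locale magnetic_setting =
  fixes G :: "'g mgroup" and B :: "('g, 'b) gspace" and a :: 'g
  assumes tgrp: "topological_group G"
    and phase_hom: "phase G \<in> hom G (integer_mod_group 2)"
    and phase_continuous: "continuous_map (gtop G)
      (discrete_topology (carrier (integer_mod_group 2))) (phase G)"
    and B: "G_space G B"
    and a_odd: "a \<in> carrier G" "phase G a \<noteq> 0"
begin

abbreviation G0 where "G0 \<equiv> even_part G"

sublocale group G using tgrp by (simp add: topological_group_def)

lemma gtop: "topspace (gtop G) = carrier G" and gtop0: "topspace (gtop G0) = carrier G0"
  using tgrp by (auto simp: topological_group_def)

lemma phase_mult:
  assumes "g \<in> carrier G" "h \<in> carrier G"
  shows "phase G (g \<otimes>\<^bsub>G\<^esub> h) = 0 \<longleftrightarrow> (phase G g = 0 \<longleftrightarrow> phase G h = 0)"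
proof -
  have "phase G g \<in> {0..<2}" "phase G h \<in> {0..<2}"
    using assms phase_hom hom_in_carrier by (fastforce simp: carrier_integer_mod_group)+
  moreover have "phase G (g \<otimes>\<^bsub>G\<^esub> h) = (phase G g + phase G h) mod 2"
    using phase_hom assms by (simp add: hom_mult)
  ultimately show ?thesis by (auto simp: atLeastLessThan_def) presburger+
qed

lemma phase_inv_a: "phase G (inv\<^bsub>G\<^esub> a) \<noteq> 0"
proof -
  have "phase G \<one>\<^bsub>G\<^esub> = 0"
    using phase_mult[of "\<one>\<^bsub>G\<^esub>" "\<one>\<^bsub>G\<^esub>"] by simp
  then show ?thesis using phase_mult[of a "inv\<^bsub>G\<^esub> a"] a_odd by simp
qed

lemma phase_one: "phase G \<one>\<^bsub>G\<^esub> = 0"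
  using phase_mult[of "\<one>\<^bsub>G\<^esub>" "\<one>\<^bsub>G\<^esub>"] by simp

lemma a_cancel [simp]:
  assumes "x \<in> carrier G"
  shows "inv\<^bsub>G\<^esub> a \<otimes>\<^bsub>G\<^esub> (a \<otimes>\<^bsub>G\<^esub> x) = x" "a \<otimes>\<^bsub>G\<^esub> (inv\<^bsub>G\<^esub> a \<otimes>\<^bsub>G\<^esub> x) = x"
  using assms a_odd by (simp_all flip: m_assoc)

lemmas even_simps = phase_mult phase_one phase_inv_a a_odd m_assoc

lemma continuous_map_gmult:
  "\<lbrakk>continuous_map Z (gtop G) f; continuous_map Z (gtop G) h\<rbrakk> \<Longrightarrow>
    continuous_map Z (gtop G) (\<lambda>z. f z \<otimes>\<^bsub>G\<^esub> h z)"
  by (rule continuous_map_comp2) (use tgrp in \<open>auto simp: topological_group_def\<close>)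

lemma continuous_map_gconst: "g \<in> carrier G \<Longrightarrow> continuous_map Z (gtop G) (\<lambda>z. g)"
  by (simp add: gtop)

lemma G_space_even: "G_space G0 B"
  unfolding G_space_def
proof (intro conjI ballI)
  have "continuous_map (prod_topology (gtop G0) (gs_top B)) (gs_top B)
      (\<lambda>z. gs_act B (fst z) (snd z))"
    by (intro G_spaceD(1)[OF B] continuous_map_snd)
      (use continuous_map_fst[of "gtop G0" "gs_top B"] in \<open>simp add: continuous_map_in_subtopology\<close>)
  then show "continuous_map (prod_topology (gtop G0) (gs_top B)) (gs_top B) (\<lambda>(g, x). gs_act B g x)"
    by (simp add: case_prod_unfold)
qed (auto simp: G_spaceD[OF B])

lemma gs_act_in: "\<lbrakk>g \<in> carrier G; x \<in> topspace (gs_top B)\<rbrakk> \<Longrightarrow> gs_act B g x \<in> topspace (gs_top B)"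
  by (rule G_spaceD(4)[OF B gtop])

lemma continuous_gs_act: "g \<in> carrier G \<Longrightarrow> continuous_map (gs_top B) (gs_top B) (gs_act B g)"
  using G_spaceD(1)[OF B continuous_map_gconst continuous_map_id'] by fastforce

lemma equivariant_bundle_even:
  assumes E: "equivariant_bundle G B E"
  shows "equivariant_bundle G0 B E"
proof (rule equivariant_bundleI)
  show "complex_vector_bundle (gs_top B) E" by (rule equivariant_bundle_imp_vector[OF E])
  have "continuous_map (prod_topology (gtop G0) (tspace E)) (tspace E) (\<lambda>z. vact E (fst z) (snd z))"
    by (intro continuous_map_vact[OF E] continuous_map_snd)
      (use continuous_map_fst[of "gtop G0" "tspace E"] in \<open>simp add: continuous_map_in_subtopology\<close>)
  then show "continuous_map (prod_topology (gtop G0) (tspace E)) (tspace E) (\<lambda>(g, e). vact E g e)"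
    by (simp add: case_prod_unfold)
qed (auto simp: vact_one[OF E] vact_mult[OF E] proj_vact[OF E] vact_vadd[OF E] vact_vscale[OF E])

lemma bundle_hom_even: "bundle_hom G B E F f \<Longrightarrow> bundle_hom G0 B E F f"
  by (simp add: bundle_hom_def)

lemma bundle_iso_even: "bundle_iso G B E F \<Longrightarrow> bundle_iso G0 B E F"
  unfolding bundle_iso_def by (elim exE conjE) (intro exI conjI bundle_hom_even; assumption)

lemma continuous_map_into_even:
  "\<lbrakk>continuous_map Z (gtop G) f; \<And>z. z \<in> topspace Z \<Longrightarrow> f z \<in> carrier G0\<rbrakk> \<Longrightarrow>
    continuous_map Z (gtop G0) f"
  unfolding even_part_simps(4) continuous_map_in_subtopology by blast

lemma equivariant_bundle_conj:
  assumes F: "equivariant_bundle G0 B F"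
  shows "equivariant_bundle G0 B (conj_bundle G B a F)"
proof (rule equivariant_bundleI)
  let ?C = "conj_bundle G B a F" and ?c = "\<lambda>g. a \<otimes>\<^bsub>G\<^esub> g \<otimes>\<^bsub>G\<^esub> inv\<^bsub>G\<^esub> a"
  show "complex_vector_bundle (gs_top B) ?C"
    by (rule complex_vector_bundle_conj[OF equivariant_bundle_imp_vector[OF F] continuous_gs_act[OF a_odd(1)]])
  have c: "?c g \<in> carrier G0" if "g \<in> carrier G0" for g
    using that a_odd by (simp add: even_simps)
  let ?Z = "prod_topology (gtop G0) (tspace ?C)"
  have g: "continuous_map ?Z (gtop G) (\<lambda>z. fst z)"
    using continuous_map_fst[of "gtop G0" "tspace ?C"] by (simp add: continuous_map_in_subtopology)
  then have "continuous_map ?Z (gtop G) (\<lambda>z. ?c (fst z))"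
    using a_odd by (intro continuous_map_gmult continuous_map_gconst) auto
  then have "continuous_map ?Z (gtop G0) (\<lambda>z. ?c (fst z))"
    by (rule continuous_map_into_even) (rule c, auto simp: gtop)
  from continuous_map_vact[OF F this continuous_map_conj_fst[OF continuous_map_snd]]
  have 1: "continuous_map ?Z (tspace F) (\<lambda>z. vact F (?c (fst z)) (fst (snd z)))" .
  have 2: "continuous_map ?Z (gs_top B) (\<lambda>z. gs_act B (fst z) (snd (snd z)))"
    by (rule G_spaceD(1)[OF B g continuous_map_conj_snd[OF continuous_map_snd]])
  have p: "proj F (vact F (?c g) s) = gs_act B a (gs_act B g x)"
    if "g \<in> carrier G0" "s \<in> topspace (tspace F)" "x \<in> topspace (gs_top B)" "proj F s = gs_act B a x"
    for g s x
    using proj_vact[OF F c[OF that(1)] that(2)] that a_odd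
    by (simp add: m_assoc flip: G_spaceD(3)[OF B])
  have "continuous_map ?Z (tspace ?C)
      (\<lambda>z. (vact F (?c (fst z)) (fst (snd z)), gs_act B (fst z) (snd (snd z))))"
    by (rule continuous_map_into_conj[OF 1 2]) (use p gtop in auto)
  then show "continuous_map ?Z (tspace ?C) (\<lambda>(g, e). vact ?C g e)"
    by (simp add: case_prod_unfold)
  fix g h e assume g: "g \<in> carrier G0" and h: "h \<in> carrier G0" and e: "e \<in> topspace (tspace ?C)"
  have "?c (g \<otimes>\<^bsub>G\<^esub> h) = ?c g \<otimes>\<^bsub>G\<^esub> ?c h" using g h a_odd by (simp add: m_assoc)
  then show "vact ?C (g \<otimes>\<^bsub>G0\<^esub> h) e = vact ?C g (vact ?C h e)"
    using g h e vact_mult[OF F c[OF g] c[OF h]] by (auto simp: G_spaceD[OF B])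
next
  fix g e e' assume g: "g \<in> carrier G0" and e: "e \<in> topspace (tspace (conj_bundle G B a F))"
    "e' \<in> topspace (tspace (conj_bundle G B a F))"
    "proj (conj_bundle G B a F) e' = proj (conj_bundle G B a F) e"
  have "a \<otimes>\<^bsub>G\<^esub> g \<otimes>\<^bsub>G\<^esub> inv\<^bsub>G\<^esub> a \<in> carrier G0" using g a_odd by (simp add: even_simps)
  from vact_vadd[OF F this] show "vact (conj_bundle G B a F) g (vadd (conj_bundle G B a F) e e') =
     vadd (conj_bundle G B a F) (vact (conj_bundle G B a F) g e) (vact (conj_bundle G B a F) g e')"
    using e by auto
next
  fix g e c assume g: "g \<in> carrier G0" and e: "e \<in> topspace (tspace (conj_bundle G B a F))"
  have "a \<otimes>\<^bsub>G\<^esub> g \<otimes>\<^bsub>G\<^esub> inv\<^bsub>G\<^esub> a \<in> carrier G0" using g a_odd by (simp add: even_simps)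
  from vact_vscale[OF F this] show "vact (conj_bundle G B a F) g (vscale (conj_bundle G B a F) c e) =
     vscale (conj_bundle G B a F) (if phase G0 g = 0 then c else cnj c) (vact (conj_bundle G B a F) g e)"
    using e by auto
next
  fix e assume "e \<in> topspace (tspace (conj_bundle G B a F))"
  then show "vact (conj_bundle G B a F) \<one>\<^bsub>G0\<^esub> e = e"
    using a_odd vact_one[OF F] by (auto simp: G_spaceD[OF B])
qed auto

lemma bundle_hom_conj:
  assumes F: "complex_vector_bundle (gs_top B) F" and f: "bundle_hom G0 B F F' f"
  shows "bundle_hom G0 B (conj_bundle G B a F) (conj_bundle G B a F') (\<lambda>z. (f (fst z), snd z))"
proof (rule bundle_homI)
  show "continuous_map (tspace (conj_bundle G B a F)) (tspace (conj_bundle G B a F')) (\<lambda>z. (f (fst z), snd z))"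
    by (intro continuous_map_into_conj continuous_map_comp[OF bundle_homD(1)[OF f]]
        continuous_map_conj_fst[OF continuous_map_id'] continuous_map_conj_snd[OF continuous_map_id'])
      (auto simp: bundle_homD(3)[OF f])
qed (use a_odd in \<open>auto simp: bundle_homD(5,6)[OF f] bundle_homD(4)[OF f F] even_simps\<close>)

lemma bundle_iso_conj:
  assumes "complex_vector_bundle (gs_top B) F" "complex_vector_bundle (gs_top B) F'"
    and "bundle_iso G0 B F F'"
  shows "bundle_iso G0 B (conj_bundle G B a F) (conj_bundle G B a F')"
proof -
  obtain f f' where f: "bundle_hom G0 B F F' f" "bundle_hom G0 B F' F f'"
    "\<And>e. e \<in> topspace (tspace F) \<Longrightarrow> f' (f e) = e" "\<And>e. e \<in> topspace (tspace F') \<Longrightarrow> f (f' e) = e"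
    using assms(3) unfolding bundle_iso_def by blast
  show ?thesis
    unfolding bundle_iso_def
    using bundle_hom_conj[OF assms(1) f(1)] bundle_hom_conj[OF assms(2) f(2)] f(3,4)
    by (intro exI[of _ "\<lambda>z. (f (fst z), snd z)"] exI[of _ "\<lambda>z. (f' (fst z), snd z)"]) auto
qed

lemma bundle_iso_conj_sum:
  fixes E :: "('e, 'b, 'g) vbundle" and F :: "('f, 'b, 'g) vbundle"
  assumes E: "equivariant_bundle G0 B E" and F: "equivariant_bundle G0 B F"
  shows "bundle_iso G0 B (conj_bundle G B a (bundle_sum E F))
     (bundle_sum (conj_bundle G B a E) (conj_bundle G B a F))"
proof -
  let ?L = "conj_bundle G B a (bundle_sum E F)"
    and ?R = "bundle_sum (conj_bundle G B a E) (conj_bundle G B a F)"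
  note id = continuous_map_id'
  have f: "bundle_hom G0 B ?L ?R (\<lambda>z. ((fst (fst z), snd z), (snd (fst z), snd z)))"
  proof (rule bundle_homI)
    show "continuous_map (tspace ?L) (tspace ?R) (\<lambda>z. ((fst (fst z), snd z), (snd (fst z), snd z)))"
      by (intro continuous_map_into_sum continuous_map_into_conj
          continuous_map_sum_fst[OF continuous_map_conj_fst[OF id]]
          continuous_map_sum_snd[OF continuous_map_conj_fst[OF id]]
          continuous_map_conj_snd[OF id]) auto
  qed auto
  have g: "continuous_map (tspace ?R) (tspace ?L) (\<lambda>z. ((fst (fst z), fst (snd z)), snd (fst z)))"
    by (intro continuous_map_into_sum continuous_map_into_conj
        continuous_map_conj_fst[OF continuous_map_sum_fst[OF id]]
        continuous_map_conj_snd[OF continuous_map_sum_fst[OF id]]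
        continuous_map_conj_fst[OF continuous_map_sum_snd[OF id]]) auto
  show ?thesis
    by (rule bundle_iso_bij_hom[OF gtop0 _ _ f g])
      (auto intro!: equivariant_bundle_conj equivariant_bundle_sum[OF gtop0] E F)
qed

text \<open>
  The isomorphism is the action of \<open>a\<inverse>\<close>: being antilinear on \<open>E\<close>, it is linear on the conjugate.
\<close>

lemma bundle_iso_conj_magnetic:
  assumes E: "equivariant_bundle G B E"
  shows "bundle_iso G0 B (conj_bundle G B a E) E"
proof (rule bundle_iso_bij_hom[OF gtop0])
  note E0 = equivariant_bundle_even[OF E] and cE = equivariant_bundle_imp_vector[OF E]
  let ?C = "conj_bundle G B a E"
  show "equivariant_bundle G0 B ?C" by (rule equivariant_bundle_conj[OF E0])
  show "equivariant_bundle G0 B E" by (rule E0)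
  have ia: "inv\<^bsub>G\<^esub> a \<in> carrier G" using a_odd by simp
  show "bundle_hom G0 B ?C E (\<lambda>z. vact E (inv\<^bsub>G\<^esub> a) (fst z))"
  proof (rule bundle_homI)
    show "continuous_map (tspace ?C) (tspace E) (\<lambda>z. vact E (inv\<^bsub>G\<^esub> a) (fst z))"
      by (intro continuous_map_vact[OF E] continuous_map_gconst ia continuous_map_conj_fst[OF continuous_map_id'])
    fix e assume "e \<in> topspace (tspace ?C)"
    then show "proj E (vact E (inv\<^bsub>G\<^esub> a) (fst e)) = proj ?C e"
      using ia a_odd by (auto simp: proj_vact[OF E] G_spaceD(2)[OF B] simp flip: G_spaceD(3)[OF B])
  next
    fix g e assume g: "g \<in> carrier G0" and e: "e \<in> topspace (tspace ?C)"
    then show "vact E (inv\<^bsub>G\<^esub> a) (fst (vact ?C g e)) = vact E g (vact E (inv\<^bsub>G\<^esub> a) (fst e))"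
      using ia a_odd by (auto simp: m_assoc simp flip: vact_mult[OF E])
  qed (use ia in \<open>auto simp: vact_vadd[OF E] vact_vscale[OF E] phase_inv_a\<close>)
  show "continuous_map (tspace E) (tspace ?C) (\<lambda>e. (vact E a e, proj E e))"
    by (intro continuous_map_into_conj continuous_map_vact[OF E] continuous_map_gconst a_odd
        continuous_map_id' continuous_map_bundle_proj[OF cE]) (auto simp: proj_vact[OF E] a_odd)
  show "(vact E a (vact E (inv\<^bsub>G\<^esub> a) (fst e)), proj E (vact E (inv\<^bsub>G\<^esub> a) (fst e))) = e"
    if "e \<in> topspace (tspace ?C)" for e
    using that ia a_odd
    by (auto simp: proj_vact[OF E] G_spaceD(2)[OF B] vact_one[OF E] simp flip: G_spaceD(3)[OF B] vact_mult[OF E])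
  show "vact E (inv\<^bsub>G\<^esub> a) (fst (vact E a y, proj E y)) = y" if "y \<in> topspace (tspace E)" for y
    using that ia a_odd by (auto simp: vact_one[OF E] simp flip: vact_mult[OF E])
qed

end

context magnetic_setting begin

text \<open>
  The phase splits \<open>G\<close> into two open pieces, on each of which the action is given by a single
  continuous formula in terms of the action of \<open>G\<^sub>0\<close> on \<open>F\<close>.
\<close>

lemma equivariant_bundle_induced:
  assumes F: "equivariant_bundle G0 B F"
  shows "equivariant_bundle G B (induced_bundle G B a F)" (is "equivariant_bundle G B ?I")
proof (rule equivariant_bundleI)
  let ?c = "\<lambda>g. a \<otimes>\<^bsub>G\<^esub> g \<otimes>\<^bsub>G\<^esub> inv\<^bsub>G\<^esub> a" and ?S = "bundle_sum F (conj_bundle G B a F)"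
  have ia: "inv\<^bsub>G\<^esub> a \<in> carrier G" using a_odd by simp
  note S = complex_vector_bundle_sum[OF equivariant_bundle_imp_vector[OF F]
      equivariant_bundle_imp_vector[OF equivariant_bundle_conj[OF F]]]
  show "complex_vector_bundle (gs_top B) ?I"
    by (rule iffD2[OF complex_vector_bundle_cong S]) (simp_all add: fun_eq_iff)
  let ?Z = "prod_topology (gtop G) (tspace ?S)"
  define T where "T b = {z \<in> topspace ?Z. (phase G (fst z) = 0) = b}" for b
  have T: "openin ?Z (T b)" for b
  proof -
    have "T b = {z \<in> topspace ?Z. phase G (fst z) \<in> {p \<in> carrier (integer_mod_group 2). (p = 0) = b}}"
      using continuous_map_in_topspace[OF phase_continuous] by (auto simp: T_def)
    then show ?thesis
      using openin_continuous_map_preimage[OF continuous_map_comp[OF phase_continuous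
            continuous_map_fst[of "gtop G" "tspace ?S"]],
          of "{p \<in> carrier (integer_mod_group 2). (p = 0) = b}"] by auto
  qed
  have g: "continuous_map (subtopology ?Z (T b)) (gtop G) (\<lambda>z. fst z)"
    and z: "continuous_map (subtopology ?Z (T b)) (tspace ?S) (\<lambda>z. snd z)" for b
    by (intro continuous_map_from_subtopology continuous_map_fst continuous_map_snd)+
  note s = continuous_map_sum_fst[OF z]
    and t = continuous_map_conj_fst[OF continuous_map_sum_snd[OF z]]
    and x = continuous_map_conj_snd[OF continuous_map_sum_snd[OF z]]
  have gx: "continuous_map (subtopology ?Z (T b)) (gs_top B) (\<lambda>z. gs_act B (fst z) (snd (snd (snd z))))" for b
    by (rule G_spaceD(1)[OF B g x])
  have even: "continuous_map (subtopology ?Z (T True)) (tspace ?S)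
      (\<lambda>z. (vact F (fst z) (fst (snd z)), (vact F (?c (fst z)) (fst (snd (snd z))),
        gs_act B (fst z) (snd (snd (snd z))))))"
  proof (intro continuous_map_into_sum continuous_map_into_conj gx continuous_map_vact[OF F] s t
      continuous_map_into_even g continuous_map_gmult continuous_map_gconst a_odd ia)
    fix z assume "z \<in> topspace (subtopology ?Z (T True))"
    then have z: "fst z \<in> carrier G" "phase G (fst z) = 0" "snd z \<in> topspace (tspace ?S)"
      by (auto simp: T_def gtop)
    then show "fst z \<in> carrier G0" "?c (fst z) \<in> carrier G0"
      using a_odd by (simp_all add: even_simps)
    then show "proj F (vact F (?c (fst z)) (fst (snd (snd z)))) =
        gs_act B a (gs_act B (fst z) (snd (snd (snd z))))"
      "proj F (vact F (fst z) (fst (snd z))) =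
        proj (conj_bundle G B a F) (vact F (?c (fst z)) (fst (snd (snd z))), gs_act B (fst z) (snd (snd (snd z))))"
      using z a_odd by (auto simp: proj_vact[OF F] m_assoc simp flip: G_spaceD(3)[OF B])
  qed
  have odd: "continuous_map (subtopology ?Z (T False)) (tspace ?S)
      (\<lambda>z. (vact F (fst z \<otimes>\<^bsub>G\<^esub> inv\<^bsub>G\<^esub> a) (fst (snd (snd z))), (vact F (a \<otimes>\<^bsub>G\<^esub> fst z) (fst (snd z)),
        gs_act B (fst z) (snd (snd (snd z))))))"
  proof (intro continuous_map_into_sum continuous_map_into_conj gx continuous_map_vact[OF F] s t
      continuous_map_into_even g continuous_map_gmult continuous_map_gconst a_odd ia)
    fix z assume "z \<in> topspace (subtopology ?Z (T False))"
    then have z: "fst z \<in> carrier G" "phase G (fst z) \<noteq> 0" "snd z \<in> topspace (tspace ?S)"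
      by (auto simp: T_def gtop)
    then show "fst z \<otimes>\<^bsub>G\<^esub> inv\<^bsub>G\<^esub> a \<in> carrier G0" "a \<otimes>\<^bsub>G\<^esub> fst z \<in> carrier G0"
      using a_odd by (simp_all add: even_simps)
    then show "proj F (vact F (a \<otimes>\<^bsub>G\<^esub> fst z) (fst (snd z))) =
        gs_act B a (gs_act B (fst z) (snd (snd (snd z))))"
      "proj F (vact F (fst z \<otimes>\<^bsub>G\<^esub> inv\<^bsub>G\<^esub> a) (fst (snd (snd z)))) =
        proj (conj_bundle G B a F) (vact F (a \<otimes>\<^bsub>G\<^esub> fst z) (fst (snd z)), gs_act B (fst z) (snd (snd (snd z))))"
      using z a_odd by (auto simp: proj_vact[OF F] m_assoc simp flip: G_spaceD(3)[OF B])
  qed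
  have "continuous_map ?Z (tspace ?S) (\<lambda>z. vact ?I (fst z) (snd z))"
  proof (rule pasting_lemma[where I = UNIV and T = T and f = "\<lambda>_ z. vact ?I (fst z) (snd z)"])
    show "continuous_map (subtopology ?Z (T b)) (tspace ?S) (\<lambda>z. vact ?I (fst z) (snd z))" for b
    proof (cases b)
      case True
      then have b: "b = True" by simp
      show ?thesis unfolding b
        by (rule continuous_map_eq[OF even]) (simp add: T_def)
    next
      case False
      then have b: "b = False" by simp
      show ?thesis unfolding b
        by (rule continuous_map_eq[OF odd]) (simp add: T_def)
    qed
  next
    show "openin ?Z (T b)" for b by (rule T)
  qed (auto simp: T_def)
  then show "continuous_map (prod_topology (gtop G) (tspace ?I)) (tspace ?I) (\<lambda>(g, e). vact ?I g e)"
    by (simp add: case_prod_unfold del: induced_bundle_simps(5))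
  show "vact ?I \<one>\<^bsub>G\<^esub> e = e" if "e \<in> topspace (tspace ?I)" for e
    using that a_odd by (auto simp: phase_one vact_one[OF F, simplified] G_spaceD[OF B])
  show "proj ?I (vact ?I g e) = gs_act B g (proj ?I e)"
    if "g \<in> carrier G" "e \<in> topspace (tspace ?I)" for g e
    using that a_odd by (auto simp: even_simps proj_vact[OF F] simp flip: G_spaceD(3)[OF B])
  show "vact ?I (g \<otimes>\<^bsub>G\<^esub> h) e = vact ?I g (vact ?I h e)"
    if "g \<in> carrier G" "h \<in> carrier G" "e \<in> topspace (tspace ?I)" for g h e
    using that a_odd
    by (auto simp: even_simps G_spaceD(3)[OF B] simp flip: vact_mult[OF F, simplified])
  show "vact ?I g (vadd ?I e e') = vadd ?I (vact ?I g e) (vact ?I g e')"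
    if "g \<in> carrier G" "e \<in> topspace (tspace ?I)" "e' \<in> topspace (tspace ?I)" "proj ?I e' = proj ?I e"
    for g e e'
    using that a_odd by (auto simp: even_simps vact_vadd[OF F])
  show "vact ?I g (vscale ?I c e) = vscale ?I (if phase G g = 0 then c else cnj c) (vact ?I g e)"
    if "g \<in> carrier G" "e \<in> topspace (tspace ?I)" for g e c
    using that a_odd by (auto simp: even_simps vact_vscale[OF F])
qed

lemma bundle_iso_induced_even:
  "bundle_iso G0 B (induced_bundle G B a F) (bundle_sum F (conj_bundle G B a F))"
proof -
  let ?I = "induced_bundle G B a F" and ?S = "bundle_sum F (conj_bundle G B a F)"
  have "bundle_hom G0 B ?I ?S (\<lambda>z. z)" "bundle_hom G0 B ?S ?I (\<lambda>z. z)"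
    by (simp_all add: bundle_hom_def continuous_map_id' fun_eq_iff)
  then show ?thesis unfolding bundle_iso_def by blast
qed

lemma bundle_hom_induced:
  assumes F: "complex_vector_bundle (gs_top B) F" and f: "bundle_hom G0 B F F' f"
  shows "bundle_hom G B (induced_bundle G B a F) (induced_bundle G B a F')
    (\<lambda>z. (f (fst z), (f (fst (snd z)), snd (snd z))))"
proof (rule bundle_homI)
  show "continuous_map (tspace (induced_bundle G B a F)) (tspace (induced_bundle G B a F'))
     (\<lambda>z. (f (fst z), (f (fst (snd z)), snd (snd z))))"
    unfolding induced_bundle_simps(1)
    by (intro continuous_map_into_sum continuous_map_into_conj continuous_map_comp[OF bundle_homD(1)[OF f]]
        continuous_map_sum_fst[OF continuous_map_id']
        continuous_map_conj_fst[OF continuous_map_sum_snd[OF continuous_map_id']]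
        continuous_map_conj_snd[OF continuous_map_sum_snd[OF continuous_map_id']])
      (auto simp: bundle_homD(3)[OF f])
qed (use a_odd in \<open>auto simp: bundle_homD(3,5,6)[OF f] bundle_homD(4)[OF f F] even_simps\<close>)

lemma bundle_iso_induced:
  assumes "complex_vector_bundle (gs_top B) F" "complex_vector_bundle (gs_top B) F'"
    and "bundle_iso G0 B F F'"
  shows "bundle_iso G B (induced_bundle G B a F) (induced_bundle G B a F')"
proof -
  obtain f f' where f: "bundle_hom G0 B F F' f" "bundle_hom G0 B F' F f'"
    "\<And>e. e \<in> topspace (tspace F) \<Longrightarrow> f' (f e) = e" "\<And>e. e \<in> topspace (tspace F') \<Longrightarrow> f (f' e) = e"
    using assms(3) unfolding bundle_iso_def by blast
  show ?thesis
    unfolding bundle_iso_def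
    using bundle_hom_induced[OF assms(1) f(1)] bundle_hom_induced[OF assms(2) f(2)] f(3,4)
    by (intro exI[of _ "\<lambda>z. (f (fst z), (f (fst (snd z)), snd (snd z)))"]
        exI[of _ "\<lambda>z. (f' (fst z), (f' (fst (snd z)), snd (snd z)))"]) auto
qed

lemma bundle_iso_induced_sum:
  fixes E :: "('e, 'b, 'g) vbundle" and F :: "('f, 'b, 'g) vbundle"
  assumes E: "equivariant_bundle G0 B E" and F: "equivariant_bundle G0 B F"
  shows "bundle_iso G B (induced_bundle G B a (bundle_sum E F))
     (bundle_sum (induced_bundle G B a E) (induced_bundle G B a F))"
proof -
  let ?L = "induced_bundle G B a (bundle_sum E F)"
    and ?R = "bundle_sum (induced_bundle G B a E) (induced_bundle G B a F)"
  let ?f = "\<lambda>z. ((fst (fst z), (fst (fst (snd z)), snd (snd z))), (snd (fst z), (snd (fst (snd z)), snd (snd z))))"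
  let ?g = "\<lambda>z. ((fst (fst z), fst (snd z)), ((fst (snd (fst z)), fst (snd (snd z))), snd (snd (fst z))))"
  have idI: "continuous_map (tspace (induced_bundle G B a E)) (tspace (bundle_sum E (conj_bundle G B a E))) (\<lambda>z. z)"
    "continuous_map (tspace (induced_bundle G B a F)) (tspace (bundle_sum F (conj_bundle G B a F))) (\<lambda>z. z)"
    by (simp_all add: continuous_map_id')
  have idL: "continuous_map (tspace ?L) (tspace (bundle_sum (bundle_sum E F)
      (conj_bundle G B a (bundle_sum E F)))) (\<lambda>z. z)"
    by (simp add: continuous_map_id')
  note s = continuous_map_sum_fst[OF idL]
    and t = continuous_map_conj_fst[OF continuous_map_sum_snd[OF idL]]
    and x = continuous_map_conj_snd[OF continuous_map_sum_snd[OF idL]]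
  have f: "bundle_hom G B ?L ?R ?f"
  proof (rule bundle_homI)
    have "continuous_map (tspace ?L) (tspace (induced_bundle G B a E))
        (\<lambda>z. (fst (fst z), (fst (fst (snd z)), snd (snd z))))"
      unfolding induced_bundle_simps(1)[of G B a E]
      by (intro continuous_map_into_sum continuous_map_into_conj
          continuous_map_sum_fst[OF s] continuous_map_sum_fst[OF t] x) auto
    moreover have "continuous_map (tspace ?L) (tspace (induced_bundle G B a F))
        (\<lambda>z. (snd (fst z), (snd (fst (snd z)), snd (snd z))))"
      unfolding induced_bundle_simps(1)[of G B a F]
      by (intro continuous_map_into_sum continuous_map_into_conj
          continuous_map_sum_snd[OF s] continuous_map_sum_snd[OF t] x) auto
    ultimately show "continuous_map (tspace ?L) (tspace ?R) ?f"
      by (intro continuous_map_into_sum) auto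
  qed auto
  note eR = continuous_map_comp[OF idI(1) continuous_map_sum_fst[OF continuous_map_id'[of "tspace ?R"]]]
    and fR = continuous_map_comp[OF idI(2) continuous_map_sum_snd[OF continuous_map_id'[of "tspace ?R"]]]
  have g: "continuous_map (tspace ?R) (tspace ?L) ?g"
    unfolding induced_bundle_simps(1)[of G B a "bundle_sum E F"]
    by (intro continuous_map_into_sum continuous_map_into_conj
        continuous_map_sum_fst[OF eR] continuous_map_sum_fst[OF fR]
        continuous_map_conj_fst[OF continuous_map_sum_snd[OF eR]]
        continuous_map_conj_fst[OF continuous_map_sum_snd[OF fR]]
        continuous_map_conj_snd[OF continuous_map_sum_snd[OF eR]]) auto
  show ?thesis
  proof (rule bundle_iso_bij_hom[OF gtop _ _ f g])
    show "equivariant_bundle G B ?L"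
      by (intro equivariant_bundle_induced equivariant_bundle_sum[OF gtop0] E F)
    show "equivariant_bundle G B ?R"
      by (intro equivariant_bundle_induced equivariant_bundle_sum[OF gtop] E F)
  qed auto
qed

text \<open>
  The isomorphism sends \<open>(s, t)\<close> to \<open>(s + a\<inverse>t, \<i>(s - a\<inverse>t))\<close>. Odd elements exchange the
  contributions of \<open>s\<close> and \<open>a\<inverse>t\<close>, which changes the sign of the difference; the factor \<open>\<i>\<close>, which they
  turn into \<open>-\<i>\<close>, cancels this sign.
\<close>

lemma bundle_iso_induced_magnetic:
  assumes E: "equivariant_bundle G B E"
  shows "bundle_iso G B (induced_bundle G B a E) (bundle_sum E E)"
proof (rule bundle_iso_bij_hom[OF gtop])
  note E0 = equivariant_bundle_even[OF E] and cE = equivariant_bundle_imp_vector[OF E]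
  let ?I = "induced_bundle G B a E" and ?a = "vact E a" and ?b = "vact E (inv\<^bsub>G\<^esub> a)"
  show eI: "equivariant_bundle G B ?I" by (rule equivariant_bundle_induced[OF E0])
  show "equivariant_bundle G B (bundle_sum E E)" by (rule equivariant_bundle_sum[OF gtop E E])
  have ia: "inv\<^bsub>G\<^esub> a \<in> carrier G" using a_odd by simp
  have fib: "fst e \<in> fibre E (proj E (fst e))" "?b (fst (snd e)) \<in> fibre E (proj E (fst e))"
    if "e \<in> topspace (tspace ?I)" for e
  proof -
    have t: "fst (snd e) \<in> topspace (tspace E)" "proj E (fst (snd e)) = gs_act B a (proj E (fst e))"
      and s: "fst e \<in> topspace (tspace E)" "proj E (fst e) \<in> topspace (gs_top B)"
      using that by auto
    have "proj E (?b (fst (snd e))) = gs_act B (inv\<^bsub>G\<^esub> a) (gs_act B a (proj E (fst e)))"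
      using proj_vact[OF E ia t(1)] t(2) by simp
    also have "\<dots> = proj E (fst e)"
      using G_spaceD(3)[OF B ia a_odd(1) s(2)] G_spaceD(2)[OF B s(2)] a_odd by simp
    finally show "?b (fst (snd e)) \<in> fibre E (proj E (fst e))"
      using vact_in[OF E gtop ia t(1)] by (simp add: fibre_def)
    show "fst e \<in> fibre E (proj E (fst e))" using s by (simp add: fibre_def)
  qed
  have base: "proj E (fst e) \<in> topspace (gs_top B)" if "e \<in> topspace (tspace ?I)" for e
    using that bundle_proj_in[OF cE] by auto
  let ?f = "\<lambda>z. (vadd E (fst z) (?b (fst (snd z))),
      vscale E \<i> (vadd E (fst z) (vscale E (-1) (?b (fst (snd z))))))"
  have fibD: "e \<in> topspace (tspace E)" "proj E e = b" if "e \<in> fibre E b" for e b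
    using that by (auto simp: fibre_def)
  have same: "proj E e = proj E e'" if "e \<in> fibre E b" "e' \<in> fibre E b" for e e' b
    using that by (auto simp: fibre_def)
  show "bundle_hom G B ?I (bundle_sum E E) ?f"
  proof (rule bundle_homI)
    have id: "continuous_map (tspace ?I) (tspace (bundle_sum E (conj_bundle G B a E))) (\<lambda>z. z)"
      by (simp add: continuous_map_id')
    have s: "continuous_map (tspace ?I) (tspace E) (\<lambda>z. fst z)"
      and t: "continuous_map (tspace ?I) (tspace E) (\<lambda>z. ?b (fst (snd z)))"
      by (intro continuous_map_sum_fst[OF id] continuous_map_vact[OF E] continuous_map_gconst ia
          continuous_map_conj_fst[OF continuous_map_sum_snd[OF id]])+
    show "continuous_map (tspace ?I) (tspace (bundle_sum E E)) ?f"
    proof (intro continuous_map_into_sum continuous_map_vadd[OF cE] continuous_map_vscale[OF cE] s t)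
      fix z assume z: "z \<in> topspace (tspace ?I)"
      note [simp] = fibre_closed[OF cE base[OF z]] fib[OF z]
      show "proj E (?b (fst (snd z))) = proj E (fst z)"
        "proj E (vscale E (-1) (?b (fst (snd z)))) = proj E (fst z)"
        "proj E (vadd E (fst z) (?b (fst (snd z)))) =
          proj E (vscale E \<i> (vadd E (fst z) (vscale E (-1) (?b (fst (snd z))))))"
        by (rule same[of _ "proj E (fst z)"]; simp)+
    qed
  next
    fix z assume z: "z \<in> topspace (tspace ?I)"
    note [simp] = fibre_closed[OF cE base[OF z]] fib[OF z]
    have "proj E (vadd E (fst z) (?b (fst (snd z)))) = proj E (fst z)"
      by (rule same[of _ "proj E (fst z)"]; simp)
    then show "proj (bundle_sum E E) (?f z) = proj ?I z" by simp
    fix c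
    have "?b (vscale E (cnj c) (fst (snd z))) = vscale E c (?b (fst (snd z)))"
      using z ia phase_inv_a by (auto simp: vact_vscale[OF E])
    then show "?f (vscale ?I c z) = vscale (bundle_sum E E) c (?f z)"
      by (simp add: fibre_vscale_vadd[OF cE base[OF z]] fibre_vscale_vscale[OF cE base[OF z]] mult.commute)
  next
    fix z z' assume z: "z \<in> topspace (tspace ?I)" and z': "z' \<in> topspace (tspace ?I)"
      and p: "proj ?I z' = proj ?I z"
    note [simp] = fibre_closed[OF cE base[OF z]] fib[OF z] fib[OF z', unfolded p[simplified]]
    have "?b (vadd E (fst (snd z)) (fst (snd z'))) = vadd E (?b (fst (snd z))) (?b (fst (snd z')))"
      using z z' p ia by (auto simp: vact_vadd[OF E])
    then show "?f (vadd ?I z z') = vadd (bundle_sum E E) (?f z) (?f z')"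
      by (simp add: fibre_vscale_vadd[OF cE base[OF z]] fibre_vadd_interchange[OF cE base[OF z]])
  next
    fix g z assume g: "g \<in> carrier G" and z: "z \<in> topspace (tspace ?I)"
    let ?s = "fst z" and ?t = "?b (fst (snd z))" and ?y = "gs_act B g (proj E (fst z))"
    have y: "?y \<in> topspace (gs_top B)" by (rule gs_act_in[OF g base[OF z]])
    have gs: "vact E g ?s \<in> fibre E ?y" "vact E g ?t \<in> fibre E ?y"
      using fib[OF z] vact_in[OF E gtop g] by (auto simp: fibre_def proj_vact[OF E] g)
    note [simp] = fibre_closed[OF cE y] gs
    have mt: "vscale E (-1) ?t \<in> fibre E (proj E ?s)"
      and d: "vadd E ?s (vscale E (-1) ?t) \<in> fibre E (proj E ?s)"
      using fib[OF z] fibre_closed[OF cE base[OF z]] by blast+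
    note in_E = fibD[OF fib(1)[OF z]] fibD[OF fib(2)[OF z]] fibD[OF mt] fibD[OF d]
    have 1: "vact E g (fst (?f z)) = vadd E (vact E g ?s) (vact E g ?t)"
      using in_E by (simp add: vact_vadd[OF E g])
    have 2: "vact E g (snd (?f z)) = vscale E (if phase G g = 0 then \<i> else - \<i>)
        (vadd E (vact E g ?s) (vscale E (-1) (vact E g ?t)))"
      using in_E by (simp add: vact_vadd[OF E g] vact_vscale[OF E g])
    have "fst (snd z) \<in> topspace (tspace E)" using z by auto
    then have t: "vact E g ?t = vact E (g \<otimes>\<^bsub>G\<^esub> inv\<^bsub>G\<^esub> a) (fst (snd z))"
      and t': "?b (vact E (a \<otimes>\<^bsub>G\<^esub> g \<otimes>\<^bsub>G\<^esub> inv\<^bsub>G\<^esub> a) (fst (snd z))) = vact E g ?t"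
      and s': "?b (vact E (a \<otimes>\<^bsub>G\<^esub> g) ?s) = vact E g ?s"
      using g ia a_odd in_E by (simp_all add: m_assoc flip: vact_mult[OF E])
    show "?f (vact ?I g z) = vact (bundle_sum E E) g (?f z)"
    proof (cases "phase G g = 0")
      case True
      then show ?thesis using 1 2 t' by simp
    next
      case False
      then have "?f (vact ?I g z) = (vadd E (vact E g ?t) (vact E g ?s),
          vscale E \<i> (vadd E (vact E g ?t) (vscale E (-1) (vact E g ?s))))"
        using t s' by simp
      also have "\<dots> = (vact E g (fst (?f z)), vact E g (snd (?f z)))"
        unfolding 1 2 using False fibre_vadd_commute[OF cE y gs] fibre_rotate[OF cE y gs] by simp
      finally show ?thesis by simp
    qed
  qed
  let ?s = "\<lambda>y. vscale E (1/2) (vadd E (fst y) (vscale E (- \<i>) (snd y)))"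
    and ?t = "\<lambda>y. vscale E (1/2) (vadd E (fst y) (vscale E \<i> (snd y)))"
  let ?g = "\<lambda>y. (?s y, (?a (?t y), proj E (fst y)))"
  have fib': "fst y \<in> fibre E (proj E (fst y))" "snd y \<in> fibre E (proj E (fst y))"
    "proj E (fst y) \<in> topspace (gs_top B)" if "y \<in> topspace (tspace (bundle_sum E E))" for y
    using that bundle_proj_in[OF cE] by (auto simp: fibre_def)
  show "continuous_map (tspace (bundle_sum E E)) (tspace ?I) ?g"
  proof -
    note id = continuous_map_id'[of "tspace (bundle_sum E E)"]
    note u = continuous_map_sum_fst[OF id] and v = continuous_map_sum_snd[OF id]
    show ?thesis
      unfolding induced_bundle_simps(1)
    proof (intro continuous_map_into_sum continuous_map_into_conj continuous_map_vact[OF E]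
        continuous_map_gconst a_odd continuous_map_vscale[OF cE] continuous_map_vadd[OF cE] u v
        continuous_map_comp[OF continuous_map_bundle_proj[OF cE] u])
      fix y assume y: "y \<in> topspace (tspace (bundle_sum E E))"
      note [simp] = fibre_closed[OF cE fib'(3)[OF y]] fib'(1,2)[OF y]
      show "proj E (vscale E \<i> (snd y)) = proj E (fst y)"
        "proj E (vscale E (- \<i>) (snd y)) = proj E (fst y)"
        by (rule same[of _ "proj E (fst y)"]; simp)+
      have t: "?t y \<in> fibre E (proj E (fst y))" by simp
      show "proj E (?a (?t y)) = gs_act B a (proj E (fst y))"
        using proj_vact[OF E a_odd(1) fibD(1)[OF t]] fibD(2)[OF t] by simp
      have "proj E (?s y) = proj E (fst y)"
        by (rule same[of _ "proj E (fst y)"]; simp)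
      then show "proj E (?s y) = proj (conj_bundle G B a E) (?a (?t y), proj E (fst y))" by simp
    qed
  qed
  show "?g (?f z) = z" if z: "z \<in> topspace (tspace ?I)" for z
  proof -
    note [simp] = fibre_closed[OF cE base[OF z]] fib[OF z]
    have "?a (?b (fst (snd z))) = fst (snd z)"
      using z ia a_odd by (auto simp: vact_one[OF E] simp flip: vact_mult[OF E])
    moreover have "proj E (vadd E (fst z) (?b (fst (snd z)))) = proj E (fst z)"
      by (rule same[of _ "proj E (fst z)"]; simp)
    moreover have "proj E (fst z) = snd (snd z)" using z by auto
    ultimately show ?thesis
      using fibre_split(1,2)[OF cE base[OF z] fib[OF z]] by (simp add: prod_eq_iff)
  qed
  show "?f (?g y) = y" if y: "y \<in> topspace (tspace (bundle_sum E E))" for y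
  proof -
    note [simp] = fibre_closed[OF cE fib'(3)[OF y]] fib'(1,2)[OF y]
    have "?b (?a (?t y)) = ?t y"
      using ia a_odd fibD(1)[of "?t y" "proj E (fst y)"]
      by (simp add: vact_one[OF E] flip: vact_mult[OF E])
    then show ?thesis
      using fibre_split(3,4)[OF cE fib'(3)[OF y] fib'(1,2)[OF y]] by (simp add: prod_eq_iff)
  qed
qed

end

section \<open>K-groups via isomorphism classes\<close>

text \<open>
  The sum of two bundles in the type of representatives no longer has that type. Passing to the
  set of all representatives isomorphic to a given bundle removes this mismatch and turns rearrangements
  of direct sums into calculations in a commutative semigroup.
\<close>

definition iso_class :: "'g mgroup \<Rightarrow> ('g, 'b) gspace \<Rightarrow> ('e, 'b, 'g) vbundle \<Rightarrow> ('g, 'b) ubundle set" where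
  "iso_class G B E = {S. equivariant_bundle G B S \<and> bundle_iso G B E S}"

definition class_sum ::
  "'g mgroup \<Rightarrow> ('g, 'b) gspace \<Rightarrow> ('g, 'b) ubundle set \<Rightarrow> ('g, 'b) ubundle set \<Rightarrow> ('g, 'b) ubundle set" where
  "class_sum G B P Q = {S. equivariant_bundle G B S \<and> (\<exists>E\<in>P. \<exists>F\<in>Q.
     equivariant_bundle G B E \<and> equivariant_bundle G B F \<and> bundle_iso G B (bundle_sum E F) S)}"

lemma UN_eq_const: "\<lbrakk>x \<in> A; \<And>y. y \<in> A \<Longrightarrow> f y = c\<rbrakk> \<Longrightarrow> (\<Union>y\<in>A. f y) = c"
  by auto

locale bundle_setting =
  fixes G :: "'g mgroup" and B :: "('g, 'b) gspace"
  assumes tg: "topspace (gtop G) = carrier G" and gsp: "G_space G B"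
begin

abbreviation "eqv \<equiv> equivariant_bundle G B"
abbreviation "cls \<equiv> iso_class G B"
abbreviation csum (infixl "\<boxplus>" 65) where "P \<boxplus> Q \<equiv> class_sum G B P Q"

lemma iso_trans:
  assumes "bundle_iso G B E F" "bundle_iso G B F H" "eqv E" "eqv F" "eqv H"
  shows "bundle_iso G B E H"
  using bundle_iso_trans equivariant_bundle_imp_vector assms by metis

lemma iso_sum:
  assumes "bundle_iso G B E E'" "bundle_iso G B F F'" "eqv E" "eqv E'" "eqv F" "eqv F'"
  shows "bundle_iso G B (bundle_sum E F) (bundle_sum E' F')"
  using bundle_iso_sum equivariant_bundle_imp_vector assms by metis

lemma eqv_sum: "\<lbrakk>eqv E; eqv F\<rbrakk> \<Longrightarrow> eqv (bundle_sum E F)"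
  by (rule equivariant_bundle_sum[OF tg])

lemma iso_class_eq_iff:
  assumes "eqv E" "eqv F"
  shows "cls E = cls F \<longleftrightarrow> bundle_iso G B E F"
proof
  assume "cls E = cls F"
  obtain S :: "('g, 'b) ubundle" where S: "eqv S" "bundle_iso G B E S"
    using ubundle_exhaustive[OF assms(1) tg] by blast
  then have "S \<in> cls E" by (simp add: iso_class_def)
  then have "S \<in> cls F" using \<open>cls E = cls F\<close> by simp
  then have "bundle_iso G B F S" by (simp add: iso_class_def)
  then show "bundle_iso G B E F"
    using iso_trans[OF S(2) bundle_iso_sym assms(1) S(1) assms(2)] by blast
next
  assume iso: "bundle_iso G B E F"
  then have iso': "bundle_iso G B F E" by (rule bundle_iso_sym)
  show "cls E = cls F"
    using iso_trans[OF iso] iso_trans[OF iso'] assms by (auto simp: iso_class_def)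
qed

lemma obtain_ubundle:
  assumes "eqv E"
  obtains S :: "('g, 'b) ubundle" where "eqv S" "bundle_iso G B E S" "cls S = cls E"
proof -
  obtain S :: "('g, 'b) ubundle" where S: "eqv S" "bundle_iso G B E S"
    using ubundle_exhaustive[OF assms tg] by blast
  then show ?thesis using that iso_class_eq_iff[OF assms S(1)] by metis
qed

lemma iso_class_sum:
  assumes E: "eqv E" and F: "eqv F"
  shows "cls (bundle_sum E F) = cls E \<boxplus> cls F"
proof (rule subset_antisym; rule subsetI)
  fix S assume "S \<in> cls (bundle_sum E F)"
  then have S: "eqv S" "bundle_iso G B (bundle_sum E F) S" by (auto simp: iso_class_def)
  obtain E' :: "('g, 'b) ubundle" where E': "eqv E'" "bundle_iso G B E E'" "cls E' = cls E" by (rule obtain_ubundle[OF E])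
  obtain F' :: "('g, 'b) ubundle" where F': "eqv F'" "bundle_iso G B F F'" "cls F' = cls F" by (rule obtain_ubundle[OF F])
  have "bundle_iso G B (bundle_sum E' F') S"
    by (rule iso_trans[OF bundle_iso_sym[OF iso_sum[OF E'(2) F'(2)]] S(2)])
      (use E F E' F' S in \<open>auto intro: eqv_sum\<close>)
  moreover have "E' \<in> cls E" "F' \<in> cls F" using E' F' by (simp_all add: iso_class_def)
  ultimately show "S \<in> cls E \<boxplus> cls F" unfolding class_sum_def using S E' F' by blast
next
  fix S assume "S \<in> cls E \<boxplus> cls F"
  then obtain E' F' where EF: "E' \<in> cls E" "F' \<in> cls F" "eqv S" "eqv E'" "eqv F'"
    "bundle_iso G B (bundle_sum E' F') S"
    unfolding class_sum_def by blast
  then have "bundle_iso G B E E'" "bundle_iso G B F F'" by (simp_all add: iso_class_def)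
  note * = EF(3,4,5) this EF(6)
  have "bundle_iso G B (bundle_sum E F) S"
    by (rule iso_trans[OF iso_sum[OF *(4,5)] *(6)]) (use * E F in \<open>auto intro: eqv_sum\<close>)
  then show "S \<in> cls (bundle_sum E F)" using * by (simp add: iso_class_def)
qed

lemma class_sum_commute: "P \<boxplus> Q = Q \<boxplus> P"
proof -
  have "S \<in> Q \<boxplus> P" if S: "S \<in> P \<boxplus> Q" for P Q S
  proof -
    obtain E F where *: "eqv S" "E \<in> P" "F \<in> Q" "eqv E" "eqv F" "bundle_iso G B (bundle_sum E F) S"
      using S unfolding class_sum_def by blast
    have "bundle_iso G B (bundle_sum F E) S"
      by (rule iso_trans[OF bundle_iso_sum_commute *(6)]) (use * in \<open>auto intro: eqv_sum\<close>)
    then show ?thesis unfolding class_sum_def using * by blast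
  qed
  then show ?thesis by blast
qed

lemma class_sum_assoc: "P \<boxplus> Q \<boxplus> R = P \<boxplus> (Q \<boxplus> R)"
proof -
  have le: "P \<boxplus> Q \<boxplus> R \<subseteq> P \<boxplus> (Q \<boxplus> R)" for P Q R
  proof
    fix S assume "S \<in> P \<boxplus> Q \<boxplus> R"
    then obtain T H where TH: "eqv S" "T \<in> P \<boxplus> Q" "H \<in> R" "eqv T" "eqv H"
      "bundle_iso G B (bundle_sum T H) S"
      unfolding class_sum_def[of G B "P \<boxplus> Q"] by blast
    from TH(2) obtain E F where EF: "E \<in> P" "F \<in> Q" "eqv E" "eqv F"
      "bundle_iso G B (bundle_sum E F) T"
      unfolding class_sum_def by blast
    note * = TH(1) EF(1,2) TH(3) EF(3,4) TH(5,4) EF(5) TH(6)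
    obtain D :: "('g, 'b) ubundle" where D: "eqv D" "bundle_iso G B (bundle_sum F H) D"
      using obtain_ubundle[OF eqv_sum[OF *(6,7)]] by metis
    have "bundle_iso G B (bundle_sum E D) (bundle_sum E (bundle_sum F H))"
      by (rule iso_sum[OF bundle_iso_refl bundle_iso_sym[OF D(2)]]) (use * D in \<open>auto intro: eqv_sum\<close>)
    from iso_trans[OF this bundle_iso_sym[OF bundle_iso_sum_assoc]]
    have 1: "bundle_iso G B (bundle_sum E D) (bundle_sum (bundle_sum E F) H)"
      using * D by (auto intro: eqv_sum)
    have "bundle_iso G B (bundle_sum (bundle_sum E F) H) (bundle_sum T H)"
      by (rule iso_sum[OF *(9) bundle_iso_refl]) (use * in \<open>auto intro: eqv_sum\<close>)
    from iso_trans[OF this *(10)]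
    have 2: "bundle_iso G B (bundle_sum (bundle_sum E F) H) S"
      using * by (auto intro: eqv_sum)
    from iso_trans[OF 1 2] have "bundle_iso G B (bundle_sum E D) S"
      using * D by (auto intro: eqv_sum)
    moreover have "D \<in> Q \<boxplus> R" unfolding class_sum_def using * D by blast
    ultimately show "S \<in> P \<boxplus> (Q \<boxplus> R)" unfolding class_sum_def[of G B P] using * D by blast
  qed
  show ?thesis
  proof (rule subset_antisym[OF le])
    have "P \<boxplus> (Q \<boxplus> R) = R \<boxplus> Q \<boxplus> P" by (metis class_sum_commute)
    also have "\<dots> \<subseteq> R \<boxplus> (Q \<boxplus> P)" by (rule le)
    also have "\<dots> = P \<boxplus> Q \<boxplus> R" by (metis class_sum_commute)
    finally show "P \<boxplus> (Q \<boxplus> R) \<subseteq> P \<boxplus> Q \<boxplus> R" .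
  qed
qed

lemma class_sum_left_commute: "P \<boxplus> (Q \<boxplus> R) = Q \<boxplus> (P \<boxplus> R)"
  by (metis class_sum_assoc class_sum_commute)

lemmas class_sum_ac = class_sum_assoc class_sum_commute class_sum_left_commute

lemma mem_kclass_iff:
  assumes "eqv E0" "eqv E1"
  shows "(S0, S1) \<in> kclass G B E0 E1 \<longleftrightarrow> eqv S0 \<and> eqv S1 \<and>
    (\<exists>F :: ('g, 'b) ubundle. eqv F \<and> cls E0 \<boxplus> (cls S1 \<boxplus> cls F) = cls S0 \<boxplus> (cls E1 \<boxplus> cls F))"
proof -
  have "bundle_iso G B (bundle_sum E0 (bundle_sum S1 F)) (bundle_sum S0 (bundle_sum E1 F)) \<longleftrightarrow>
      cls E0 \<boxplus> (cls S1 \<boxplus> cls F) = cls S0 \<boxplus> (cls E1 \<boxplus> cls F)"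
    if "eqv S0" "eqv S1" "eqv F" for F :: "('g, 'b) ubundle"
    using that assms by (simp add: eqv_sum iso_class_sum flip: iso_class_eq_iff)
  then show ?thesis unfolding kclass_def by auto
qed

lemma kclass_self:
  assumes "eqv E0" "eqv E1"
  shows "(E0, E1) \<in> kclass G B E0 E1"
  using assms by (auto simp: mem_kclass_iff)

text \<open>
  Transitivity of the stable equivalence: the bundle \<open>E\<^sub>1 \<oplus> X \<oplus> F\<close> stabilizes one equivalence
  when \<open>X\<close> and \<open>F\<close> stabilize the other two.
\<close>

lemma kclass_eqI:
  assumes "eqv E0" "eqv E1" "eqv F0" "eqv F1" "eqv X"
    and "cls E0 \<boxplus> (cls F1 \<boxplus> cls X) = cls F0 \<boxplus> (cls E1 \<boxplus> cls X)"
  shows "kclass G B E0 E1 = kclass G B F0 F1"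
proof -
  have le: "kclass G B E0 E1 \<subseteq> kclass G B F0 F1"
    if e: "eqv E0" "eqv E1" "eqv F0" "eqv F1" "eqv X"
      and X: "cls E0 \<boxplus> (cls F1 \<boxplus> cls X) = cls F0 \<boxplus> (cls E1 \<boxplus> cls X)"
    for E0 E1 :: "('p, 'b, 'g) vbundle" and F0 F1 :: "('q, 'b, 'g) vbundle" and X :: "('r, 'b, 'g) vbundle"
  proof
    fix s assume s: "s \<in> kclass G B E0 E1"
    obtain S0 S1 where s_eq: "s = (S0, S1)" by (cases s)
    from s obtain F :: "('g, 'b) ubundle" where F: "eqv S0" "eqv S1" "eqv F"
      "cls E0 \<boxplus> (cls S1 \<boxplus> cls F) = cls S0 \<boxplus> (cls E1 \<boxplus> cls F)"
      using mem_kclass_iff[OF e(1,2)] s_eq by blast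
    obtain Y :: "('g, 'b) ubundle" where Y: "eqv Y" "bundle_iso G B (bundle_sum E1 (bundle_sum X F)) Y"
      "cls Y = cls (bundle_sum E1 (bundle_sum X F))"
      by (rule obtain_ubundle[OF eqv_sum[OF e(2) eqv_sum[OF e(5) F(3)]]])
    have Y': "cls Y = cls E1 \<boxplus> (cls X \<boxplus> cls F)"
      using Y(3) e F by (simp add: iso_class_sum eqv_sum)
    have "cls F0 \<boxplus> (cls S1 \<boxplus> cls Y) = (cls F0 \<boxplus> (cls E1 \<boxplus> cls X)) \<boxplus> (cls S1 \<boxplus> cls F)"
      unfolding Y' by (simp add: class_sum_ac)
    also have "\<dots> = (cls E0 \<boxplus> (cls S1 \<boxplus> cls F)) \<boxplus> (cls F1 \<boxplus> cls X)"
      unfolding X[symmetric] by (simp add: class_sum_ac)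
    also have "\<dots> = cls S0 \<boxplus> (cls F1 \<boxplus> cls Y)"
      unfolding Y' F(4) by (simp add: class_sum_ac)
    finally show "s \<in> kclass G B F0 F1"
      unfolding s_eq mem_kclass_iff[OF e(3,4)] using F Y(1) by blast
  qed
  show ?thesis using le[OF assms] le[OF assms(3,4,1,2,5) assms(6)[symmetric]] by (rule subset_antisym)
qed

lemma kclass_cong:
  assumes "eqv E0" "eqv E1" "eqv F0" "eqv F1" "bundle_iso G B E0 F0" "bundle_iso G B E1 F1"
  shows "kclass G B E0 E1 = kclass G B F0 F1"
  by (rule kclass_eqI[OF assms(1-4) assms(1)]) (use assms in \<open>simp flip: iso_class_eq_iff\<close>)

lemma kclass_ubundle:
  assumes "eqv E0" "eqv E1"
  obtains S0 S1 :: "('g, 'b) ubundle" where "eqv S0" "eqv S1" "bundle_iso G B E0 S0" "bundle_iso G B E1 S1"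
    "kclass G B E0 E1 = kclass G B S0 S1"
proof -
  obtain S0 :: "('g, 'b) ubundle" where S0: "eqv S0" "bundle_iso G B E0 S0" "cls S0 = cls E0" by (rule obtain_ubundle[OF assms(1)])
  obtain S1 :: "('g, 'b) ubundle" where S1: "eqv S1" "bundle_iso G B E1 S1" "cls S1 = cls E1" by (rule obtain_ubundle[OF assms(2)])
  show ?thesis
    by (rule that[OF S0(1) S1(1) S0(2) S1(2) kclass_cong[OF assms S0(1) S1(1) S0(2) S1(2)]])
qed

lemma kclass_carrier: "\<lbrakk>eqv E0; eqv E1\<rbrakk> \<Longrightarrow> kclass G B E0 E1 \<in> carrier (K_group G B)"
  by (erule (1) kclass_ubundle) (auto simp: K_group_def)

lemma carrier_K_groupE:
  assumes "\<xi> \<in> carrier (K_group G B)"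
  obtains E0 E1 :: "('g, 'b) ubundle" where "eqv E0" "eqv E1" "\<xi> = kclass G B E0 E1"
  using assms by (auto simp: K_group_def)

lemma K_one: "\<one>\<^bsub>K_group G B\<^esub> = kclass G B (zero_bundle B) (zero_bundle B)"
  by (simp add: K_group_def)

lemma eqv_zero: "eqv (zero_bundle B)"
  by (rule equivariant_bundle_zero[OF gsp])

lemma kclass_diagonal:
  assumes "eqv E"
  shows "kclass G B E E = \<one>\<^bsub>K_group G B\<^esub>"
  unfolding K_one by (rule kclass_eqI[OF assms assms eqv_zero eqv_zero assms]) (simp add: class_sum_ac)

lemma K_mult:
  assumes e: "eqv E0" "eqv E1" and f: "eqv F0" "eqv F1"
  shows "kclass G B E0 E1 \<otimes>\<^bsub>K_group G B\<^esub> kclass G B F0 F1 =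
    kclass G B (bundle_sum E0 F0) (bundle_sum E1 F1)"
proof -
  have eq: "kclass G B (bundle_sum S0 T0) (bundle_sum S1 T1) = kclass G B (bundle_sum E0 F0) (bundle_sum E1 F1)"
    if s: "(S0, S1) \<in> kclass G B E0 E1" and t: "(T0, T1) \<in> kclass G B F0 F1" for S0 S1 T0 T1
  proof -
    obtain X :: "('g, 'b) ubundle" where X: "eqv S0" "eqv S1" "eqv X"
      "cls E0 \<boxplus> (cls S1 \<boxplus> cls X) = cls S0 \<boxplus> (cls E1 \<boxplus> cls X)"
      using s mem_kclass_iff[OF e] by blast
    obtain Y :: "('g, 'b) ubundle" where Y: "eqv T0" "eqv T1" "eqv Y"
      "cls F0 \<boxplus> (cls T1 \<boxplus> cls Y) = cls T0 \<boxplus> (cls F1 \<boxplus> cls Y)"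
      using t mem_kclass_iff[OF f] by blast
    have "(cls S0 \<boxplus> cls T0) \<boxplus> ((cls E1 \<boxplus> cls F1) \<boxplus> (cls X \<boxplus> cls Y)) =
        (cls S0 \<boxplus> (cls E1 \<boxplus> cls X)) \<boxplus> (cls T0 \<boxplus> (cls F1 \<boxplus> cls Y))" by (simp add: class_sum_ac)
    also have "\<dots> = (cls E0 \<boxplus> cls F0) \<boxplus> ((cls S1 \<boxplus> cls T1) \<boxplus> (cls X \<boxplus> cls Y))"
      unfolding X(4)[symmetric] Y(4)[symmetric] by (simp add: class_sum_ac)
    finally show ?thesis
      using e f X Y by (intro kclass_eqI[where X = "bundle_sum X Y"]) (simp_all add: eqv_sum iso_class_sum)
  qed
  obtain s t where st: "s \<in> kclass G B E0 E1" "t \<in> kclass G B F0 F1"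
    using kclass_ubundle[OF e] kclass_ubundle[OF f] kclass_self by metis
  have "kclass G B E0 E1 \<otimes>\<^bsub>K_group G B\<^esub> kclass G B F0 F1 =
     (\<Union>s\<in>kclass G B E0 E1. \<Union>t\<in>kclass G B F0 F1.
        kclass G B (bundle_sum (fst s) (fst t)) (bundle_sum (snd s) (snd t)))"
    by (simp add: K_group_def case_prod_unfold)
  also have "\<dots> = kclass G B (bundle_sum E0 F0) (bundle_sum E1 F1)"
    by (rule UN_eq_const[OF st(1)], rule UN_eq_const[OF st(2)], rule eq) simp_all
  finally show ?thesis .
qed

lemma K_mult_closed:
  assumes "\<xi> \<in> carrier (K_group G B)" "\<eta> \<in> carrier (K_group G B)"
  shows "\<xi> \<otimes>\<^bsub>K_group G B\<^esub> \<eta> \<in> carrier (K_group G B)"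
  using assms by (elim carrier_K_groupE) (simp add: K_mult kclass_carrier eqv_sum)

end

text \<open>
  Compatibility with sums is stated through a representative \<open>S\<close> of the sum, since \<open>\<Phi>\<close> applies
  only to bundles in the type of representatives.
\<close>

definition additive_construction ::
  "'g mgroup \<Rightarrow> ('g, 'b) gspace \<Rightarrow> 'g mgroup \<Rightarrow> ('g, 'c) gspace \<Rightarrow>
   (('g, 'b) ubundle \<Rightarrow> ('e, 'c, 'g) vbundle) \<Rightarrow> bool" where
  "additive_construction G B H C \<Phi> \<longleftrightarrow>
     (\<forall>E. equivariant_bundle G B E \<longrightarrow> equivariant_bundle H C (\<Phi> E)) \<and>
     (\<forall>E F S. equivariant_bundle G B E \<longrightarrow> equivariant_bundle G B F \<longrightarrow> equivariant_bundle G B S \<longrightarrow>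
        bundle_iso G B (bundle_sum E F) S \<longrightarrow> bundle_iso H C (bundle_sum (\<Phi> E) (\<Phi> F)) (\<Phi> S))"

locale additive_map = dom: bundle_setting G B + cod: bundle_setting H C
  for G :: "'g mgroup" and B :: "('g, 'b) gspace" and H :: "'g mgroup" and C :: "('g, 'c) gspace" +
  fixes \<Phi> :: "('g, 'b) ubundle \<Rightarrow> ('e, 'c, 'g) vbundle"
  assumes additive: "additive_construction G B H C \<Phi>"
begin

lemma \<Phi>_eqv: "dom.eqv E \<Longrightarrow> cod.eqv (\<Phi> E)"
  using additive by (simp add: additive_construction_def)

lemma \<Phi>_cls:
  assumes "dom.eqv E" "dom.eqv F" "dom.eqv S" "dom.cls S = class_sum G B (dom.cls E) (dom.cls F)"
  shows "cod.cls (\<Phi> S) = class_sum H C (cod.cls (\<Phi> E)) (cod.cls (\<Phi> F))"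
proof -
  have "dom.cls (bundle_sum E F) = dom.cls S" using assms by (simp add: dom.iso_class_sum)
  then have "bundle_iso G B (bundle_sum E F) S"
    using dom.iso_class_eq_iff[OF dom.eqv_sum[OF assms(1,2)] assms(3)] by simp
  then have "bundle_iso H C (bundle_sum (\<Phi> E) (\<Phi> F)) (\<Phi> S)"
    using additive assms unfolding additive_construction_def by blast
  then have "cod.cls (bundle_sum (\<Phi> E) (\<Phi> F)) = cod.cls (\<Phi> S)"
    using cod.iso_class_eq_iff[OF cod.eqv_sum[OF \<Phi>_eqv[OF assms(1)] \<Phi>_eqv[OF assms(2)]] \<Phi>_eqv[OF assms(3)]]
    by simp
  then show ?thesis using assms by (simp add: cod.iso_class_sum \<Phi>_eqv)
qed

lemma K_map_kclass:
  assumes E: "dom.eqv E0" "dom.eqv E1"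
  shows "K_map H C \<Phi> (kclass G B E0 E1) = kclass H C (\<Phi> E0) (\<Phi> E1)"
proof -
  have eq: "kclass H C (\<Phi> S0) (\<Phi> S1) = kclass H C (\<Phi> E0) (\<Phi> E1)"
    if s: "(S0, S1) \<in> kclass G B E0 E1" for S0 S1
  proof -
    obtain F :: "('g, 'b) ubundle" where F: "dom.eqv S0" "dom.eqv S1" "dom.eqv F"
      "class_sum G B (dom.cls E0) (class_sum G B (dom.cls S1) (dom.cls F)) =
       class_sum G B (dom.cls S0) (class_sum G B (dom.cls E1) (dom.cls F))"
      using s dom.mem_kclass_iff[OF E] by blast
    \<comment> \<open>\<open>T\<close> represents both sides of the stable isomorphism, so that additivity applies to either.\<close>
    obtain P :: "('g, 'b) ubundle" where P: "dom.eqv P" "bundle_iso G B (bundle_sum S1 F) P"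
      "dom.cls P = dom.cls (bundle_sum S1 F)"
      by (rule dom.obtain_ubundle[OF dom.eqv_sum[OF F(2,3)]])
    obtain Q :: "('g, 'b) ubundle" where Q: "dom.eqv Q" "bundle_iso G B (bundle_sum E1 F) Q"
      "dom.cls Q = dom.cls (bundle_sum E1 F)"
      by (rule dom.obtain_ubundle[OF dom.eqv_sum[OF E(2) F(3)]])
    obtain T :: "('g, 'b) ubundle" where T: "dom.eqv T" "bundle_iso G B (bundle_sum E0 P) T"
      "dom.cls T = dom.cls (bundle_sum E0 P)"
      by (rule dom.obtain_ubundle[OF dom.eqv_sum[OF E(1) P(1)]])
    have P': "dom.cls P = class_sum G B (dom.cls S1) (dom.cls F)"
      and Q': "dom.cls Q = class_sum G B (dom.cls E1) (dom.cls F)"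
      and T': "dom.cls T = class_sum G B (dom.cls E0) (dom.cls P)"
      using P(3) Q(3) T(3) E F P(1) by (simp_all add: dom.iso_class_sum)
    have T'': "dom.cls T = class_sum G B (dom.cls S0) (dom.cls Q)"
      unfolding T' P' Q' F(4) ..
    show ?thesis
    proof (rule cod.kclass_eqI[where X = "\<Phi> F"])
      show "class_sum H C (cod.cls (\<Phi> S0)) (class_sum H C (cod.cls (\<Phi> E1)) (cod.cls (\<Phi> F))) =
        class_sum H C (cod.cls (\<Phi> E0)) (class_sum H C (cod.cls (\<Phi> S1)) (cod.cls (\<Phi> F)))"
        using \<Phi>_cls[OF E(1) P(1) T(1) T'] \<Phi>_cls[OF F(1) Q(1) T(1) T'']
          \<Phi>_cls[OF F(2,3) P(1) P'] \<Phi>_cls[OF E(2) F(3) Q(1) Q'] by simp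
    qed (use E F in \<open>simp_all add: \<Phi>_eqv\<close>)
  qed
  have "(case s of (S0, S1) \<Rightarrow> kclass H C (\<Phi> S0) (\<Phi> S1)) = kclass H C (\<Phi> E0) (\<Phi> E1)"
    if "s \<in> kclass G B E0 E1" for s
    using that by (cases s) (simp add: eq)
  then show ?thesis
    unfolding K_map_def by (rule UN_eq_const[OF dom.kclass_self[OF E]])
qed

lemma K_map_hom: "K_map H C \<Phi> \<in> hom (K_group G B) (K_group H C)"
proof (rule homI)
  fix \<xi> assume "\<xi> \<in> carrier (K_group G B)"
  then show "K_map H C \<Phi> \<xi> \<in> carrier (K_group H C)"
    by (elim dom.carrier_K_groupE) (simp add: K_map_kclass cod.kclass_carrier \<Phi>_eqv)
next
  fix \<xi> \<eta> assume "\<xi> \<in> carrier (K_group G B)" "\<eta> \<in> carrier (K_group G B)"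
  then obtain E0 E1 F0 F1 :: "('g, 'b) ubundle"
    where E: "dom.eqv E0" "dom.eqv E1" "\<xi> = kclass G B E0 E1"
      and F: "dom.eqv F0" "dom.eqv F1" "\<eta> = kclass G B F0 F1"
    by (elim dom.carrier_K_groupE)
  obtain S0 :: "('g, 'b) ubundle" where S0: "dom.eqv S0" "bundle_iso G B (bundle_sum E0 F0) S0"
    "dom.cls S0 = dom.cls (bundle_sum E0 F0)"
    by (rule dom.obtain_ubundle[OF dom.eqv_sum[OF E(1) F(1)]])
  obtain S1 :: "('g, 'b) ubundle" where S1: "dom.eqv S1" "bundle_iso G B (bundle_sum E1 F1) S1"
    "dom.cls S1 = dom.cls (bundle_sum E1 F1)"
    by (rule dom.obtain_ubundle[OF dom.eqv_sum[OF E(2) F(2)]])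
  have "\<xi> \<otimes>\<^bsub>K_group G B\<^esub> \<eta> = kclass G B S0 S1"
    unfolding E(3) F(3) dom.K_mult[OF E(1,2) F(1,2)]
    by (rule dom.kclass_cong[OF _ _ S0(1) S1(1) S0(2) S1(2)]) (use E F in \<open>auto intro: dom.eqv_sum\<close>)
  then have "K_map H C \<Phi> (\<xi> \<otimes>\<^bsub>K_group G B\<^esub> \<eta>) = kclass H C (\<Phi> S0) (\<Phi> S1)"
    by (simp add: K_map_kclass S0 S1)
  also have "\<dots> = kclass H C (bundle_sum (\<Phi> E0) (\<Phi> F0)) (bundle_sum (\<Phi> E1) (\<Phi> F1))"
  proof (rule cod.kclass_cong[OF \<Phi>_eqv[OF S0(1)] \<Phi>_eqv[OF S1(1)]])
    have "bundle_iso H C (bundle_sum (\<Phi> E0) (\<Phi> F0)) (\<Phi> S0)" "bundle_iso H C (bundle_sum (\<Phi> E1) (\<Phi> F1)) (\<Phi> S1)"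
      using additive E F S0 S1 unfolding additive_construction_def by blast+
    then show "bundle_iso H C (\<Phi> S0) (bundle_sum (\<Phi> E0) (\<Phi> F0))"
      "bundle_iso H C (\<Phi> S1) (bundle_sum (\<Phi> E1) (\<Phi> F1))" by (auto intro: bundle_iso_sym)
  qed (use E F in \<open>auto intro!: cod.eqv_sum \<Phi>_eqv\<close>)
  also have "\<dots> = K_map H C \<Phi> \<xi> \<otimes>\<^bsub>K_group H C\<^esub> K_map H C \<Phi> \<eta>"
    using E F by (simp add: K_map_kclass cod.K_mult \<Phi>_eqv)
  finally show "K_map H C \<Phi> (\<xi> \<otimes>\<^bsub>K_group G B\<^esub> \<eta>) =
    K_map H C \<Phi> \<xi> \<otimes>\<^bsub>K_group H C\<^esub> K_map H C \<Phi> \<eta>" .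
qed

lemma K_map_one: "K_map H C \<Phi> \<one>\<^bsub>K_group G B\<^esub> = \<one>\<^bsub>K_group H C\<^esub>"
  unfolding dom.K_one by (simp add: K_map_kclass dom.eqv_zero \<Phi>_eqv cod.kclass_diagonal)

end

section \<open>Restriction, conjugation and induction in K-theory\<close>

context magnetic_setting begin

sublocale full: bundle_setting G B
  by unfold_locales (rule gtop, rule B)

sublocale even: bundle_setting G0 B
  by unfold_locales (rule gtop0, rule G_space_even)

lemma additive_map_even: "additive_map G B G0 B (\<lambda>E. E)"
  by unfold_locales
    (auto simp: additive_construction_def intro: equivariant_bundle_even bundle_iso_even)

lemma additive_map_conj: "additive_map G0 B G0 B (conj_bundle G B a)"
proof unfold_locales
  have "bundle_iso G0 B (bundle_sum (conj_bundle G B a E) (conj_bundle G B a F)) (conj_bundle G B a S)"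
    if "even.eqv E" "even.eqv F" "even.eqv S" "bundle_iso G0 B (bundle_sum E F) S"
    for E F S :: "('g, 'b) ubundle"
  proof (rule even.iso_trans[OF bundle_iso_sym[OF bundle_iso_conj_sum[OF that(1,2)]]])
    show "bundle_iso G0 B (conj_bundle G B a (bundle_sum E F)) (conj_bundle G B a S)"
      by (rule bundle_iso_conj[OF _ _ that(4)])
        (use that in \<open>auto intro: equivariant_bundle_imp_vector even.eqv_sum\<close>)
  qed (use that in \<open>auto intro: even.eqv_sum equivariant_bundle_conj\<close>)
  then show "additive_construction G0 B G0 B (conj_bundle G B a)"
    by (auto simp: additive_construction_def intro: equivariant_bundle_conj)
qed

lemma additive_map_induced: "additive_map G0 B G B (induced_bundle G B a)"
proof unfold_locales
  have "bundle_iso G B (bundle_sum (induced_bundle G B a E) (induced_bundle G B a F)) (induced_bundle G B a S)"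
    if "even.eqv E" "even.eqv F" "even.eqv S" "bundle_iso G0 B (bundle_sum E F) S"
    for E F S :: "('g, 'b) ubundle"
  proof (rule full.iso_trans[OF bundle_iso_sym[OF bundle_iso_induced_sum[OF that(1,2)]]])
    show "bundle_iso G B (induced_bundle G B a (bundle_sum E F)) (induced_bundle G B a S)"
      by (rule bundle_iso_induced[OF _ _ that(4)])
        (use that in \<open>auto intro: equivariant_bundle_imp_vector even.eqv_sum\<close>)
  qed (use that in \<open>auto intro: even.eqv_sum full.eqv_sum equivariant_bundle_induced\<close>)
  then show "additive_construction G0 B G B (induced_bundle G B a)"
    by (auto simp: additive_construction_def intro: equivariant_bundle_induced)
qed

abbreviation "K_res \<equiv> K_map G0 B (\<lambda>E. E)"
abbreviation "K_cnj \<equiv> K_map G0 B (conj_bundle G B a)"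
abbreviation "K_ind \<equiv> K_map G B (induced_bundle G B a)"

lemma K_res_kclass:
  fixes E0 E1 :: "('e, 'b, 'g) vbundle"
  assumes E: "full.eqv E0" "full.eqv E1"
  shows "K_res (kclass G B E0 E1) = kclass G0 B E0 E1"
proof -
  obtain S0 S1 :: "('g, 'b) ubundle" where S: "full.eqv S0" "full.eqv S1" "bundle_iso G B E0 S0"
    "bundle_iso G B E1 S1" "kclass G B E0 E1 = kclass G B S0 S1"
    by (rule full.kclass_ubundle[OF E])
  have "K_res (kclass G B E0 E1) = kclass G0 B S0 S1"
    unfolding S(5) by (rule additive_map.K_map_kclass[OF additive_map_even S(1,2)])
  also have "\<dots> = kclass G0 B E0 E1"
    by (rule even.kclass_cong)
      (use E S in \<open>auto intro: equivariant_bundle_even bundle_iso_even bundle_iso_sym\<close>)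
  finally show ?thesis .
qed

lemma K_cnj_res:
  assumes "\<xi> \<in> carrier (K_group G B)"
  shows "K_cnj (K_res \<xi>) = K_res \<xi>"
  using assms
proof (rule full.carrier_K_groupE)
  fix E0 E1 :: "('g, 'b) ubundle" assume E: "full.eqv E0" "full.eqv E1" "\<xi> = kclass G B E0 E1"
  note E0 = equivariant_bundle_even[OF E(1)] equivariant_bundle_even[OF E(2)]
  have "kclass G0 B (conj_bundle G B a E0) (conj_bundle G B a E1) = kclass G0 B E0 E1"
    by (rule even.kclass_cong[OF equivariant_bundle_conj[OF E0(1)] equivariant_bundle_conj[OF E0(2)] E0
          bundle_iso_conj_magnetic[OF E(1)] bundle_iso_conj_magnetic[OF E(2)]])
  then show ?thesis
    unfolding E(3) K_res_kclass[OF E(1,2)] additive_map.K_map_kclass[OF additive_map_conj E0] .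
qed

lemma K_ind_res:
  assumes "\<xi> \<in> carrier (K_group G B)"
  shows "K_ind (K_res \<xi>) = \<xi> \<otimes>\<^bsub>K_group G B\<^esub> \<xi>"
  using assms
proof (rule full.carrier_K_groupE)
  fix E0 E1 :: "('g, 'b) ubundle" assume E: "full.eqv E0" "full.eqv E1" "\<xi> = kclass G B E0 E1"
  note E0 = equivariant_bundle_even[OF E(1)] equivariant_bundle_even[OF E(2)]
  have "kclass G B (induced_bundle G B a E0) (induced_bundle G B a E1) =
      kclass G B (bundle_sum E0 E0) (bundle_sum E1 E1)"
    by (rule full.kclass_cong[OF equivariant_bundle_induced[OF E0(1)] equivariant_bundle_induced[OF E0(2)]
          full.eqv_sum[OF E(1,1)] full.eqv_sum[OF E(2,2)]
          bundle_iso_induced_magnetic[OF E(1)] bundle_iso_induced_magnetic[OF E(2)]])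
  then show ?thesis
    unfolding E(3) K_res_kclass[OF E(1,2)] additive_map.K_map_kclass[OF additive_map_induced E0]
      full.K_mult[OF E(1,2) E(1,2)] .
qed

lemma K_res_ind:
  assumes "\<xi> \<in> carrier (K_group G0 B)"
  shows "K_res (K_ind \<xi>) = \<xi> \<otimes>\<^bsub>K_group G0 B\<^esub> K_cnj \<xi>"
  using assms
proof (rule even.carrier_K_groupE)
  fix E0 E1 :: "('g, 'b) ubundle" assume E: "even.eqv E0" "even.eqv E1" "\<xi> = kclass G0 B E0 E1"
  note I = equivariant_bundle_induced[OF E(1)] equivariant_bundle_induced[OF E(2)]
  note C = equivariant_bundle_conj[OF E(1)] equivariant_bundle_conj[OF E(2)]
  have "K_res (K_ind \<xi>) = kclass G0 B (induced_bundle G B a E0) (induced_bundle G B a E1)"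
    unfolding E(3) additive_map.K_map_kclass[OF additive_map_induced E(1,2)] by (rule K_res_kclass[OF I])
  also have "\<dots> = kclass G0 B (bundle_sum E0 (conj_bundle G B a E0)) (bundle_sum E1 (conj_bundle G B a E1))"
    by (rule even.kclass_cong[OF equivariant_bundle_even[OF I(1)] equivariant_bundle_even[OF I(2)]
          even.eqv_sum[OF E(1) C(1)] even.eqv_sum[OF E(2) C(2)]
          bundle_iso_induced_even bundle_iso_induced_even])
  also have "\<dots> = \<xi> \<otimes>\<^bsub>K_group G0 B\<^esub> K_cnj \<xi>"
    unfolding E(3) additive_map.K_map_kclass[OF additive_map_conj E(1,2)] even.K_mult[OF E(1,2) C] ..
  finally show ?thesis .
qed

end

section \<open>Quotients of spaces with group action\<close>

lemma continuous_map_quot_proj: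
  "continuous_map T (quot_topology T Y) (quot_proj Y)"
  by (auto simp: continuous_map_def openin_quot_topology topspace_quot_topology quot_proj_def)

text \<open>
  As \<open>G\<close> is compact Hausdorff, the product of \<open>G\<close> with a quotient map is a quotient map, so continuity
  can be tested before passing to the quotient. For empty \<open>Y\<close> the projection misses the added base
  point, and the quotient is covered by the open pieces \<open>Z\<close> and the base point instead.
\<close>

lemma G_space_quotient:
  fixes G :: "'g mgroup" and Z :: "('g, 'z) gspace"
  assumes G: "topological_group G" "compact_space (gtop G)" "Hausdorff_space (gtop G)"
    and Z: "G_space G Z" and Y: "Y \<subseteq> topspace (gs_top Z)"
    and inv: "\<And>g y. \<lbrakk>g \<in> carrier G; y \<in> Y\<rbrakk> \<Longrightarrow> gs_act Z g y \<in> Y"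
  shows "G_space G (quot_gspace Z Y)"
proof -
  interpret group G using G by (simp add: topological_group_def)
  have tg: "topspace (gtop G) = carrier G" using G by (simp add: topological_group_def)
  let ?T = "gs_top Z" and ?Q = "quot_topology (gs_top Z) Y"
  let ?act = "\<lambda>g z. Option.bind z (\<lambda>x. quot_proj Y (gs_act Z g x))"
  have act: "continuous_map (prod_topology (gtop G) ?T) ?T (\<lambda>(g, x). gs_act Z g x)"
    and one: "\<And>x. x \<in> topspace ?T \<Longrightarrow> gs_act Z \<one>\<^bsub>G\<^esub> x = x"
    and mult: "\<And>g h x. \<lbrakk>g \<in> carrier G; h \<in> carrier G; x \<in> topspace ?T\<rbrakk> \<Longrightarrow>
        gs_act Z (g \<otimes>\<^bsub>G\<^esub> h) x = gs_act Z g (gs_act Z h x)"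
    using Z by (simp_all add: G_space_def)
  \<comment> \<open>As \<open>g\<close> is invertible, it maps the complement of \<open>Y\<close> into itself.\<close>
  have inY: "x \<in> Y" if "g \<in> carrier G" "x \<in> topspace ?T" "gs_act Z g x \<in> Y" for g x
    using inv[of "inv\<^bsub>G\<^esub> g" "gs_act Z g x"] mult[of "inv\<^bsub>G\<^esub> g" g x] one that by simp
  have act_proj: "?act g (quot_proj Y x) = quot_proj Y (gs_act Z g x)" if "g \<in> carrier G" for g x
    using inv[OF that] by (simp add: quot_proj_def)
  have "continuous_map (prod_topology (gtop G) ?Q) ?Q (\<lambda>z. ?act (fst z) (snd z))"
  proof (cases "Y = {}")
    case False
    let ?q = "\<lambda>(g, x). (g, quot_proj Y x)"
    have q: "quotient_map (prod_topology (gtop G) ?T) (prod_topology (gtop G) ?Q) ?q"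
      by (intro quotient_map_prod_right quotient_map_quot_proj Y False
          compact_imp_locally_compact_space G disjI1)
    have "continuous_map (prod_topology (gtop G) ?T) ?Q (quot_proj Y \<circ> (\<lambda>(g, x). gs_act Z g x))"
      by (rule continuous_map_compose[OF act continuous_map_quot_proj])
    then have "continuous_map (prod_topology (gtop G) ?T) ?Q ((\<lambda>z. ?act (fst z) (snd z)) \<circ> ?q)"
      by (rule continuous_map_eq) (auto simp: tg act_proj)
    then show ?thesis by (simp add: continuous_compose_quotient_map_eq[OF q])
  next
    case True
    let ?P = "prod_topology (gtop G) ?Q"
    define W where "W b = {z \<in> topspace ?P. (snd z = None) = b}" for b
    have some: "{x \<in> topspace ?T. quot_proj Y x \<in> Some ` topspace ?T} = topspace ?T"
      and none: "{x \<in> topspace ?T. quot_proj Y x \<in> {None}} = {}"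
      using True by (auto simp: quot_proj_def)
    have Qn: "openin ?Q {None}" and Qs: "openin ?Q (Some ` topspace ?T)"
      unfolding openin_quot_topology some none using True by auto
    have "W True = topspace (gtop G) \<times> {None}" "W False = topspace (gtop G) \<times> Some ` topspace ?T"
      using True by (auto simp: W_def topspace_quot_topology)
    then have W: "openin ?P (W b)" for b
      using Qn Qs by (cases b) (simp_all add: openin_prod_Times_iff)
    have the: "continuous_map (subtopology ?Q (Some ` topspace ?T)) ?T the"
      unfolding continuous_map_def
    proof (intro conjI allI impI)
      fix U assume U: "openin ?T U"
      then have "{x \<in> topspace (subtopology ?Q (Some ` topspace ?T)). the x \<in> U} = Some ` U"
        using True openin_subset[OF U] by (auto simp: topspace_quot_topology)
      moreover have "openin ?Q (Some ` U)"
      proof -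
        have "{x \<in> topspace ?T. quot_proj Y x \<in> Some ` U} = U"
          using True openin_subset[OF U] by (auto simp: quot_proj_def)
        then show ?thesis using U True openin_subset[OF U] by (auto simp: openin_quot_topology)
      qed
      ultimately show "openin (subtopology ?Q (Some ` topspace ?T))
          {x \<in> topspace (subtopology ?Q (Some ` topspace ?T)). the x \<in> U}"
        using openin_subset[OF U] by (simp only:) (auto simp: openin_subtopology intro!: exI[of _ "Some ` U"])
    qed (use True in \<open>auto simp: topspace_quot_topology\<close>)
    show ?thesis
    proof (rule pasting_lemma[where I = UNIV and T = W and f = "\<lambda>_ z. ?act (fst z) (snd z)"])
      show "continuous_map (subtopology ?P (W b)) ?Q (\<lambda>z. ?act (fst z) (snd z))" for b
      proof (cases b)
        case True
        show ?thesis
          by (rule continuous_map_eq[of _ _ "\<lambda>_. None"])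
            (use True in \<open>auto simp: W_def topspace_quot_topology\<close>)
      next
        case False
        have s: "continuous_map (subtopology ?P (W b)) (subtopology ?Q (Some ` topspace ?T)) snd"
          using False \<open>Y = {}\<close>
          by (auto simp: continuous_map_in_subtopology continuous_map_from_subtopology
              continuous_map_snd W_def topspace_quot_topology)
        have "continuous_map (subtopology ?P (W b)) (prod_topology (gtop G) ?T)
            (\<lambda>z. (fst z, (the \<circ> snd) z))"
          by (intro continuous_map_pairedI continuous_map_compose[OF s the]
              continuous_map_from_subtopology continuous_map_fst)
        from continuous_map_compose[OF continuous_map_compose[OF this act] continuous_map_quot_proj[of ?T Y]]
        show ?thesis
          by (rule continuous_map_eq) (use False in \<open>auto simp: W_def\<close>)
      qed
    next
      show "openin ?P (W b)" for b by (rule W)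
    qed (auto simp: W_def)
  qed
  moreover have "?act \<one>\<^bsub>G\<^esub> z = z" if "z \<in> topspace ?Q" for z
    using that one by (auto simp: topspace_quot_topology quot_proj_def)
  moreover have "?act (g \<otimes>\<^bsub>G\<^esub> h) z = ?act g (?act h z)"
    if "g \<in> carrier G" "h \<in> carrier G" "z \<in> topspace ?Q" for g h z
    using that mult inY act_proj[of g] by (auto simp: topspace_quot_topology)
  ultimately show ?thesis
    by (simp add: G_space_def quot_gspace_def case_prod_unfold)
qed

lemma G_space_times_ball:
  assumes "G_space G X"
  shows "G_space G (times_ball X q)"
proof -
  let ?P = "prod_topology (gtop G) (prod_topology (gs_top X) (ball_space q))"
  have c: "continuous_map (prod_topology (gtop G) (gs_top X)) (gs_top X) (\<lambda>(g, x). gs_act X g x)"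
    using assms by (simp add: G_space_def)
  have s: "continuous_map ?P (gs_top X) (fst \<circ> snd)" "continuous_map ?P (ball_space q) (snd \<circ> snd)"
    by (rule continuous_map_compose[OF continuous_map_snd continuous_map_fst]
        continuous_map_compose[OF continuous_map_snd continuous_map_snd])+
  have "continuous_map ?P (prod_topology (gtop G) (gs_top X)) (\<lambda>z. (fst z, (fst \<circ> snd) z))"
    by (intro continuous_map_pairedI continuous_map_fst s)
  from continuous_map_pairedI[OF continuous_map_compose[OF this c] s(2)]
  have "continuous_map ?P (prod_topology (gs_top X) (ball_space q))
     (\<lambda>(g, z). case z of (x, t) \<Rightarrow> (gs_act X g x, t))"
    by (simp add: o_def case_prod_unfold)
  then show ?thesis
    using assms by (auto simp: G_space_def times_ball_def)
qed

lemma G_space_K_deg_space: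
  fixes G :: "'g mgroup" and X :: "('g, 'x) gspace"
  assumes G: "topological_group G" "compact_space (gtop G)" "Hausdorff_space (gtop G)"
    and X: "G_space G X"
  shows "G_space G (K_deg_space n X)"
  unfolding K_deg_space_def
proof (rule G_space_quotient[OF G G_space_times_ball[OF X]])
  let ?q = "suspension_degree n"
  show "neg_degree_sub ?q X {} \<subseteq> topspace (gs_top (times_ball X ?q))"
    by (auto simp: neg_degree_sub_def times_ball_def ball_space_def ball_boundary_def)
  have "gs_act X g x \<in> topspace (gs_top X)" if "g \<in> carrier G" "x \<in> topspace (gs_top X)" for g x
    using that G by (intro G_spaceD(4)[OF X]) (auto simp: topological_group_def)
  then show "gs_act (times_ball X ?q) g y \<in> neg_degree_sub ?q X {}"
    if "g \<in> carrier G" "y \<in> neg_degree_sub ?q X {}" for g y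
    using that by (auto simp: neg_degree_sub_def times_ball_def)
qed

section \<open>Rational isomorphisms\<close>

lemma quotient_group_iso:
  assumes N: "N \<lhd> F" and N': "N' \<lhd> F'"
    and \<phi>: "\<phi> \<in> hom F F'" "\<phi> ` N \<subseteq> N'" and \<psi>: "\<psi> \<in> hom F' F" "\<psi> ` N' \<subseteq> N"
    and \<psi>\<phi>: "\<And>x. x \<in> carrier F \<Longrightarrow> \<psi> (\<phi> x) \<in> N #>\<^bsub>F\<^esub> x"
    and \<phi>\<psi>: "\<And>y. y \<in> carrier F' \<Longrightarrow> \<phi> (\<psi> y) \<in> N' #>\<^bsub>F'\<^esub> y"
  shows "(\<lambda>C. \<Union>c\<in>C. N' #>\<^bsub>F'\<^esub> \<phi> c) \<in> iso (F Mod N) (F' Mod N')"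
proof -
  have val: "(\<Union>c\<in>N #>\<^bsub>F\<^esub> x. N' #>\<^bsub>F'\<^esub> \<phi> c) = N' #>\<^bsub>F'\<^esub> \<phi> x"
    if "N \<lhd> F" "N' \<lhd> F'" "\<phi> \<in> hom F F'" "\<phi> ` N \<subseteq> N'" "x \<in> carrier F"
    for N N' \<phi> x and F :: "('p, 'q) monoid_scheme" and F' :: "('r, 's) monoid_scheme"
  proof -
    interpret N: normal N F by fact
    interpret N': normal N' F' by fact
    have "N' #>\<^bsub>F'\<^esub> \<phi> c = N' #>\<^bsub>F'\<^esub> \<phi> x" if c: "c \<in> N #>\<^bsub>F\<^esub> x" for c
    proof -
      obtain m where m: "m \<in> N" "c = m \<otimes>\<^bsub>F\<^esub> x" using c by (auto simp: r_coset_def)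
      then have "\<phi> c = \<phi> m \<otimes>\<^bsub>F'\<^esub> \<phi> x"
        using \<open>\<phi> \<in> hom F F'\<close> \<open>x \<in> carrier F\<close> by (simp add: hom_mult N.subset[THEN subsetD])
      then have "\<phi> c \<in> N' #>\<^bsub>F'\<^esub> \<phi> x" using m \<open>\<phi> ` N \<subseteq> N'\<close> by (auto simp: r_coset_def)
      then show ?thesis
        using N'.repr_independence[OF _ _ N'.subgroup_axioms] hom_in_carrier[OF \<open>\<phi> \<in> hom F F'\<close> \<open>x \<in> carrier F\<close>]
        by metis
    qed
    moreover have "x \<in> N #>\<^bsub>F\<^esub> x" by (rule N.rcos_self[OF \<open>x \<in> carrier F\<close> N.subgroup_axioms])
    ultimately show ?thesis by blast
  qed
  interpret N: normal N F by fact
  interpret N': normal N' F' by fact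
  let ?\<Phi> = "\<lambda>C. \<Union>c\<in>C. N' #>\<^bsub>F'\<^esub> \<phi> c" and ?\<Psi> = "\<lambda>C. \<Union>c\<in>C. N #>\<^bsub>F\<^esub> \<psi> c"
  note v = val[OF N N' \<phi>] and w = val[OF N' N \<psi>]
  have car: "carrier (F Mod N) = (\<lambda>x. N #>\<^bsub>F\<^esub> x) ` carrier F"
    "carrier (F' Mod N') = (\<lambda>x. N' #>\<^bsub>F'\<^esub> x) ` carrier F'"
    by (auto simp: FactGroup_def RCOSETS_def)
  have \<phi>c: "\<phi> x \<in> carrier F'" if "x \<in> carrier F" for x using hom_in_carrier[OF \<phi>(1) that] .
  have \<psi>c: "\<psi> x \<in> carrier F" if "x \<in> carrier F'" for x using hom_in_carrier[OF \<psi>(1) that] .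
  have "?\<Phi> \<in> hom (F Mod N) (F' Mod N')"
  proof (rule homI)
    show "?\<Phi> C \<in> carrier (F' Mod N')" if "C \<in> carrier (F Mod N)" for C
      using that v \<phi>c by (auto simp: car)
    fix C D assume "C \<in> carrier (F Mod N)" "D \<in> carrier (F Mod N)"
    then obtain x y where x: "x \<in> carrier F" "C = N #>\<^bsub>F\<^esub> x" and y: "y \<in> carrier F" "D = N #>\<^bsub>F\<^esub> y"
      by (auto simp: car)
    then have "C \<otimes>\<^bsub>F Mod N\<^esub> D = N #>\<^bsub>F\<^esub> (x \<otimes>\<^bsub>F\<^esub> y)" by (simp add: FactGroup_def N.rcos_sum)
    then have "?\<Phi> (C \<otimes>\<^bsub>F Mod N\<^esub> D) = N' #>\<^bsub>F'\<^esub> (\<phi> x \<otimes>\<^bsub>F'\<^esub> \<phi> y)"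
      using v[of "x \<otimes>\<^bsub>F\<^esub> y"] x y by (simp add: hom_mult[OF \<phi>(1)])
    also have "\<dots> = ?\<Phi> C \<otimes>\<^bsub>F' Mod N'\<^esub> ?\<Phi> D"
      using v x y \<phi>c by (simp add: FactGroup_def N'.rcos_sum)
    finally show "?\<Phi> (C \<otimes>\<^bsub>F Mod N\<^esub> D) = ?\<Phi> C \<otimes>\<^bsub>F' Mod N'\<^esub> ?\<Phi> D" .
  qed
  moreover have "bij_betw ?\<Phi> (carrier (F Mod N)) (carrier (F' Mod N'))"
  proof (rule bij_betw_byWitness[where f' = ?\<Psi>])
    show "\<forall>C\<in>carrier (F Mod N). ?\<Psi> (?\<Phi> C) = C"
    proof
      fix C assume "C \<in> carrier (F Mod N)"
      then obtain x where x: "x \<in> carrier F" "C = N #>\<^bsub>F\<^esub> x" by (auto simp: car)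
      then show "?\<Psi> (?\<Phi> C) = C"
        using v[OF x(1)] w[OF \<phi>c[OF x(1)]]
          N.repr_independence[OF \<psi>\<phi>[OF x(1)] x(1) N.subgroup_axioms] by simp
    qed
    show "\<forall>C\<in>carrier (F' Mod N'). ?\<Phi> (?\<Psi> C) = C"
    proof
      fix C assume "C \<in> carrier (F' Mod N')"
      then obtain x where x: "x \<in> carrier F'" "C = N' #>\<^bsub>F'\<^esub> x" by (auto simp: car)
      then show "?\<Phi> (?\<Psi> C) = C"
        using w[OF x(1)] v[OF \<psi>c[OF x(1)]]
          N'.repr_independence[OF \<phi>\<psi>[OF x(1)] x(1) N'.subgroup_axioms] by simp
    qed
    show "?\<Phi> ` carrier (F Mod N) \<subseteq> carrier (F' Mod N')" using v \<phi>c by (auto simp: car)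
    show "?\<Psi> ` carrier (F' Mod N') \<subseteq> carrier (F Mod N)" using w \<psi>c by (auto simp: car)
  qed
  ultimately show ?thesis by (simp add: iso_def)
qed

lemma frag_extend_of_hom:
  assumes "h ` S \<subseteq> S'"
  shows "frag_extend (\<lambda>p. frag_of (h p)) \<in> hom (free_Abelian_group S) (free_Abelian_group S')"
proof (rule homI)
  fix x assume "x \<in> carrier (free_Abelian_group S)"
  then have "Poly_Mapping.keys x \<subseteq> S" by simp
  then have "Poly_Mapping.keys (frag_extend (\<lambda>p. frag_of (h p)) x) \<subseteq> S'"
    using keys_frag_extend[of "\<lambda>p. frag_of (h p)" x] assms by fastforce
  then show "frag_extend (\<lambda>p. frag_of (h p)) x \<in> carrier (free_Abelian_group S')" by simp
qed (simp add: frag_extend_add)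

context
  fixes A :: "('a, 'm) monoid_scheme" and C :: "('c, 'n) monoid_scheme"
  assumes A: "\<And>x y. \<lbrakk>x \<in> carrier A; y \<in> carrier A\<rbrakk> \<Longrightarrow> x \<otimes>\<^bsub>A\<^esub> y \<in> carrier A"
    and C: "\<And>x y. \<lbrakk>x \<in> carrier C; y \<in> carrier C\<rbrakk> \<Longrightarrow> x \<otimes>\<^bsub>C\<^esub> y \<in> carrier C"
begin

lemma tensor_relations_subgroup:
  "subgroup (tensor_relations A C) (free_Abelian_group (carrier A \<times> carrier C))"
  unfolding tensor_relations_def
  by (rule group.generate_is_subgroup[OF group_free_Abelian_group])
    (use A C in \<open>auto dest!: keys_diff[THEN subsetD]\<close>)

lemma tensor_relations_normal:
  "tensor_relations A C \<lhd> free_Abelian_group (carrier A \<times> carrier C)"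
  by (rule comm_group.subgroup_imp_normal[OF abelian_free_Abelian_group tensor_relations_subgroup])

lemma tensor_relations_arith:
  assumes "r \<in> tensor_relations A C" "s \<in> tensor_relations A C"
  shows "r + s \<in> tensor_relations A C" "r - s \<in> tensor_relations A C"
proof -
  interpret subgroup "tensor_relations A C" "free_Abelian_group (carrier A \<times> carrier C)"
    by (rule tensor_relations_subgroup)
  show "r + s \<in> tensor_relations A C" using m_closed[OF assms] by simp
  have "Poly_Mapping.keys s \<subseteq> carrier A \<times> carrier C"
    using subset assms(2) by (metis carrier_free_Abelian_group_iff subsetD)
  then show "r - s \<in> tensor_relations A C"
    using m_closed[OF assms(1) m_inv_closed[OF assms(2)]] by simp
qed

lemma tensor_relations_zero: "0 \<in> tensor_relations A C"
  using subgroup.one_closed[OF tensor_relations_subgroup] by simp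

end

lemma tensor_relations_left:
  "\<lbrakk>a \<in> carrier A; a' \<in> carrier A; b \<in> carrier C\<rbrakk> \<Longrightarrow>
    frag_of (a \<otimes>\<^bsub>A\<^esub> a', b) - frag_of (a, b) - frag_of (a', b) \<in> tensor_relations A C"
  unfolding tensor_relations_def by (rule generate.incl) blast

lemma tensor_relations_right:
  "\<lbrakk>a \<in> carrier A; b \<in> carrier C; b' \<in> carrier C\<rbrakk> \<Longrightarrow>
    frag_of (a, b \<otimes>\<^bsub>C\<^esub> b') - frag_of (a, b) - frag_of (a, b') \<in> tensor_relations A C"
  unfolding tensor_relations_def by (rule generate.incl) blast

lemma tensor_relations_map:
  assumes A: "\<And>x y. \<lbrakk>x \<in> carrier A; y \<in> carrier A\<rbrakk> \<Longrightarrow> x \<otimes>\<^bsub>A\<^esub> y \<in> carrier A"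
    and A': "\<And>x y. \<lbrakk>x \<in> carrier A'; y \<in> carrier A'\<rbrakk> \<Longrightarrow> x \<otimes>\<^bsub>A'\<^esub> y \<in> carrier A'"
    and C: "\<And>x y. \<lbrakk>x \<in> carrier C; y \<in> carrier C\<rbrakk> \<Longrightarrow> x \<otimes>\<^bsub>C\<^esub> y \<in> carrier C"
    and f: "f \<in> hom A A'" and k: "k \<in> hom C C"
  shows "frag_extend (\<lambda>p. frag_of (f (fst p), k (snd p))) ` tensor_relations A C \<subseteq> tensor_relations A' C"
    (is "?\<phi> ` _ \<subseteq> _")
proof -
  have rel: "?\<phi> r \<in> tensor_relations A' C"
    if "r \<in> {frag_of (a \<otimes>\<^bsub>A\<^esub> a', b) - frag_of (a, b) - frag_of (a', b) | a a' b.
           a \<in> carrier A \<and> a' \<in> carrier A \<and> b \<in> carrier C} \<union>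
        {frag_of (a, b \<otimes>\<^bsub>C\<^esub> b') - frag_of (a, b) - frag_of (a, b') | a b b'.
           a \<in> carrier A \<and> b \<in> carrier C \<and> b' \<in> carrier C}" for r
    using that hom_in_carrier[OF f] hom_in_carrier[OF k]
    by (auto simp: frag_extend_diff hom_mult[OF f] hom_mult[OF k]
        intro!: tensor_relations_left tensor_relations_right)
  have "?\<phi> r \<in> tensor_relations A' C" if "r \<in> tensor_relations A C" for r
    using that unfolding tensor_relations_def[of A C]
  proof (induction rule: generate.induct)
    case one
    then show ?case by (simp add: tensor_relations_zero[OF A' C])
  next
    case (incl r)
    then show ?case by (rule rel)
  next
    case (inv r)
    have "Poly_Mapping.keys r \<subseteq> carrier A \<times> carrier C"
      using inv A C by (auto dest!: keys_diff[THEN subsetD])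
    then show ?case
      using tensor_relations_arith(2)[OF A' C tensor_relations_zero[OF A' C] rel[OF inv]]
      by (simp add: frag_extend_minus)
  next
    case (eng r s)
    then show ?case
      using tensor_relations_arith(1)[OF A' C] by (simp add: frag_extend_add)
  qed
  then show ?thesis by blast
qed

text \<open>
  Both tensors equal \<open>2(x \<otimes> q/2)\<close>.
\<close>

lemma tensor_relations_double:
  assumes M: "\<And>x y. \<lbrakk>x \<in> carrier M; y \<in> carrier M\<rbrakk> \<Longrightarrow> x \<otimes>\<^bsub>M\<^esub> y \<in> carrier M" and x: "x \<in> carrier M"
  shows "frag_of (x \<otimes>\<^bsub>M\<^esub> x, q / 2) - frag_of (x, q) \<in> tensor_relations M rational_group"
    (is "_ \<in> ?R")
proof -
  have Q: "\<And>x y. \<lbrakk>x \<in> carrier rational_group; y \<in> carrier rational_group\<rbrakk> \<Longrightarrow>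
      x \<otimes>\<^bsub>rational_group\<^esub> y \<in> carrier rational_group"
    by (simp add: rational_group_def)
  have "frag_of (x \<otimes>\<^bsub>M\<^esub> x, q / 2) - frag_of (x, q / 2) - frag_of (x, q / 2) \<in> ?R"
    using x by (intro tensor_relations_left) (auto simp: rational_group_def)
  moreover have "frag_of (x, (q / 2) \<otimes>\<^bsub>rational_group\<^esub> (q / 2)) - frag_of (x, q / 2) - frag_of (x, q / 2) \<in> ?R"
    using x by (intro tensor_relations_right) (auto simp: rational_group_def)
  then have "frag_of (x, q) - frag_of (x, q / 2) - frag_of (x, q / 2) \<in> ?R"
    by (simp add: rational_group_def)
  ultimately show ?thesis
    using tensor_relations_arith(2)[OF M Q] by fastforce
qed

text \<open>
  The inverse is \<open>g \<otimes> 1/2\<close>, since \<open>g(f x) \<otimes> q/2 = 2x \<otimes> q/2 = x \<otimes> q\<close>.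
\<close>

lemma tensor_map_rational_iso:
  assumes A: "\<And>x y. \<lbrakk>x \<in> carrier A; y \<in> carrier A\<rbrakk> \<Longrightarrow> x \<otimes>\<^bsub>A\<^esub> y \<in> carrier A"
    and A': "\<And>x y. \<lbrakk>x \<in> carrier A'; y \<in> carrier A'\<rbrakk> \<Longrightarrow> x \<otimes>\<^bsub>A'\<^esub> y \<in> carrier A'"
    and f: "f \<in> hom A A'" and g: "g \<in> hom A' A"
    and gf: "\<And>x. x \<in> carrier A \<Longrightarrow> g (f x) = x \<otimes>\<^bsub>A\<^esub> x"
    and fg: "\<And>y. y \<in> carrier A' \<Longrightarrow> f (g y) = y \<otimes>\<^bsub>A'\<^esub> y"
  shows "tensor_map A' rational_group f \<in> iso (tensor_group A rational_group) (tensor_group A' rational_group)"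
proof -
  let ?Q = rational_group
  have Q: "\<And>x y. \<lbrakk>x \<in> carrier ?Q; y \<in> carrier ?Q\<rbrakk> \<Longrightarrow> x \<otimes>\<^bsub>?Q\<^esub> y \<in> carrier ?Q"
    by (simp add: rational_group_def)
  have id: "(\<lambda>q. q) \<in> hom ?Q ?Q" and half: "(\<lambda>q. q / 2) \<in> hom ?Q ?Q"
    by (auto simp: rational_group_def hom_def add_divide_distrib)
  let ?\<phi> = "frag_extend (\<lambda>p. frag_of (f (fst p), snd p)) :: ('a \<times> rat \<Rightarrow>\<^sub>0 int) \<Rightarrow> _"
  let ?\<psi> = "frag_extend (\<lambda>p. frag_of (g (fst p), snd p / 2)) :: ('c \<times> rat \<Rightarrow>\<^sub>0 int) \<Rightarrow> _"
  have coset: "y \<in> N #>\<^bsub>free_Abelian_group S\<^esub> x" if "y - x \<in> N" for x y :: "'z \<Rightarrow>\<^sub>0 int" and N S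
    using that by (force simp: r_coset_def)
  have 1: "?\<psi> (?\<phi> x) - x \<in> tensor_relations A ?Q" if "Poly_Mapping.keys x \<subseteq> carrier A \<times> carrier ?Q" for x
  proof (rule free_Abelian_group_induct[OF that, where P = "\<lambda>x. ?\<psi> (?\<phi> x) - x \<in> tensor_relations A ?Q"])
    show "?\<psi> (?\<phi> 0) - 0 \<in> tensor_relations A ?Q"
      by (simp add: tensor_relations_zero[OF A Q])
  next
    fix x y assume xy: "?\<psi> (?\<phi> x) - x \<in> tensor_relations A ?Q" "?\<psi> (?\<phi> y) - y \<in> tensor_relations A ?Q"
    have *: "?\<psi> (?\<phi> (x - y)) - (x - y) = (?\<psi> (?\<phi> x) - x) - (?\<psi> (?\<phi> y) - y)"
      by (simp add: frag_extend_diff)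
    show "?\<psi> (?\<phi> (x - y)) - (x - y) \<in> tensor_relations A ?Q"
      unfolding * by (rule tensor_relations_arith(2)[OF A Q xy])
  next
    fix p assume "p \<in> carrier A \<times> carrier ?Q"
    then show "?\<psi> (?\<phi> (frag_of p)) - frag_of p \<in> tensor_relations A ?Q"
      using tensor_relations_double[OF A, of "fst p" "snd p"] by (auto simp: gf)
  qed
  have 2: "?\<phi> (?\<psi> x) - x \<in> tensor_relations A' ?Q" if "Poly_Mapping.keys x \<subseteq> carrier A' \<times> carrier ?Q" for x
  proof (rule free_Abelian_group_induct[OF that, where P = "\<lambda>x. ?\<phi> (?\<psi> x) - x \<in> tensor_relations A' ?Q"])
    show "?\<phi> (?\<psi> 0) - 0 \<in> tensor_relations A' ?Q"
      by (simp add: tensor_relations_zero[OF A' Q])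
  next
    fix x y assume xy: "?\<phi> (?\<psi> x) - x \<in> tensor_relations A' ?Q" "?\<phi> (?\<psi> y) - y \<in> tensor_relations A' ?Q"
    have *: "?\<phi> (?\<psi> (x - y)) - (x - y) = (?\<phi> (?\<psi> x) - x) - (?\<phi> (?\<psi> y) - y)"
      by (simp add: frag_extend_diff)
    show "?\<phi> (?\<psi> (x - y)) - (x - y) \<in> tensor_relations A' ?Q"
      unfolding * by (rule tensor_relations_arith(2)[OF A' Q xy])
  next
    fix p assume "p \<in> carrier A' \<times> carrier ?Q"
    then show "?\<phi> (?\<psi> (frag_of p)) - frag_of p \<in> tensor_relations A' ?Q"
      using tensor_relations_double[OF A', of "fst p" "snd p"] by (auto simp: fg)
  qed
  have "(\<lambda>K. \<Union>c\<in>K. tensor_relations A' ?Q #>\<^bsub>free_Abelian_group (carrier A' \<times> carrier ?Q)\<^esub> ?\<phi> c)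
      \<in> iso (tensor_group A ?Q) (tensor_group A' ?Q)"
    unfolding tensor_group_def
  proof (rule quotient_group_iso[where \<psi> = ?\<psi>])
    show "tensor_relations A ?Q \<lhd> free_Abelian_group (carrier A \<times> carrier ?Q)"
      by (rule tensor_relations_normal[OF A Q])
    show "tensor_relations A' ?Q \<lhd> free_Abelian_group (carrier A' \<times> carrier ?Q)"
      by (rule tensor_relations_normal[OF A' Q])
    show "?\<phi> \<in> hom (free_Abelian_group (carrier A \<times> carrier ?Q)) (free_Abelian_group (carrier A' \<times> carrier ?Q))"
      using hom_in_carrier[OF f] by (intro frag_extend_of_hom) auto
    show "?\<psi> \<in> hom (free_Abelian_group (carrier A' \<times> carrier ?Q)) (free_Abelian_group (carrier A \<times> carrier ?Q))"
      using hom_in_carrier[OF g] by (intro frag_extend_of_hom) (auto simp: rational_group_def)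
    show "?\<phi> ` tensor_relations A ?Q \<subseteq> tensor_relations A' ?Q"
      by (rule tensor_relations_map[OF A A' Q f id])
    show "?\<psi> ` tensor_relations A' ?Q \<subseteq> tensor_relations A ?Q"
      by (rule tensor_relations_map[OF A' A Q g half])
  qed (use 1 2 in \<open>auto intro!: coset\<close>)
  then show ?thesis by (simp add: tensor_map_def[abs_def] case_prod_unfold)
qed

section \<open>Reduced K-groups\<close>

context bundle_setting begin

lemma K_one_mult: "\<one>\<^bsub>K_group G B\<^esub> \<otimes>\<^bsub>K_group G B\<^esub> \<one>\<^bsub>K_group G B\<^esub> = \<one>\<^bsub>K_group G B\<^esub>"
  using K_mult[OF eqv_zero eqv_zero eqv_zero eqv_zero] kclass_diagonal[OF eqv_zero]
    kclass_diagonal[OF eqv_sum[OF eqv_zero eqv_zero]] by simp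

lemma bundle_setting_restrict:
  assumes "\<And>g x. \<lbrakk>g \<in> carrier G; x \<in> topspace (gs_top B); x \<in> S\<rbrakk> \<Longrightarrow> gs_act B g x \<in> S"
  shows "bundle_setting G (sub_gspace B S)"
  by unfold_locales (rule tg, rule G_space_sub[OF tg gsp assms])

lemma additive_map_restrict:
  assumes S: "\<And>g x. \<lbrakk>g \<in> carrier G; x \<in> topspace (gs_top B); x \<in> S\<rbrakk> \<Longrightarrow> gs_act B g x \<in> S"
  shows "additive_map G B G (sub_gspace B S) (restrict_bundle S)"
proof -
  interpret sub: bundle_setting G "sub_gspace B S" by (rule bundle_setting_restrict[OF S])
  show ?thesis
  proof unfold_locales
    show "additive_construction G B G (sub_gspace B S) (restrict_bundle S)"
      by (auto simp: additive_construction_def simp flip: restrict_bundle_sum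
          intro!: equivariant_bundle_restrict[OF tg _ S] bundle_iso_restrict
          intro: equivariant_bundle_imp_vector eqv_sum)
  qed
qed

lemma K_restrict_kclass:
  fixes E0 E1 :: "('e, 'b, 'g) vbundle"
  assumes S: "\<And>g x. \<lbrakk>g \<in> carrier G; x \<in> topspace (gs_top B); x \<in> S\<rbrakk> \<Longrightarrow> gs_act B g x \<in> S"
    and E: "eqv E0" "eqv E1"
  shows "K_map G (sub_gspace B S) (restrict_bundle S) (kclass G B E0 E1) =
    kclass G (sub_gspace B S) (restrict_bundle S E0) (restrict_bundle S E1)"
proof -
  interpret sub: bundle_setting G "sub_gspace B S" by (rule bundle_setting_restrict[OF S])
  obtain S0 S1 :: "('g, 'b) ubundle" where *: "eqv S0" "eqv S1" "bundle_iso G B E0 S0"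
    "bundle_iso G B E1 S1" "kclass G B E0 E1 = kclass G B S0 S1"
    by (rule kclass_ubundle[OF E])
  have "K_map G (sub_gspace B S) (restrict_bundle S) (kclass G B E0 E1) =
      kclass G (sub_gspace B S) (restrict_bundle S S0) (restrict_bundle S S1)"
    unfolding *(5) by (rule additive_map.K_map_kclass[OF additive_map_restrict[OF S] *(1,2)])
  also have "\<dots> = kclass G (sub_gspace B S) (restrict_bundle S E0) (restrict_bundle S E1)"
    using * E
    by (intro sub.kclass_cong equivariant_bundle_restrict[OF tg _ S] bundle_iso_restrict
        equivariant_bundle_imp_vector[of G] bundle_iso_sym[of G B E0] bundle_iso_sym[of G B E1])
  finally show ?thesis .
qed

end

locale magnetic_pointed = magnetic_setting G B a
  for G :: "'g mgroup" and B :: "('g, 'b) gspace" and a :: 'g +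
  fixes b0 :: 'b
  assumes base_fixed: "g \<in> carrier G \<Longrightarrow> gs_act B g b0 = b0"
begin

abbreviation "B0 \<equiv> sub_gspace B {b0}"

lemma invariant_base:
  "\<lbrakk>g \<in> carrier G; x \<in> topspace (gs_top B); x \<in> {b0}\<rbrakk> \<Longrightarrow> gs_act B g x \<in> {b0}"
  "\<lbrakk>g \<in> carrier G0; x \<in> topspace (gs_top B); x \<in> {b0}\<rbrakk> \<Longrightarrow> gs_act B g x \<in> {b0}"
  using base_fixed by auto

sublocale pt: magnetic_setting G B0 a
  by unfold_locales
    (rule tgrp phase_hom phase_continuous G_space_sub[OF gtop B invariant_base(1)] a_odd; assumption?)+

text \<open>
  An equality of bundles, not merely an isomorphism: as \<open>a\<close> fixes the base point, the fibre of the
  pullback over it is taken from the fibre of \<open>F\<close> over it.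
\<close>

lemma restrict_conj_bundle:
  "restrict_bundle {b0} (conj_bundle G B a F) = conj_bundle G B0 a (restrict_bundle {b0} F)"
proof -
  have "{(s, x). proj F s = gs_act B a x} \<inter> {z. snd z \<in> {b0}} =
      ({e. proj F e \<in> {b0}} \<times> {b0}) \<inter> {(s, x). proj F s = gs_act B a x}"
    using base_fixed[OF a_odd(1)] by auto
  then have "subtopology (subtopology (prod_topology (tspace F) (gs_top B)) {(s, x). proj F s = gs_act B a x})
       {z. snd z \<in> {b0}} =
     subtopology (subtopology (prod_topology (tspace F) (gs_top B)) ({e. proj F e \<in> {b0}} \<times> {b0}))
       {(s, x). proj F s = gs_act B a x}"
    by (simp only: subtopology_subtopology)
  then show ?thesis
    by (simp add: restrict_bundle_def conj_bundle_def subtopology_Times)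
qed

lemma restrict_induced_bundle:
  "restrict_bundle {b0} (induced_bundle G B a F) = induced_bundle G B0 a (restrict_bundle {b0} F)"
proof -
  have "restrict_bundle {b0} (induced_bundle G B a F) =
    restrict_bundle {b0} (bundle_sum F (conj_bundle G B a F))\<lparr>vact := vact (induced_bundle G B a F)\<rparr>"
    by (simp add: induced_bundle_def restrict_bundle_def)
  also have "\<dots> = induced_bundle G B0 a (restrict_bundle {b0} F)"
    unfolding restrict_bundle_sum restrict_conj_bundle
    unfolding induced_bundle_def restrict_bundle_simps sub_gspace_simps by simp
  finally show ?thesis .
qed

abbreviation "base_restr \<equiv> K_map G B0 (restrict_bundle {b0})"
abbreviation "base_restr0 \<equiv> K_map G0 B0 (restrict_bundle {b0})"

lemma eqv_base_restr:
  "full.eqv E \<Longrightarrow> pt.full.eqv (restrict_bundle {b0} E)"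
  "even.eqv F \<Longrightarrow> pt.even.eqv (restrict_bundle {b0} F)"
  by (rule equivariant_bundle_restrict[OF gtop _ invariant_base(1)]
      equivariant_bundle_restrict[OF gtop0 _ invariant_base(2)]; assumption)+

lemma base_restr_kclass:
  "\<lbrakk>full.eqv E0; full.eqv E1\<rbrakk> \<Longrightarrow> base_restr (kclass G B E0 E1) =
     kclass G B0 (restrict_bundle {b0} E0) (restrict_bundle {b0} E1)"
  "\<lbrakk>even.eqv F0; even.eqv F1\<rbrakk> \<Longrightarrow> base_restr0 (kclass G0 B F0 F1) =
     kclass G0 B0 (restrict_bundle {b0} F0) (restrict_bundle {b0} F1)"
  by (rule full.K_restrict_kclass[OF invariant_base(1)] even.K_restrict_kclass[OF invariant_base(2)]; assumption)+

lemma base_restr_res: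
  assumes "\<xi> \<in> carrier (K_group G B)"
  shows "base_restr0 (K_res \<xi>) = pt.K_res (base_restr \<xi>)"
  using assms
proof (rule full.carrier_K_groupE)
  fix E0 E1 :: "('g, 'b) ubundle" assume E: "full.eqv E0" "full.eqv E1" "\<xi> = kclass G B E0 E1"
  note R = eqv_base_restr(1)[OF E(1)] eqv_base_restr(1)[OF E(2)]
  show ?thesis
    unfolding E(3) K_res_kclass[OF E(1,2)] base_restr_kclass(1)[OF E(1,2)]
      base_restr_kclass(2)[OF equivariant_bundle_even[OF E(1)] equivariant_bundle_even[OF E(2)]]
      pt.K_res_kclass[OF R] ..
qed

lemma base_restr_ind:
  assumes "\<xi> \<in> carrier (K_group G0 B)"
  shows "base_restr (K_ind \<xi>) = pt.K_ind (base_restr0 \<xi>)"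
  using assms
proof (rule even.carrier_K_groupE)
  fix E0 E1 :: "('g, 'b) ubundle" assume E: "even.eqv E0" "even.eqv E1" "\<xi> = kclass G0 B E0 E1"
  note R = eqv_base_restr(2)[OF E(1)] eqv_base_restr(2)[OF E(2)]
  show ?thesis
    unfolding E(3) additive_map.K_map_kclass[OF additive_map_induced E(1,2)]
      base_restr_kclass(1)[OF equivariant_bundle_induced[OF E(1)] equivariant_bundle_induced[OF E(2)]]
      base_restr_kclass(2)[OF E(1,2)]
      additive_map.K_map_kclass[OF pt.additive_map_induced R] restrict_induced_bundle ..
qed

lemma carrier_reduced:
  "\<xi> \<in> carrier (K_reduced G B b0) \<longleftrightarrow> \<xi> \<in> carrier (K_group G B) \<and> base_restr \<xi> = \<one>\<^bsub>K_group G B0\<^esub>"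
  "\<xi> \<in> carrier (K_reduced G0 B b0) \<longleftrightarrow> \<xi> \<in> carrier (K_group G0 B) \<and> base_restr0 \<xi> = \<one>\<^bsub>K_group G0 B0\<^esub>"
  by (simp_all add: K_reduced_def kernel_def)

lemma mult_reduced [simp]:
  "mult (K_reduced G B b0) = mult (K_group G B)" "mult (K_reduced G0 B b0) = mult (K_group G0 B)"
  by (simp_all add: K_reduced_def)

definition "K_inv = (K_reduced G0 B b0)\<lparr>carrier := {\<xi> \<in> carrier (K_reduced G0 B b0). K_cnj \<xi> = \<xi>}\<rparr>"

lemma K_inv_simps [simp]:
  "mult K_inv = mult (K_group G0 B)"
  "\<xi> \<in> carrier K_inv \<longleftrightarrow> \<xi> \<in> carrier (K_reduced G0 B b0) \<and> K_cnj \<xi> = \<xi>"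
  by (simp_all add: K_inv_def)

lemma K_reduced_closed:
  assumes "\<xi> \<in> carrier (K_reduced G B b0)" "\<eta> \<in> carrier (K_reduced G B b0)"
  shows "\<xi> \<otimes>\<^bsub>K_reduced G B b0\<^esub> \<eta> \<in> carrier (K_reduced G B b0)"
  using assms hom_mult[OF additive_map.K_map_hom[OF full.additive_map_restrict[OF invariant_base(1)]]]
  by (simp add: carrier_reduced full.K_mult_closed pt.full.K_one_mult)

lemma K_inv_closed:
  assumes "\<xi> \<in> carrier K_inv" "\<eta> \<in> carrier K_inv"
  shows "\<xi> \<otimes>\<^bsub>K_inv\<^esub> \<eta> \<in> carrier K_inv"
  using assms hom_mult[OF additive_map.K_map_hom[OF even.additive_map_restrict[OF invariant_base(2)]]]
    hom_mult[OF additive_map.K_map_hom[OF additive_map_conj]]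
  by (simp add: carrier_reduced even.K_mult_closed pt.even.K_one_mult)

lemma K_res_hom: "K_res \<in> hom (K_reduced G B b0) K_inv"
proof (rule homI)
  fix \<xi> assume "\<xi> \<in> carrier (K_reduced G B b0)"
  then show "K_res \<xi> \<in> carrier K_inv"
    using hom_in_carrier[OF additive_map.K_map_hom[OF additive_map_even]] K_cnj_res
    by (simp add: carrier_reduced base_restr_res additive_map.K_map_one[OF pt.additive_map_even])
qed (simp add: carrier_reduced hom_mult[OF additive_map.K_map_hom[OF additive_map_even]])

lemma K_ind_hom: "K_ind \<in> hom K_inv (K_reduced G B b0)"
proof (rule homI)
  fix \<xi> assume "\<xi> \<in> carrier K_inv"
  then show "K_ind \<xi> \<in> carrier (K_reduced G B b0)"
    using hom_in_carrier[OF additive_map.K_map_hom[OF additive_map_induced]]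
    by (simp add: carrier_reduced base_restr_ind additive_map.K_map_one[OF pt.additive_map_induced])
qed (simp add: carrier_reduced hom_mult[OF additive_map.K_map_hom[OF additive_map_induced]])

lemma K_res_rational_iso:
  "tensor_map K_inv rational_group K_res \<in>
     iso (tensor_group (K_reduced G B b0) rational_group) (tensor_group K_inv rational_group)"
proof (rule tensor_map_rational_iso[OF K_reduced_closed K_inv_closed K_res_hom K_ind_hom])
  show "K_ind (K_res \<xi>) = \<xi> \<otimes>\<^bsub>K_reduced G B b0\<^esub> \<xi>" if "\<xi> \<in> carrier (K_reduced G B b0)" for \<xi>
    using that by (simp add: carrier_reduced K_ind_res)
  show "K_res (K_ind \<xi>) = \<xi> \<otimes>\<^bsub>K_inv\<^esub> \<xi>" if "\<xi> \<in> carrier K_inv" for \<xi>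
    using that by (simp add: carrier_reduced K_res_ind)
qed

end

theorem mainTheorem1:
  fixes G :: "'g mgroup" and X :: "('g, 'x) gspace" and n :: int and a :: 'g
  assumes "magnetic_group G"
    and "G_space G X" and "compact_space (gs_top X)"
    and "a \<in> carrier G - carrier (even_part G)"
  shows "K_restriction G n X \<in> hom (K_deg G n X) (K_invariants G a n X) \<and>
    tensor_map (K_invariants G a n X) rational_group (K_restriction G n X)
      \<in> iso (tensor_group (K_deg G n X) rational_group)
            (tensor_group (K_invariants G a n X) rational_group)"
proof -
  have G: "topological_group G" "compact_space (gtop G)" "Hausdorff_space (gtop G)"
    using assms(1) by (auto simp: magnetic_group_def compact_lie_group_def lie_group_def)
  interpret magnetic_pointed G "K_deg_space n X" a None
  proof unfold_locales
    show "topological_group G" by (rule G)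
    show "phase G \<in> hom G (integer_mod_group 2)"
      "continuous_map (gtop G) (discrete_topology (carrier (integer_mod_group 2))) (phase G)"
      using assms(1) by (auto simp: magnetic_group_def epi_def)
    show "G_space G (K_deg_space n X)" by (rule G_space_K_deg_space[OF G assms(2)])
    show "a \<in> carrier G" "phase G a \<noteq> 0" using assms(4) by auto
    show "gs_act (K_deg_space n X) g None = None" for g
      by (simp add: K_deg_space_def quot_gspace_def)
  qed
  have "K_invariants G a n X = K_inv"
    by (simp add: K_invariants_def K_inv_def K_deg_eq K_conj_def)
  then show ?thesis
    using K_res_hom K_res_rational_iso by (simp add: K_deg_eq K_restriction_def)
qed

end
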